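(* Let $\mathfrak{h}$ be a complex Hilbert space with anti-unitary involution $\Gamma$, let $P$ be a basis projection on $\mathfrak{h}$ (an orthogonal projection with $P+\Gamma P\Gamma=\mathbb{1}$), and put $\mathfrak{p}:=P\mathfrak{h}$. Let $\mathfrak{q}\subset\mathfrak{h}$ be a closed $\Gamma$-invariant subspace with orthogonal projection $Q$, put $Q^\perp:=\mathbb{1}-Q$, and assume that $\mathfrak{p}$ and $\mathfrak{q}$ are in generic position. Let $\beta$ and $\alpha$ be the antilinear operators in $\mathfrak{p}$ with graphs $$\mathrm{gra}\,\beta=\{(Pq,P\Gamma q)\mid q\in\mathfrak{q}\},\qquad \mathrm{gra}\,\alpha=\{(Pq^\perp,-P\Gamma q^\perp)\mid q^\perp\in\mathfrak{q}^\perp\},$$ and let $\Delta_{\mathfrak{p}}:=\beta^*\beta$. Then $\Delta_{\mathfrak{p}}$ is a densely defined linear positive self-adjoint operator on $\mathfrak{p}$ with graph $$\mathrm{gra}\,\Delta_{\mathfrak{p}}=\{(PQp,\,PQ^\perp p)\mid p\in\mathfrak{p}\}.$$ Moreover, $\Delta_{\mathfrak{p}}^{-1}=\beta\beta^*=\alpha^*\alpha$. The modular conjugation $J$ of the pair $(\mathcal{M}(\mathfrak{q}),\Omega)$ is given on the one-particle space by $$J(Pq)=\Delta_{\mathfrak{p}}^{1/2}(P\Gamma q),\qquad q\in\mathfrak{q}.$$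
   Context: Anti-unitary involution: $\Gamma$ is antilinear, $\Gamma^2=\mathbb{1}$, and $\langle\Gamma f,\Gamma h\rangle=\langle h,f\rangle$. Scalar products are antilinear in the first and linear in the second argument. Generic position: $\mathfrak{p}\cap\mathfrak{q}=\mathfrak{p}\cap\mathfrak{q}^\perp=\mathfrak{p}^\perp\cap\mathfrak{q}=\mathfrak{p}^\perp\cap\mathfrak{q}^\perp=\{0\}$ (the last two follow from the first two, since $\Gamma\mathfrak{p}=\mathfrak{p}^\perp$ and $\Gamma\mathfrak{q}=\mathfrak{q}$). In this case $q\mapsto Pq$ on $\mathfrak{q}$ and $q^\perp\mapsto Pq^\perp$ on $\mathfrak{q}^\perp$ are injective, so the graphs above define antilinear operators; $\beta$ has dense domain $P\mathfrak{q}$ and $\alpha$ has dense domain $P(\mathfrak{q}^\perp)$. The adjoint of a densely defined antilinear operator $\beta$ is defined by $\langle \beta^*x,y\rangle=\langle\beta y,x\rangle$ for $y\in\mathrm{dom}\,\beta$. Fock representation: $\mathfrak{F}:=\bigoplus_{n=0}^\infty\bigwedge^n\mathfrak{p}$ is the antisymmetric Fock space over $\mathfrak{p}$ (Hilbert space direct sum), with Fock vacuum $\Omega$ (unit vector in the $n=0$ summand) and one-particle subspace $\mathfrak{p}$ ($n=1$). For $p\in\mathfrak{p}$ let $c(p)^*\Omega=p$, $c(p)^*(p_1\wedge\dots\wedge p_n)=p\wedge p_1\wedge\dots\wedge p_n$, $c(p)\Omega=0$, $c(p)(p_1\wedge\dots\wedge p_n)=\sum_{r=1}^n(-1)^{r-1}\langle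 p,p_r\rangle\,p_1\wedge\dots\wedge\widehat{p_r}\wedge\dots\wedge p_n$. Put $a(f):=c(P\Gamma f)^*+c(Pf)$ for $f\in\mathfrak{h}$. Let $\mathcal{M}(\mathfrak{q}):=\{a(q)\mid q\in\mathfrak{q}\}''\subset\mathcal{L}(\mathfrak{F})$. In generic position $\Omega$ is cyclic and separating for $\mathcal{M}(\mathfrak{q})$. Modular conjugation: the Tomita operator $S$ of $(\mathcal{M}(\mathfrak{q}),\Omega)$ is the closure of the antilinear operator $M\Omega\mapsto M^*\Omega$, $M\in\mathcal{M}(\mathfrak{q})$. Its polar decomposition is $S=J\Delta^{1/2}$ with $\Delta$ positive self-adjoint and $J$ antiunitary; $J$ is the modular conjugation. *)

theory Defs
  imports "HOL-Analysis.Analysis"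
begin

section \<open>Complex Hilbert spaces\<close>

text \<open>
  The scalar product is antilinear in the first and linear in the second argument; its real
  part is the real inner product of the library, so norm and topology are the library's.
\<close>

class chilbert_space = real_inner + complete_space +
  fixes scaleC :: "complex \<Rightarrow> 'a \<Rightarrow> 'a" (infixr \<open>*\<^sub>C\<close> 75)
    and cinner :: "'a \<Rightarrow> 'a \<Rightarrow> complex"
  assumes scaleC_add_right: "c *\<^sub>C (x + y) = c *\<^sub>C x + c *\<^sub>C y"
    and scaleC_add_left: "(c + d) *\<^sub>C x = c *\<^sub>C x + d *\<^sub>C x"
    and scaleC_scaleC: "c *\<^sub>C d *\<^sub>C x = (c * d) *\<^sub>C x"
    and scaleR_scaleC: "r *\<^sub>R x = complex_of_real r *\<^sub>C x"
    and cinner_commute: "cinner x y = cnj (cinner y x)"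
    and cinner_add_right: "cinner x (y + z) = cinner x y + cinner x z"
    and cinner_scaleC_right: "cinner x (c *\<^sub>C y) = c * cinner x y"
    and Re_cinner: "Re (cinner x y) = inner x y"

global_interpretation complex_vector:
  vector_space "scaleC :: complex \<Rightarrow> 'a \<Rightarrow> 'a::chilbert_space"
proof
  show "1 *\<^sub>C x = x" for x :: 'a
    using scaleR_scaleC[of 1 x] by simp
qed (simp_all add: scaleC_add_right scaleC_add_left scaleC_scaleC)

abbreviation csubspace :: "'a::chilbert_space set \<Rightarrow> bool"
  where "csubspace \<equiv> complex_vector.subspace"

abbreviation cspan :: "'a::chilbert_space set \<Rightarrow> 'a set"
  where "cspan \<equiv> complex_vector.span"

lemma cinner_add_left: "cinner (x + y) z = cinner x z + cinner y z"
  by (simp add: cinner_commute[of _ z] cinner_add_right)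

lemma cinner_scaleC_left: "cinner (c *\<^sub>C x) y = cnj c * cinner x y"
  by (simp add: cinner_commute[of _ y] cinner_scaleC_right)

lemma cinner_zero_right [simp]: "cinner x 0 = 0"
  using cinner_add_right[of x 0 0] by simp

lemma cinner_zero_left [simp]: "cinner 0 x = 0"
  using cinner_add_left[of 0 0 x] by simp

lemma cinner_diff_right: "cinner x (y - z) = cinner x y - cinner x z"
  using cinner_add_right[of x "y - z" z] by simp

lemma cinner_sum_right: "cinner x (\<Sum>i\<in>A. f i) = (\<Sum>i\<in>A. cinner x (f i))"
  by (induction A rule: infinite_finite_induct) (simp_all add: cinner_add_right)

lemma cinner_sum_left: "cinner (\<Sum>i\<in>A. f i) x = (\<Sum>i\<in>A. cinner (f i) x)"
  by (induction A rule: infinite_finite_induct) (simp_all add: cinner_add_left)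

lemma cinner_self: "cinner x x = complex_of_real ((norm x)\<^sup>2)"
proof (rule complex_eqI)
  show "Im (cinner x x) = Im (complex_of_real ((norm x)\<^sup>2))"
    using arg_cong[OF cinner_commute[of x x], of Im] by simp
qed (simp add: Re_cinner power2_norm_eq_inner)

lemma norm_scaleC: "norm (c *\<^sub>C x) = cmod c * norm x"
proof -
  have "complex_of_real ((norm (c *\<^sub>C x))\<^sup>2) = c * cnj c * cinner x x"
    unfolding cinner_self[symmetric] by (simp add: cinner_scaleC_left cinner_scaleC_right)
  also have "\<dots> = complex_of_real ((cmod c * norm x)\<^sup>2)"
    by (simp add: cinner_self complex_norm_square[symmetric] power_mult_distrib)
  finally have "complex_of_real ((norm (c *\<^sub>C x))\<^sup>2) = complex_of_real ((cmod c * norm x)\<^sup>2)" .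
  then have "(norm (c *\<^sub>C x))\<^sup>2 = (cmod c * norm x)\<^sup>2"
    using of_real_eq_iff by blast
  then show ?thesis
    by (metis norm_ge_zero power2_eq_imp_eq mult_nonneg_nonneg)
qed

lemma norm_cinner_le: "cmod (cinner x y) \<le> norm x * norm y"
proof (cases "cinner x y = 0")
  case False
  define c where "c = cnj (cinner x y) / cmod (cinner x y)"
  have "cmod c = 1"
    using False by (simp add: c_def norm_divide)
  have "complex_of_real (cmod (cinner x y)) = cinner x (c *\<^sub>C y)"
    using False by (simp add: c_def cinner_scaleC_right complex_norm_square[symmetric]
        power2_eq_square mult.commute[of "cnj _"])
  then have "cmod (cinner x y) = inner x (c *\<^sub>C y)"
    by (metis Re_cinner Re_complex_of_real)
  also have "\<dots> \<le> norm x * norm (c *\<^sub>C y)"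
    by (rule norm_cauchy_schwarz)
  finally show ?thesis
    by (simp add: norm_scaleC \<open>cmod c = 1\<close>)
qed simp

instantiation prod :: (chilbert_space, chilbert_space) chilbert_space
begin

definition scaleC_prod_def: "c *\<^sub>C z = (c *\<^sub>C fst z, c *\<^sub>C snd z)"

definition cinner_prod_def: "cinner z w = cinner (fst z) (fst w) + cinner (snd z) (snd w)"

instance
proof
  fix c d :: complex and r :: real and x y z :: "'a \<times> 'b"
  show "c *\<^sub>C (x + y) = c *\<^sub>C x + c *\<^sub>C y"
    by (simp add: scaleC_prod_def scaleC_add_right)
  show "(c + d) *\<^sub>C x = c *\<^sub>C x + d *\<^sub>C x"
    by (simp add: scaleC_prod_def scaleC_add_left)
  show "c *\<^sub>C d *\<^sub>C x = (c * d) *\<^sub>C x"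
    by (simp add: scaleC_prod_def scaleC_scaleC)
  show "r *\<^sub>R x = complex_of_real r *\<^sub>C x"
    by (simp add: scaleC_prod_def scaleR_prod_def scaleR_scaleC)
  show "cinner x y = cnj (cinner y x)"
    using cinner_commute[of "fst x" "fst y"] cinner_commute[of "snd x" "snd y"]
    by (simp add: cinner_prod_def)
  show "cinner x (y + z) = cinner x y + cinner x z"
    by (simp add: cinner_prod_def cinner_add_right)
  show "cinner x (c *\<^sub>C y) = c * cinner x y"
    by (simp add: cinner_prod_def scaleC_prod_def cinner_scaleC_right distrib_left)
  show "Re (cinner x y) = inner x y"
    by (simp add: cinner_prod_def inner_prod_def Re_cinner)
qed

end


section \<open>Square-summable families\<close>

typedef 'i ell2 = "{f :: 'i \<Rightarrow> complex. (\<lambda>i. (cmod (f i))\<^sup>2) summable_on UNIV}"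
  morphisms ell2_coeff Abs_ell2
  by (rule exI[of _ "\<lambda>_. 0"]) simp

setup_lifting type_definition_ell2

lemma ell2_eqI: "(\<And>i. ell2_coeff x i = ell2_coeff y i) \<Longrightarrow> x = y"
  by (simp add: ell2_coeff_inject[symmetric] fun_eq_iff)

lemma ell2_coeff_square_summable: "(\<lambda>i. (cmod (ell2_coeff x i))\<^sup>2) summable_on UNIV"
  using ell2_coeff[of x] by simp

lemma square_summable_prod:
  fixes f g :: "'i \<Rightarrow> complex"
  assumes "(\<lambda>i. (cmod (f i))\<^sup>2) summable_on UNIV" "(\<lambda>i. (cmod (g i))\<^sup>2) summable_on UNIV"
  shows "(\<lambda>i. cnj (f i) * g i) summable_on UNIV"
proof (rule abs_summable_summable)
  have "(\<lambda>i. (cmod (f i))\<^sup>2 + (cmod (g i))\<^sup>2) summable_on UNIV"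
    by (intro summable_on_add assms)
  then show "(\<lambda>i. norm (cnj (f i) * g i)) summable_on UNIV"
  proof (rule summable_on_comparison_test)
    fix i
    have "2 * cmod (f i) * cmod (g i) \<le> (cmod (f i))\<^sup>2 + (cmod (g i))\<^sup>2"
      by (rule sum_squares_bound)
    moreover have "0 \<le> cmod (f i) * cmod (g i)"
      by simp
    ultimately show "norm (cnj (f i) * g i) \<le> (cmod (f i))\<^sup>2 + (cmod (g i))\<^sup>2"
      unfolding norm_mult complex_mod_cnj by linarith
  qed simp
qed

lemma square_summable_add:
  fixes f g :: "'i \<Rightarrow> complex"
  assumes "(\<lambda>i. (cmod (f i))\<^sup>2) summable_on UNIV" "(\<lambda>i. (cmod (g i))\<^sup>2) summable_on UNIV"
  shows "(\<lambda>i. (cmod (f i + g i))\<^sup>2) summable_on UNIV"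
proof -
  have "(\<lambda>i. 2 * (cmod (f i))\<^sup>2 + 2 * (cmod (g i))\<^sup>2) summable_on UNIV"
    by (intro summable_on_add summable_on_cmult_right assms)
  then show ?thesis
  proof (rule summable_on_comparison_test)
    fix i
    have "(cmod (f i + g i))\<^sup>2 \<le> (cmod (f i) + cmod (g i))\<^sup>2"
      by (simp add: norm_triangle_ineq power_mono)
    also have "\<dots> \<le> 2 * (cmod (f i))\<^sup>2 + 2 * (cmod (g i))\<^sup>2"
      using sum_squares_bound[of "cmod (f i)" "cmod (g i)"] by (simp add: power2_sum)
    finally show "(cmod (f i + g i))\<^sup>2 \<le> 2 * (cmod (f i))\<^sup>2 + 2 * (cmod (g i))\<^sup>2" .
  qed simp
qed

lemma square_summable_cmult:
  fixes f :: "'i \<Rightarrow> complex"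
  assumes "(\<lambda>i. (cmod (f i))\<^sup>2) summable_on UNIV"
  shows "(\<lambda>i. (cmod (c * f i))\<^sup>2) summable_on UNIV"
  unfolding norm_mult power_mult_distrib by (intro summable_on_cmult_right assms)

instantiation ell2 :: (type) real_inner
begin

lift_definition zero_ell2 :: "'a ell2" is "\<lambda>_. 0"
  by simp

lift_definition plus_ell2 :: "'a ell2 \<Rightarrow> 'a ell2 \<Rightarrow> 'a ell2" is "\<lambda>f g i. f i + g i"
  by (rule square_summable_add)

lift_definition uminus_ell2 :: "'a ell2 \<Rightarrow> 'a ell2" is "\<lambda>f i. - f i"
  by simp

lift_definition scaleR_ell2 :: "real \<Rightarrow> 'a ell2 \<Rightarrow> 'a ell2" is "\<lambda>r f i. complex_of_real r * f i"
  by (rule square_summable_cmult)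

definition minus_ell2 :: "'a ell2 \<Rightarrow> 'a ell2 \<Rightarrow> 'a ell2"
  where "x - y = x + - y" for x y :: "'a ell2"

definition inner_ell2 :: "'a ell2 \<Rightarrow> 'a ell2 \<Rightarrow> real"
  where "inner x y = Re (\<Sum>\<^sub>\<infinity>i. cnj (ell2_coeff x i) * ell2_coeff y i)" for x y :: "'a ell2"

definition norm_ell2 :: "'a ell2 \<Rightarrow> real"
  where "norm x = sqrt (inner x x)" for x :: "'a ell2"

definition dist_ell2 :: "'a ell2 \<Rightarrow> 'a ell2 \<Rightarrow> real"
  where "dist x y = norm (x - y)" for x y :: "'a ell2"

definition sgn_ell2 :: "'a ell2 \<Rightarrow> 'a ell2"
  where "sgn x = scaleR (inverse (norm x)) x" for x :: "'a ell2"

definition uniformity_ell2 :: "('a ell2 \<times> 'a ell2) filter"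
  where "uniformity_ell2 = (INF e\<in>{0<..}. principal {(x, y). dist (x::'a ell2) y < e})"

definition open_ell2 :: "'a ell2 set \<Rightarrow> bool"
  where "open_ell2 U \<longleftrightarrow> (\<forall>x\<in>U. \<forall>\<^sub>F (x', y) in uniformity. x' = x \<longrightarrow> y \<in> U)"

instance
proof
  fix x y z :: "'a ell2" and r s :: real and U :: "'a ell2 set"
  note [simp] = zero_ell2.rep_eq plus_ell2.rep_eq uminus_ell2.rep_eq scaleR_ell2.rep_eq
  have summ: "(\<lambda>i. cnj (ell2_coeff u i) * ell2_coeff v i) summable_on UNIV" for u v :: "'a ell2"
    by (intro square_summable_prod ell2_coeff_square_summable)
  have self: "inner u u = (\<Sum>\<^sub>\<infinity>i. (cmod (ell2_coeff u i))\<^sup>2)" for u :: "'a ell2"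
  proof -
    have "inner u u = (\<Sum>\<^sub>\<infinity>i. Re (cnj (ell2_coeff u i) * ell2_coeff u i))"
      unfolding inner_ell2_def by (rule infsum_Re[symmetric, OF summ])
    also have "(\<lambda>i. Re (cnj (ell2_coeff u i) * ell2_coeff u i)) = (\<lambda>i. (cmod (ell2_coeff u i))\<^sup>2)"
      unfolding cmod_power2 by (simp add: power2_eq_square)
    finally show ?thesis .
  qed
  show "x + y + z = x + (y + z)" by (rule ell2_eqI) simp
  show "x + y = y + x" by (rule ell2_eqI) simp
  show "0 + x = x" by (rule ell2_eqI) simp
  show "- x + x = 0" by (rule ell2_eqI) simp
  show "x - y = x + - y" by (fact minus_ell2_def)
  show "r *\<^sub>R (x + y) = r *\<^sub>R x + r *\<^sub>R y" by (rule ell2_eqI) (simp add: distrib_left)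
  show "(r + s) *\<^sub>R x = r *\<^sub>R x + s *\<^sub>R x" by (rule ell2_eqI) (simp add: distrib_right)
  show "r *\<^sub>R s *\<^sub>R x = (r * s) *\<^sub>R x" by (rule ell2_eqI) simp
  show "1 *\<^sub>R x = x" by (rule ell2_eqI) simp
  show "dist x y = norm (x - y)" by (fact dist_ell2_def)
  show "sgn x = inverse (norm x) *\<^sub>R x" by (fact sgn_ell2_def)
  show "uniformity = (INF e\<in>{0<..}. principal {(x, y). dist (x::'a ell2) y < e})"
    by (fact uniformity_ell2_def)
  show "open U \<longleftrightarrow> (\<forall>x\<in>U. \<forall>\<^sub>F (x', y) in uniformity. x' = x \<longrightarrow> y \<in> U)"
    by (fact open_ell2_def)
  show "inner x y = inner y x"
  proof -
    have "(\<Sum>\<^sub>\<infinity>i. cnj (ell2_coeff x i) * ell2_coeff y i) = (\<Sum>\<^sub>\<infinity>i. cnj (cnj (ell2_coeff y i) * ell2_coeff x i))"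
      by (simp add: mult.commute)
    also have "\<dots> = cnj (\<Sum>\<^sub>\<infinity>i. cnj (ell2_coeff y i) * ell2_coeff x i)"
      by (rule infsum_cnj)
    finally show ?thesis
      by (simp add: inner_ell2_def)
  qed
  show "inner (x + y) z = inner x z + inner y z"
    by (simp add: inner_ell2_def distrib_right infsum_add summ)
  show "inner (r *\<^sub>R x) y = r * inner x y"
    by (simp add: inner_ell2_def mult.assoc infsum_cmult_right')
  show "0 \<le> inner x x"
    unfolding self by (rule infsum_nonneg) simp
  show "inner x x = 0 \<longleftrightarrow> x = 0"
  proof
    assume "inner x x = 0"
    then have "(cmod (ell2_coeff x i))\<^sup>2 \<le> 0" for i
      using finite_sum_le_infsum[OF ell2_coeff_square_summable[of x], of "{i}"] by (simp add: self)
    then show "x = 0"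
      by (intro ell2_eqI) simp
  next
    assume "x = 0"
    then show "inner x x = 0"
      by (simp add: self)
  qed
  show "norm x = sqrt (inner x x)" by (fact norm_ell2_def)
qed

end

lemma norm_ell2_square: "(norm x)\<^sup>2 = (\<Sum>\<^sub>\<infinity>i. (cmod (ell2_coeff x i))\<^sup>2)"
proof -
  have "(norm x)\<^sup>2 = (\<Sum>\<^sub>\<infinity>i. Re (cnj (ell2_coeff x i) * ell2_coeff x i))"
    unfolding power2_norm_eq_inner inner_ell2_def
    by (rule infsum_Re[symmetric,
          OF square_summable_prod[OF ell2_coeff_square_summable ell2_coeff_square_summable]])
  also have "(\<lambda>i. Re (cnj (ell2_coeff x i) * ell2_coeff x i)) = (\<lambda>i. (cmod (ell2_coeff x i))\<^sup>2)"
    unfolding cmod_power2 by (simp add: power2_eq_square)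
  finally show ?thesis .
qed

lemma ell2_coeff_minus: "ell2_coeff (x - y) i = ell2_coeff x i - ell2_coeff y i"
  unfolding minus_ell2_def plus_ell2.rep_eq uminus_ell2.rep_eq by simp

lemma sum_ell2_coeff_le_norm: "finite F \<Longrightarrow> (\<Sum>i\<in>F. (cmod (ell2_coeff x i))\<^sup>2) \<le> (norm x)\<^sup>2"
  unfolding norm_ell2_square by (intro finite_sum_le_infsum ell2_coeff_square_summable) auto

lemma ell2_coeff_le_norm: "cmod (ell2_coeff x i) \<le> norm x"
  using sum_ell2_coeff_le_norm[of "{i}" x] by (simp add: power2_le_iff_abs_le)

instance ell2 :: (type) complete_space
proof
  fix X :: "nat \<Rightarrow> 'a ell2"
  assume X: "Cauchy X"
  have "Cauchy (\<lambda>n. ell2_coeff (X n) i)" for i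
  proof (rule CauchyI)
    fix e :: real
    assume "0 < e"
    with X obtain N where "\<forall>m\<ge>N. \<forall>n\<ge>N. norm (X m - X n) < e"
      unfolding Cauchy_iff by blast
    then show "\<exists>N. \<forall>m\<ge>N. \<forall>n\<ge>N. norm (ell2_coeff (X m) i - ell2_coeff (X n) i) < e"
      by (metis ell2_coeff_le_norm ell2_coeff_minus order_le_less_trans)
  qed
  moreover define L where "L i = lim (\<lambda>n. ell2_coeff (X n) i)" for i
  ultimately have L: "(\<lambda>n. ell2_coeff (X n) i) \<longlonglongrightarrow> L i" for i
    by (simp add: Cauchy_convergent_iff convergent_LIMSEQ_iff)
  have bound: "\<exists>N. \<forall>m\<ge>N. \<forall>F. finite F \<longrightarrow> (\<Sum>i\<in>F. (cmod (ell2_coeff (X m) i - L i))\<^sup>2) \<le> e\<^sup>2"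
    if "0 < e" for e
  proof -
    from X that obtain N where N: "\<And>m n. m \<ge> N \<Longrightarrow> n \<ge> N \<Longrightarrow> norm (X m - X n) < e"
      unfolding Cauchy_iff by blast
    have "(\<Sum>i\<in>F. (cmod (ell2_coeff (X m) i - L i))\<^sup>2) \<le> e\<^sup>2" if "m \<ge> N" "finite F" for m F
    proof (rule LIMSEQ_le_const2)
      show "(\<lambda>n. \<Sum>i\<in>F. (cmod (ell2_coeff (X m) i - ell2_coeff (X n) i))\<^sup>2)
          \<longlonglongrightarrow> (\<Sum>i\<in>F. (cmod (ell2_coeff (X m) i - L i))\<^sup>2)"
        by (intro tendsto_intros L)
      have "(\<Sum>i\<in>F. (cmod (ell2_coeff (X m) i - ell2_coeff (X n) i))\<^sup>2) \<le> e\<^sup>2" if "n \<ge> N" for n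
      proof -
        have "(\<Sum>i\<in>F. (cmod (ell2_coeff (X m) i - ell2_coeff (X n) i))\<^sup>2) \<le> (norm (X m - X n))\<^sup>2"
          using sum_ell2_coeff_le_norm[OF \<open>finite F\<close>, of "X m - X n"] by (simp add: ell2_coeff_minus)
        also have "\<dots> \<le> e\<^sup>2"
          using N[OF \<open>m \<ge> N\<close> \<open>n \<ge> N\<close>] by (intro power_mono) simp_all
        finally show ?thesis .
      qed
      then show "\<exists>N. \<forall>n\<ge>N. (\<Sum>i\<in>F. (cmod (ell2_coeff (X m) i - ell2_coeff (X n) i))\<^sup>2) \<le> e\<^sup>2"
        by blast
    qed
    then show ?thesis
      by blast
  qed
  obtain N where N: "\<And>F. finite F \<Longrightarrow> (\<Sum>i\<in>F. (cmod (ell2_coeff (X N) i - L i))\<^sup>2) \<le> 1"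
    using bound[of 1] by auto
  have "(\<lambda>i. (cmod (ell2_coeff (X N) i - L i))\<^sup>2) summable_on UNIV"
    by (rule nonneg_bdd_above_summable_on) (auto intro!: bdd_aboveI[of _ 1] N)
  from square_summable_add[OF ell2_coeff_square_summable[of "X N"] square_summable_cmult[OF this, of "-1"]]
  have "(\<lambda>i. (cmod (L i))\<^sup>2) summable_on UNIV"
    by simp
  then have Y: "ell2_coeff (Abs_ell2 L) = L"
    by (simp add: Abs_ell2_inverse)
  have "X \<longlonglongrightarrow> Abs_ell2 L"
  proof (rule metric_LIMSEQ_I)
    fix e :: real
    assume "0 < e"
    then obtain N where N: "\<And>m F. m \<ge> N \<Longrightarrow> finite F \<Longrightarrow>
        (\<Sum>i\<in>F. (cmod (ell2_coeff (X m) i - L i))\<^sup>2) \<le> (e/2)\<^sup>2"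
      using bound[of "e/2"] by auto
    have "dist (X m) (Abs_ell2 L) < e" if "m \<ge> N" for m
    proof -
      have "(norm (X m - Abs_ell2 L))\<^sup>2 \<le> (e/2)\<^sup>2"
        unfolding norm_ell2_square
        by (rule infsum_le_finite_sums[OF ell2_coeff_square_summable]) (simp add: ell2_coeff_minus Y N that)
      then have "norm (X m - Abs_ell2 L) \<le> e/2"
        using \<open>0 < e\<close> by (simp add: power2_le_iff_abs_le)
      then show ?thesis
        using \<open>0 < e\<close> by (simp add: dist_norm)
    qed
    then show "\<exists>N. \<forall>m\<ge>N. dist (X m) (Abs_ell2 L) < e"
      by blast
  qed
  then show "convergent X"
    by (rule convergentI)
qed

instantiation ell2 :: (type) chilbert_space
begin

lift_definition scaleC_ell2 :: "complex \<Rightarrow> 'a ell2 \<Rightarrow> 'a ell2" is "\<lambda>c f i. c * f i"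
  by (rule square_summable_cmult)

definition cinner_ell2 :: "'a ell2 \<Rightarrow> 'a ell2 \<Rightarrow> complex"
  where "cinner x y = (\<Sum>\<^sub>\<infinity>i. cnj (ell2_coeff x i) * ell2_coeff y i)" for x y :: "'a ell2"

instance
proof
  fix x y z :: "'a ell2" and c d :: complex and r :: real
  note [simp] = plus_ell2.rep_eq scaleR_ell2.rep_eq scaleC_ell2.rep_eq
  show "c *\<^sub>C (x + y) = c *\<^sub>C x + c *\<^sub>C y" by (rule ell2_eqI) (simp add: distrib_left)
  show "(c + d) *\<^sub>C x = c *\<^sub>C x + d *\<^sub>C x" by (rule ell2_eqI) (simp add: distrib_right)
  show "c *\<^sub>C d *\<^sub>C x = (c * d) *\<^sub>C x" by (rule ell2_eqI) simp
  show "r *\<^sub>R x = complex_of_real r *\<^sub>C x" by (rule ell2_eqI) simp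
  show "cinner x (y + z) = cinner x y + cinner x z"
    by (simp add: cinner_ell2_def distrib_left infsum_add square_summable_prod ell2_coeff_square_summable)
  show "cinner x (c *\<^sub>C y) = c * cinner x y"
    by (simp add: cinner_ell2_def mult.left_commute infsum_cmult_right')
  show "Re (cinner x y) = inner x y"
    by (simp add: cinner_ell2_def inner_ell2_def)
  have "(\<Sum>\<^sub>\<infinity>i. cnj (ell2_coeff x i) * ell2_coeff y i) = (\<Sum>\<^sub>\<infinity>i. cnj (cnj (ell2_coeff y i) * ell2_coeff x i))"
    by (simp add: mult.commute)
  also have "\<dots> = cnj (\<Sum>\<^sub>\<infinity>i. cnj (ell2_coeff y i) * ell2_coeff x i)"
    by (rule infsum_cnj)
  finally show "cinner x y = cnj (cinner y x)"
    by (simp add: cinner_ell2_def)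
qed

end


section \<open>Tensors and wedge products\<close>

definition orthonormal :: "'a::chilbert_space set \<Rightarrow> bool"
  where "orthonormal B \<longleftrightarrow> (\<forall>b\<in>B. \<forall>c\<in>B. cinner b c = (if b = c then 1 else 0))"

definition orthonormal_basis :: "'a::chilbert_space set \<Rightarrow> bool"
  where "orthonormal_basis B \<longleftrightarrow> orthonormal B \<and> (\<forall>x. (\<forall>b\<in>B. cinner b x = 0) \<longrightarrow> x = 0)"

definition onb :: "'a::chilbert_space set"
  where "onb = (SOME B. orthonormal_basis B)"

lemma ex_orthonormal_basis: "\<exists>B :: 'a::chilbert_space set. orthonormal_basis B"
proof -
  have "\<exists>M\<in>Collect orthonormal. \<forall>X\<in>Collect orthonormal. M \<subseteq> X \<longrightarrow> X = (M :: 'a set)"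
  proof (rule subset_Zorn')
    fix C :: "'a set set"
    assume C: "subset.chain (Collect orthonormal) C"
    have "cinner b c = (if b = c then 1 else 0)" if "b \<in> \<Union>C" "c \<in> \<Union>C" for b c
    proof -
      from that obtain X Y where XY: "X \<in> C" "Y \<in> C" "b \<in> X" "c \<in> Y"
        by blast
      with C have "X \<subseteq> Y \<or> Y \<subseteq> X" "orthonormal X" "orthonormal Y"
        by (auto simp: subset_chain_def)
      with XY show ?thesis
        unfolding orthonormal_def by blast
    qed
    then show "\<Union>C \<in> Collect orthonormal"
      by (simp add: orthonormal_def)
  qed
  then obtain M :: "'a set" where M: "orthonormal M"
    and max: "\<And>X. orthonormal X \<Longrightarrow> M \<subseteq> X \<Longrightarrow> X = M"
    by blast
  have "x = 0" if x: "\<forall>b\<in>M. cinner b x = 0" for x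
  proof (rule ccontr)
    assume "x \<noteq> 0"
    define e where "e = complex_of_real (1 / norm x) *\<^sub>C x"
    have "cinner e e = 1"
      using \<open>x \<noteq> 0\<close> by (simp add: cinner_self e_def norm_scaleC norm_divide)
    moreover have "cinner b e = 0" "cinner e b = 0" if "b \<in> M" for b
      using x that cinner_commute[of e b] by (simp_all add: e_def cinner_scaleC_right)
    ultimately have "orthonormal (insert e M)" "e \<notin> M"
      using M by (auto simp: orthonormal_def)
    with max show False
      by blast
  qed
  with M show ?thesis
    unfolding orthonormal_basis_def by blast
qed

lemma onb: "orthonormal_basis onb"
  unfolding onb_def using ex_orthonormal_basis by (rule someI_ex)

lemma cinner_onb: "b \<in> onb \<Longrightarrow> c \<in> onb \<Longrightarrow> cinner b c = (if b = c then 1 else 0)"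
  using onb unfolding orthonormal_basis_def orthonormal_def by blast

lemma onb_complete: "(\<And>b. b \<in> onb \<Longrightarrow> cinner b x = 0) \<Longrightarrow> x = 0"
  using onb unfolding orthonormal_basis_def by blast

definition onb_coeff :: "'a::chilbert_space \<Rightarrow> 'a \<Rightarrow> complex"
  where "onb_coeff x b = (if b \<in> onb then cinner b x else 0)"

lemma cinner_onb_sum:
  assumes "finite S" "S \<subseteq> onb" "b \<in> onb"
  shows "cinner b (\<Sum>c\<in>S. f c *\<^sub>C c) = (if b \<in> S then f b else 0)"
proof -
  have "cinner b (\<Sum>c\<in>S. f c *\<^sub>C c) = (\<Sum>c\<in>S. if b = c then f c else 0)"
    unfolding cinner_sum_right
    by (intro sum.cong refl) (use assms in \<open>auto simp: cinner_scaleC_right cinner_onb\<close>)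
  then show ?thesis
    using assms(1) by simp
qed

lemma norm_onb_sum:
  assumes "finite S" "S \<subseteq> onb"
  shows "(norm (\<Sum>c\<in>S. f c *\<^sub>C c))\<^sup>2 = (\<Sum>c\<in>S. (cmod (f c))\<^sup>2)"
proof -
  have "complex_of_real ((norm (\<Sum>c\<in>S. f c *\<^sub>C c))\<^sup>2)
      = (\<Sum>b\<in>S. cnj (f b) * cinner b (\<Sum>c\<in>S. f c *\<^sub>C c))"
    by (subst cinner_self[symmetric], subst cinner_sum_left) (simp add: cinner_scaleC_left)
  also have "\<dots> = (\<Sum>b\<in>S. complex_of_real ((cmod (f b))\<^sup>2))"
  proof (rule sum.cong)
    fix b
    assume "b \<in> S"
    then show "cnj (f b) * cinner b (\<Sum>c\<in>S. f c *\<^sub>C c) = complex_of_real ((cmod (f b))\<^sup>2)"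
      using cinner_onb_sum[OF assms, of b f] assms(2)
      by (simp add: subset_iff complex_norm_square[symmetric] mult.commute)
  qed simp
  finally show ?thesis
    unfolding of_real_sum[symmetric] of_real_eq_iff .
qed

lemma bessel:
  assumes "finite S"
  shows "(\<Sum>b\<in>S. (cmod (onb_coeff x b))\<^sup>2) \<le> (norm x)\<^sup>2"
proof -
  define T where "T = S \<inter> onb"
  have T: "finite T" "T \<subseteq> onb"
    using assms by (auto simp: T_def)
  define s where "s = (\<Sum>b\<in>T. cinner b x *\<^sub>C b)"
  have n: "(norm s)\<^sup>2 = (\<Sum>b\<in>T. (cmod (cinner b x))\<^sup>2)"
    unfolding s_def by (rule norm_onb_sum[OF T])
  have "cinner s x = complex_of_real ((norm s)\<^sup>2)"
    unfolding n unfolding s_def cinner_sum_left of_real_sum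
    by (intro sum.cong refl)
      (simp add: cinner_scaleC_left complex_norm_square[symmetric] mult.commute)
  then have "(norm s)\<^sup>2 = inner s x"
    by (metis Re_cinner Re_complex_of_real)
  then have "norm s * norm s \<le> norm s * norm x"
    using norm_cauchy_schwarz[of s x] by (simp add: power2_eq_square)
  then have "norm s \<le> norm x"
    by (cases "norm s = 0") (simp_all add: mult_le_cancel_left)
  then have "(norm s)\<^sup>2 \<le> (norm x)\<^sup>2"
    by (simp add: power_mono)
  moreover have "(\<Sum>b\<in>S. (cmod (onb_coeff x b))\<^sup>2) = (\<Sum>b\<in>T. (cmod (cinner b x))\<^sup>2)"
    unfolding T_def by (rule sum.mono_neutral_cong_right) (use assms in \<open>auto simp: onb_coeff_def\<close>)
  ultimately show ?thesis
    using n by simp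
qed

lemma onb_coeff_square_summable: "(\<lambda>b. (cmod (onb_coeff x b))\<^sup>2) summable_on UNIV"
  by (rule nonneg_bdd_above_summable_on) (auto intro!: bdd_aboveI[of _ "(norm x)\<^sup>2"] bessel)

lemma onb_coeff_norm: "(\<Sum>\<^sub>\<infinity>b. (cmod (onb_coeff x b))\<^sup>2) = (norm x)\<^sup>2"
proof -
  define h where "h b = (cmod (onb_coeff x b))\<^sup>2" for b
  define m where "m = (\<Sum>\<^sub>\<infinity>b. h b)"
  have h: "(h has_sum m) UNIV"
    unfolding m_def h_def by (rule has_sum_infsum[OF onb_coeff_square_summable])
  have h0: "h b \<ge> 0" for b
    by (simp add: h_def)
  have le: "sum h F \<le> m" if "finite F" for F
    using finite_sum_le_infsum[of h UNIV F] h h0 that by (auto simp: m_def summable_on_def)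
  have "\<exists>G. finite G \<and> m - inverse (real (Suc n)) < sum h G" for n
  proof -
    have "\<forall>\<^sub>F G in finite_subsets_at_top UNIV. m - inverse (real (Suc n)) < sum h G"
      using h unfolding has_sum_def by (rule order_tendstoD) simp
    then show ?thesis
      unfolding eventually_finite_subsets_at_top by blast
  qed
  then obtain G where G: "\<And>n. finite (G n)" "\<And>n. m - inverse (real (Suc n)) < sum h (G n)"
    by metis
  define F where "F n = (\<Union>k\<le>n. G k) \<inter> onb" for n
  have F: "finite (F n)" "F n \<subseteq> onb" for n
    using G by (auto simp: F_def)
  have F_mono: "F k \<subseteq> F n" if "k \<le> n" for k n
    using that unfolding F_def by (auto dest: order_trans)
  have F_large: "m - inverse (real (Suc n)) < sum h (F n)" for n
  proof -
    have "sum h (G n) = sum h (G n \<inter> onb)"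
      by (rule sum.mono_neutral_right) (use G in \<open>auto simp: h_def onb_coeff_def\<close>)
    also have "\<dots> \<le> sum h (F n)"
      by (rule sum_mono2) (use F h0 in \<open>auto simp: F_def\<close>)
    finally show ?thesis
      using G(2)[of n] by linarith
  qed
  define s where "s n = (\<Sum>b\<in>F n. onb_coeff x b *\<^sub>C b)" for n
  have diff: "(norm (s n - s k))\<^sup>2 < inverse (real (Suc k))" if "k \<le> n" for k n
  proof -
    have "s n - s k = (\<Sum>b\<in>F n - F k. onb_coeff x b *\<^sub>C b)"
      unfolding s_def using sum_diff[OF F(1) F_mono[OF that]] by metis
    then have "(norm (s n - s k))\<^sup>2 = sum h (F n - F k)"
      unfolding h_def using norm_onb_sum[of "F n - F k" "onb_coeff x"] F by auto
    also have "\<dots> = sum h (F n) - sum h (F k)"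
      by (rule sum_diff[OF F(1) F_mono[OF that]])
    finally show ?thesis
      using le[OF F(1), of n] F_large[of k] by linarith
  qed
  have "Cauchy s"
  proof (rule metric_CauchyI)
    fix e :: real
    assume "0 < e"
    then obtain N where N: "inverse (real (Suc N)) < (e/2)\<^sup>2"
      using reals_Archimedean[of "(e/2)\<^sup>2"] by auto
    have *: "dist (s n) (s N) < e/2" if "n \<ge> N" for n
    proof -
      have "(norm (s n - s N))\<^sup>2 < (e/2)\<^sup>2"
        using diff[OF that] N by linarith
      then show ?thesis
        using \<open>0 < e\<close> power2_less_imp_less[of "norm (s n - s N)" "e/2"] by (simp add: dist_norm)
    qed
    have "dist (s k) (s n) < e" if "k \<ge> N" "n \<ge> N" for k n
      using *[OF that(1)] *[OF that(2)] by (rule dist_triangle_half_l)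
    then show "\<exists>M. \<forall>k\<ge>M. \<forall>n\<ge>M. dist (s k) (s n) < e"
      by blast
  qed
  then obtain y where y: "s \<longlonglongrightarrow> y"
    using Cauchy_convergent convergentD by blast
  have lim: "(\<lambda>n. cinner b (s n)) \<longlonglongrightarrow> cinner b y" for b
  proof (rule tendstoI)
    fix e :: real
    assume "0 < e"
    then have "0 < e / (norm b + 1)"
      by (simp add: add_nonneg_pos)
    then have "\<forall>\<^sub>F n in sequentially. dist (s n) y < e / (norm b + 1)"
      using y tendstoD by blast
    then show "\<forall>\<^sub>F n in sequentially. dist (cinner b (s n)) (cinner b y) < e"
    proof (rule eventually_mono)
      fix n
      assume a: "dist (s n) y < e / (norm b + 1)"
      have "dist (cinner b (s n)) (cinner b y) \<le> norm b * norm (s n - y)"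
        using norm_cinner_le[of b "s n - y"] by (simp add: dist_norm cinner_diff_right)
      also have "\<dots> \<le> (norm b + 1) * dist (s n) y"
        by (simp add: dist_norm mult_right_mono)
      also have "\<dots> < e"
        using a by (simp add: pos_less_divide_eq add_nonneg_pos mult.commute)
      finally show "dist (cinner b (s n)) (cinner b y) < e" .
    qed
  qed
  have "cinner b (x - y) = 0" if b: "b \<in> onb" for b
  proof (cases "\<exists>k. b \<in> F k")
    case True
    then obtain k where k: "b \<in> F k" ..
    have "\<forall>\<^sub>F n in sequentially. cinner b (s n) = cinner b x"
      using eventually_ge_at_top[of k]
    proof (rule eventually_mono)
      fix n
      assume "k \<le> n"
      then have "b \<in> F n"
        using k F_mono by blast
      then show "cinner b (s n) = cinner b x"
        unfolding s_def cinner_onb_sum[OF F b] using b by (simp add: onb_coeff_def)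
    qed
    then have "(\<lambda>n. cinner b (s n)) \<longlonglongrightarrow> cinner b x"
      by (rule tendsto_eventually)
    then show ?thesis
      using lim LIMSEQ_unique by (auto simp: cinner_diff_right)
  next
    case False
    then have "cinner b (s n) = 0" for n
      unfolding s_def cinner_onb_sum[OF F b] by auto
    then have "cinner b y = 0"
      using lim[of b] by (simp add: LIMSEQ_const_iff)
    moreover have "h b \<le> inverse (real (Suc n))" for n
    proof -
      have "h b + sum h (F n) = sum h (insert b (F n))"
        using False F by simp
      also have "\<dots> \<le> m"
        by (intro le) (use F in simp)
      finally show ?thesis
        using F_large[of n] by linarith
    qed
    then have "h b \<le> 0"
      by (meson not_le reals_Archimedean)
    then have "cinner b x = 0"
      using b by (simp add: h_def onb_coeff_def)
    ultimately show ?thesis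
      by (simp add: cinner_diff_right)
  qed
  then have "x - y = 0"
    by (rule onb_complete)
  then have "s \<longlonglongrightarrow> x"
    using y by simp
  then have "(\<lambda>n. (norm (s n))\<^sup>2) \<longlonglongrightarrow> (norm x)\<^sup>2"
    by (intro tendsto_intros)
  moreover have "(\<lambda>n. (norm (s n))\<^sup>2) \<longlonglongrightarrow> m"
  proof (rule tendsto_sandwich)
    have eq: "(norm (s n))\<^sup>2 = sum h (F n)" for n
      unfolding s_def h_def by (rule norm_onb_sum[OF F])
    show "\<forall>\<^sub>F n in sequentially. m - inverse (real (Suc n)) \<le> (norm (s n))\<^sup>2"
      unfolding eq using F_large by (simp add: less_imp_le)
    show "\<forall>\<^sub>F n in sequentially. (norm (s n))\<^sup>2 \<le> m"
      unfolding eq using le F by simp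
    show "(\<lambda>n. m - inverse (real (Suc n))) \<longlonglongrightarrow> m"
      using tendsto_diff[OF tendsto_const LIMSEQ_inverse_real_of_nat] by simp
  qed simp
  ultimately show ?thesis
    using LIMSEQ_unique unfolding m_def h_def by blast
qed

lemma parseval:
  "((\<lambda>b. cnj (onb_coeff x b) * onb_coeff y b) has_sum cinner x y) UNIV"
proof -
  define U where "U z = Abs_ell2 (onb_coeff z)" for z :: 'a
  have U: "ell2_coeff (U z) = onb_coeff z" for z
    by (simp add: U_def Abs_ell2_inverse onb_coeff_square_summable)
  have U_add: "U (u + v) = U u + U v" for u v
    by (rule ell2_eqI) (simp add: U plus_ell2.rep_eq onb_coeff_def cinner_add_right)
  have U_scaleC: "U (c *\<^sub>C u) = c *\<^sub>C U u" for c u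
    by (rule ell2_eqI) (simp add: U scaleC_ell2.rep_eq onb_coeff_def cinner_scaleC_right)
  have "(norm (U z))\<^sup>2 = (norm z)\<^sup>2" for z
    by (simp add: norm_ell2_square U onb_coeff_norm)
  then have norm_U: "norm (U z) = norm z" for z
    by (metis norm_ge_zero power2_eq_imp_eq)
  have inner_U: "inner (U u) (U v) = inner u v" for u v
    unfolding dot_norm by (simp add: U_add[symmetric] norm_U)
  have Im: "Im (cinner u v) = - inner u (\<i> *\<^sub>C v)" for u v :: "'b::chilbert_space"
    by (simp add: Re_cinner[symmetric] cinner_scaleC_right)
  have "cinner (U x) (U y) = cinner x y"
    by (rule complex_eqI) (simp_all add: Re_cinner inner_U Im U_scaleC[symmetric])
  moreover have "(\<lambda>b. cnj (onb_coeff x b) * onb_coeff y b) summable_on UNIV"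
    by (intro square_summable_prod onb_coeff_square_summable)
  ultimately show ?thesis
    by (simp add: cinner_ell2_def U has_sum_iff)
qed

text \<open>
  The full Fock space over the Hilbert space \<open>'a\<close> is realised as the space of square-summable
  families indexed by finite words over an orthonormal basis: \<open>x\<^sub>1 \<otimes> \<dots> \<otimes> x\<^sub>n\<close> is the family
  of its coordinates \<open>\<Prod>i. \<langle>b\<^sub>i, x\<^sub>i\<rangle>\<close> with respect to the product basis.
\<close>

definition tensor_coeff :: "'a::chilbert_space list \<Rightarrow> 'a list \<Rightarrow> complex"
  where "tensor_coeff xs bs =
    (if length bs = length xs \<and> set bs \<subseteq> onb then \<Prod>i<length xs. cinner (bs ! i) (xs ! i) else 0)"

lemma tensor_coeff_Nil: "tensor_coeff [] bs = (if bs = [] then 1 else 0)"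
  by (simp add: tensor_coeff_def)

lemma tensor_coeff_Cons_Nil: "tensor_coeff (x # xs) [] = 0"
  by (simp add: tensor_coeff_def)

lemma tensor_coeff_Cons: "tensor_coeff (x # xs) (b # bs) = onb_coeff x b * tensor_coeff xs bs"
  by (auto simp: tensor_coeff_def onb_coeff_def prod.lessThan_Suc_shift simp del: prod.lessThan_Suc)

lemma has_sum_times:
  fixes f :: "'i \<Rightarrow> complex" and g :: "'j \<Rightarrow> complex"
  assumes f: "(\<lambda>a. norm (f a)) summable_on UNIV" "(f has_sum s) UNIV"
    and g: "(\<lambda>b. norm (g b)) summable_on UNIV" "(g has_sum t) UNIV"
  shows "(\<lambda>p. norm (case p of (a, b) \<Rightarrow> f a * g b)) summable_on UNIV"
    and "((\<lambda>(a, b). f a * g b) has_sum s * t) UNIV"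
proof -
  have "(\<lambda>p. norm (case p of (a, b) \<Rightarrow> f a * g b)) summable_on UNIV \<times> UNIV"
    unfolding Infinite_Sum.abs_summable_on_Sigma_iff
    by (auto simp: norm_mult infsum_cmult_right' abs_mult intro!: summable_on_cmult_right
        summable_on_cmult_left f g)
  then show abs: "(\<lambda>p. norm (case p of (a, b) \<Rightarrow> f a * g b)) summable_on UNIV"
    by simp
  have "((\<lambda>(a, b). f a * g b) has_sum s * t) (UNIV \<times> UNIV)"
  proof (rule has_sum_SigmaI)
    show "((\<lambda>b. case (a, b) of (a, b) \<Rightarrow> f a * g b) has_sum f a * t) UNIV" for a
      using has_sum_cmult_right[OF g(2), of "f a"] by simp
    show "((\<lambda>a. f a * t) has_sum s * t) UNIV"
      by (rule has_sum_cmult_left[OF f(2)])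
    show "(\<lambda>(a, b). f a * g b) summable_on UNIV \<times> UNIV"
      using abs_summable_summable[OF abs] by simp
  qed
  then show "((\<lambda>(a, b). f a * g b) has_sum s * t) UNIV"
    by simp
qed

lemma has_sum_list_Cons:
  fixes f :: "'i list \<Rightarrow> 'b::{comm_monoid_add, topological_space}"
  assumes "f [] = 0"
  shows "(f has_sum s) UNIV \<longleftrightarrow> ((\<lambda>(a, as). f (a # as)) has_sum s) UNIV"
proof -
  have "(f has_sum s) UNIV \<longleftrightarrow> (f has_sum s) ((\<lambda>(a, as). a # as) ` UNIV)"
  proof (rule has_sum_cong_neutral)
    fix as :: "'i list"
    assume as: "as \<in> UNIV - (\<lambda>(a, as). a # as) ` UNIV"
    show "f as = 0"
    proof (cases as)
      case (Cons b bs)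
      then have "as = (\<lambda>(a, as). a # as) (b, bs)"
        by simp
      with as show ?thesis
        by blast
    qed (simp add: assms)
  qed auto
  also have "\<dots> \<longleftrightarrow> ((\<lambda>(a, as). f (a # as)) has_sum s) UNIV"
    by (subst has_sum_reindex) (auto simp: inj_on_def o_def case_prod_unfold)
  finally show ?thesis .
qed

lemma has_sum_Nil_indicator:
  "((\<lambda>bs. if bs = [] then 1 else 0 :: 'b::{comm_monoid_add, topological_space, one}) has_sum 1) UNIV"
  using has_sum_finite[of "{[]}" "\<lambda>_. 1 :: 'b"]
  by (subst has_sum_cong_neutral[where T = "{[]}" and g = "\<lambda>_. 1"]) auto

lemma tensor_coeff_has_sum:
  assumes "length xs = length ys"
  shows "(\<lambda>bs. norm (cnj (tensor_coeff xs bs) * tensor_coeff ys bs)) summable_on UNIV"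
    and "((\<lambda>bs. cnj (tensor_coeff xs bs) * tensor_coeff ys bs)
      has_sum (\<Prod>i<length xs. cinner (xs ! i) (ys ! i))) UNIV"
  using assms
proof (induction xs ys rule: list_induct2)
  case Nil
  have sq: "cnj (tensor_coeff [] bs) * tensor_coeff [] bs = (if bs = [] then 1 else 0)" for bs :: "'a list"
    by (simp add: tensor_coeff_Nil)
  have norm_sq: "norm (if bs = [] then 1 else 0 :: complex) = (if bs = [] then 1 else 0)" for bs :: "'a list"
    by simp
  {
    case 1
    show ?case
      unfolding sq norm_sq by (rule has_sum_imp_summable[OF has_sum_Nil_indicator])
  next
    case 2
    show ?case
      unfolding sq using has_sum_Nil_indicator by simp
  }
next
  case (Cons x xs y ys)
  have abs: "(\<lambda>b. norm (cnj (onb_coeff x b) * onb_coeff y b)) summable_on UNIV"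
    using has_sum_imp_summable[OF parseval[of x y]] by (simp add: summable_on_iff_abs_summable_on_complex)
  note prod = has_sum_times[OF abs parseval Cons.IH]
  have eq: "(\<lambda>(a, as). cnj (tensor_coeff (x # xs) (a # as)) * tensor_coeff (y # ys) (a # as))
      = (\<lambda>(a, as). (cnj (onb_coeff x a) * onb_coeff y a) * (cnj (tensor_coeff xs as) * tensor_coeff ys as))"
    by (auto simp: tensor_coeff_Cons)
  {
    case 1
    have "(\<lambda>(a, as). norm (cnj (tensor_coeff (x # xs) (a # as)) * tensor_coeff (y # ys) (a # as))) summable_on UNIV"
      using prod(1) unfolding eq[symmetric] by (simp add: case_prod_unfold)
    then show ?case
      unfolding summable_on_def by (subst has_sum_list_Cons) (simp_all add: tensor_coeff_Cons_Nil)
  next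
    case 2
    have "((\<lambda>(a, as). cnj (tensor_coeff (x # xs) (a # as)) * tensor_coeff (y # ys) (a # as)) has_sum
        (\<Prod>i<length (x # xs). cinner ((x # xs) ! i) ((y # ys) ! i))) UNIV"
      using prod(2) unfolding eq by (simp add: prod.lessThan_Suc_shift del: prod.lessThan_Suc)
    then show ?case
      by (subst has_sum_list_Cons) (simp_all add: tensor_coeff_Cons_Nil)
  }
qed

lift_definition tensor :: "'a::chilbert_space list \<Rightarrow> 'a list ell2" is tensor_coeff
proof -
  fix xs :: "'a list"
  have "(\<lambda>bs. (cmod (tensor_coeff xs bs))\<^sup>2) = (\<lambda>bs. norm (cnj (tensor_coeff xs bs) * tensor_coeff xs bs))"
    by (simp add: norm_mult power2_eq_square)
  then show "(\<lambda>bs. (cmod (tensor_coeff xs bs))\<^sup>2) summable_on UNIV"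
    using tensor_coeff_has_sum(1)[of xs xs] by simp
qed

lemma cinner_tensor:
  "cinner (tensor xs) (tensor ys) =
    (if length xs = length ys then \<Prod>i<length xs. cinner (xs ! i) (ys ! i) else 0)"
proof (cases "length xs = length ys")
  case True
  then show ?thesis
    using infsumI[OF tensor_coeff_has_sum(2)[OF True]] by (simp add: cinner_ell2_def tensor.rep_eq)
next
  case False
  then have "(\<lambda>bs. cnj (tensor_coeff xs bs) * tensor_coeff ys bs) = (\<lambda>_. 0)"
    by (auto simp: tensor_coeff_def)
  then show ?thesis
    unfolding cinner_ell2_def tensor.rep_eq using False by simp
qed

text \<open>
  The normalisation makes the scalar product of two wedge products the determinant of the matrix
  of scalar products, see \<open>cinner_wedge\<close>; in particular \<open>wedge\<close> does not
  depend on the choice of the orthonormal basis up to unitary equivalence.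
\<close>

definition wedge :: "'a::chilbert_space list \<Rightarrow> 'a list ell2"
  where "wedge xs = complex_of_real (1 / sqrt (fact (length xs))) *\<^sub>C
    (\<Sum>\<sigma> | \<sigma> permutes {..<length xs}.
      of_int (sign \<sigma>) *\<^sub>C tensor (map (\<lambda>i. xs ! \<sigma> i) [0..<length xs]))"

lemma cinner_wedge:
  "cinner (wedge xs) (wedge ys) =
    (if length xs = length ys
     then \<Sum>\<sigma> | \<sigma> permutes {..<length xs}. of_int (sign \<sigma>) * (\<Prod>i<length xs. cinner (xs ! i) (ys ! \<sigma> i))
     else 0)"
proof (cases "length xs = length ys")
  case False
  then show ?thesis
    by (simp add: wedge_def cinner_scaleC_left cinner_scaleC_right cinner_sum_left cinner_sum_right cinner_tensor)
next
  case True
  define n where "n = length xs"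
  define S where "S = {\<sigma>. \<sigma> permutes {..<n}}"
  define D where "D = (\<Sum>\<rho>\<in>S. of_int (sign \<rho>) * (\<Prod>i<n. cinner (xs ! i) (ys ! \<rho> i)))"
  have n: "length ys = n"
    using True by (simp add: n_def)
  have "(\<Sum>\<tau>\<in>S. of_int (sign \<sigma>) * (of_int (sign \<tau>) * (\<Prod>i<n. cinner (xs ! \<sigma> i) (ys ! \<tau> i)))) = D"
    if \<sigma>: "\<sigma> \<in> S" for \<sigma>
  proof -
    have perm: "\<sigma> permutes {..<n}"
      using \<sigma> by (simp add: S_def)
    have "(\<Sum>\<tau>\<in>S. of_int (sign \<sigma>) * (of_int (sign \<tau>) * (\<Prod>i<n. cinner (xs ! \<sigma> i) (ys ! \<tau> i))))
        = (\<Sum>\<rho>\<in>S. of_int (sign \<sigma>) * (of_int (sign (\<rho> \<circ> \<sigma>)) * (\<Prod>i<n. cinner (xs ! \<sigma> i) (ys ! (\<rho> \<circ> \<sigma>) i))))"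
      unfolding S_def by (rule sum_permutations_compose_right[OF perm])
    also have "\<dots> = D"
      unfolding D_def
    proof (rule sum.cong[OF refl])
      fix \<rho>
      assume "\<rho> \<in> S"
      then have "permutation \<rho>" "permutation \<sigma>"
        using perm by (auto simp: S_def intro: permutes_imp_permutation)
      then have "sign (\<rho> \<circ> \<sigma>) = sign \<rho> * sign \<sigma>"
        by (rule sign_compose)
      moreover have "sign \<sigma> * sign \<sigma> = 1"
        by (simp add: sign_def)
      ultimately have "sign \<sigma> * sign (\<rho> \<circ> \<sigma>) = sign \<rho>"
        by (simp add: mult.left_commute)
      then have "of_int (sign \<sigma>) * of_int (sign (\<rho> \<circ> \<sigma>)) = (of_int (sign \<rho>) :: complex)"
        by (simp flip: of_int_mult)
      moreover have "(\<Prod>i<n. cinner (xs ! \<sigma> i) (ys ! (\<rho> \<circ> \<sigma>) i)) = (\<Prod>i<n. cinner (xs ! i) (ys ! \<rho> i))"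
        using prod.permute[OF perm, of "\<lambda>i. cinner (xs ! i) (ys ! \<rho> i)"] by (simp add: o_def)
      ultimately show "of_int (sign \<sigma>) * (of_int (sign (\<rho> \<circ> \<sigma>)) * (\<Prod>i<n. cinner (xs ! \<sigma> i) (ys ! (\<rho> \<circ> \<sigma>) i)))
          = of_int (sign \<rho>) * (\<Prod>i<n. cinner (xs ! i) (ys ! \<rho> i))"
        by (simp add: mult.assoc[symmetric])
    qed
    finally show ?thesis .
  qed
  then have "(\<Sum>\<sigma>\<in>S. \<Sum>\<tau>\<in>S. of_int (sign \<sigma>) * (of_int (sign \<tau>) * (\<Prod>i<n. cinner (xs ! \<sigma> i) (ys ! \<tau> i))))
      = of_nat (card S) * D"
    by simp
  also have "card S = fact n"
    unfolding S_def by (rule card_permutations) simp_all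
  finally have sum: "(\<Sum>\<sigma>\<in>S. \<Sum>\<tau>\<in>S. of_int (sign \<sigma>) * (of_int (sign \<tau>) * (\<Prod>i<n. cinner (xs ! \<sigma> i) (ys ! \<tau> i))))
      = of_nat (fact n) * D" .
  have "cinner (wedge xs) (wedge ys) = complex_of_real (1 / sqrt (fact n)) * complex_of_real (1 / sqrt (fact n)) *
      (\<Sum>\<sigma>\<in>S. \<Sum>\<tau>\<in>S. of_int (sign \<sigma>) * (of_int (sign \<tau>) * (\<Prod>i<n. cinner (xs ! \<sigma> i) (ys ! \<tau> i))))"
    unfolding wedge_def n_def[symmetric] n S_def[symmetric]
    by (subst sum.swap)
      (simp add: cinner_scaleC_left cinner_scaleC_right cinner_sum_left cinner_sum_right
        cinner_tensor sum_distrib_left mult.left_commute)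
  also have "\<dots> = D"
    unfolding sum by (simp flip: of_real_mult)
  finally show ?thesis
    using True by (simp add: D_def S_def n_def)
qed


section \<open>Operators in a closed subspace\<close>

text \<open>
  An operator (in general unbounded and only partially defined) in a closed subspace \<open>H\<close> is
  identified with its graph. With the library's composition of relations, \<open>S O T\<close> is the graph
  of the operator product \<open>T S\<close>, and \<open>T\<inverse>\<close> is the graph of the inverse.
\<close>

definition linear_operator_on :: "'a::chilbert_space set \<Rightarrow> ('a \<times> 'a) set \<Rightarrow> bool"
  where "linear_operator_on H T \<longleftrightarrow> T \<subseteq> H \<times> H \<and> csubspace T \<and> single_valued T"

definition antilinear_operator_on :: "'a::chilbert_space set \<Rightarrow> ('a \<times> 'a) set \<Rightarrow> bool"
  where "antilinear_operator_on H T \<longleftrightarrow> T \<subseteq> H \<times> H \<and> single_valued T \<and> (0, 0) \<in> T \<and>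
    (\<forall>(x, y)\<in>T. \<forall>(x', y')\<in>T. (x + x', y + y') \<in> T) \<and>
    (\<forall>c. \<forall>(x, y)\<in>T. (c *\<^sub>C x, cnj c *\<^sub>C y) \<in> T)"

definition densely_defined_on :: "'a::chilbert_space set \<Rightarrow> ('a \<times> 'a) set \<Rightarrow> bool"
  where "densely_defined_on H T \<longleftrightarrow> H \<subseteq> closure (Domain T)"

definition adjoint_on :: "'a::chilbert_space set \<Rightarrow> ('a \<times> 'a) set \<Rightarrow> ('a \<times> 'a) set"
  where "adjoint_on H T = {(x, z) \<in> H \<times> H. \<forall>(y, w)\<in>T. cinner z y = cinner x w}"

definition antilinear_adjoint_on :: "'a::chilbert_space set \<Rightarrow> ('a \<times> 'a) set \<Rightarrow> ('a \<times> 'a) set"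
  where "antilinear_adjoint_on H T = {(x, z) \<in> H \<times> H. \<forall>(y, w)\<in>T. cinner z y = cinner w x}"

definition selfadjoint_on :: "'a::chilbert_space set \<Rightarrow> ('a \<times> 'a) set \<Rightarrow> bool"
  where "selfadjoint_on H T \<longleftrightarrow>
    linear_operator_on H T \<and> densely_defined_on H T \<and> adjoint_on H T = T"

definition positive_operator :: "('a::chilbert_space \<times> 'a) set \<Rightarrow> bool"
  where "positive_operator T \<longleftrightarrow> (\<forall>(x, y)\<in>T. cinner x y \<in> \<real> \<and> 0 \<le> Re (cinner x y))"

text \<open>The positive self-adjoint square root of a positive self-adjoint operator.\<close>

definition sqrt_on :: "'a::chilbert_space set \<Rightarrow> ('a \<times> 'a) set \<Rightarrow> ('a \<times> 'a) set"
  where "sqrt_on H T = (THE R. selfadjoint_on H R \<and> positive_operator R \<and> R O R = T)"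

definition bounded_operator_on :: "'a::chilbert_space set \<Rightarrow> ('a \<times> 'a) set \<Rightarrow> bool"
  where "bounded_operator_on H T \<longleftrightarrow>
    linear_operator_on H T \<and> Domain T = H \<and> (\<exists>K. \<forall>(x, y)\<in>T. norm y \<le> K * norm x)"

definition antiunitary_on :: "'a::chilbert_space set \<Rightarrow> ('a \<times> 'a) set \<Rightarrow> bool"
  where "antiunitary_on H J \<longleftrightarrow> antilinear_operator_on H J \<and> Domain J = H \<and> Range J = H \<and>
    (\<forall>(x, y)\<in>J. \<forall>(x', y')\<in>J. cinner y y' = cinner x' x)"

definition commutant_on :: "'a::chilbert_space set \<Rightarrow> ('a \<times> 'a) set set \<Rightarrow> ('a \<times> 'a) set set"
  where "commutant_on H X = {T. bounded_operator_on H T \<and> (\<forall>S\<in>X. S O T = T O S)}"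

definition tomita_operator ::
    "'a::chilbert_space set \<Rightarrow> ('a \<times> 'a) set set \<Rightarrow> 'a \<Rightarrow> ('a \<times> 'a) set"
  where "tomita_operator H \<M> \<Omega> =
    closure {(x, y). \<exists>M\<in>\<M>. (\<Omega>, x) \<in> M \<and> (\<Omega>, y) \<in> adjoint_on H M}"

text \<open>The antiunitary part \<open>J\<close> of the polar decomposition \<open>S = J \<Delta>\<^sup>1\<^sup>/\<^sup>2\<close> of the Tomita operator.\<close>

definition modular_conjugation ::
    "'a::chilbert_space set \<Rightarrow> ('a \<times> 'a) set set \<Rightarrow> 'a \<Rightarrow> ('a \<times> 'a) set"
  where "modular_conjugation H \<M> \<Omega> = (THE J. antiunitary_on H J \<and>
    (\<exists>\<Delta>. selfadjoint_on H \<Delta> \<and> positive_operator \<Delta> \<and> tomita_operator H \<M> \<Omega> = sqrt_on H \<Delta> O J))"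


section \<open>Involutions, projections, subspaces\<close>

definition antiunitary_involution :: "('a::chilbert_space \<Rightarrow> 'a) \<Rightarrow> bool"
  where "antiunitary_involution \<Gamma> \<longleftrightarrow> (\<forall>f h. \<Gamma> (f + h) = \<Gamma> f + \<Gamma> h) \<and>
    (\<forall>c f. \<Gamma> (c *\<^sub>C f) = cnj c *\<^sub>C \<Gamma> f) \<and> (\<forall>f. \<Gamma> (\<Gamma> f) = f) \<and>
    (\<forall>f h. cinner (\<Gamma> f) (\<Gamma> h) = cinner h f)"

definition orthogonal_projection :: "('a::chilbert_space \<Rightarrow> 'a) \<Rightarrow> bool"
  where "orthogonal_projection P \<longleftrightarrow> Vector_Spaces.linear (*\<^sub>C) (*\<^sub>C) P \<and>
    (\<forall>f. P (P f) = P f) \<and> (\<forall>f h. cinner (P f) h = cinner f (P h))"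

definition basis_projection :: "('a::chilbert_space \<Rightarrow> 'a) \<Rightarrow> ('a \<Rightarrow> 'a) \<Rightarrow> bool"
  where "basis_projection \<Gamma> P \<longleftrightarrow> orthogonal_projection P \<and> (\<forall>f. P f + \<Gamma> (P (\<Gamma> f)) = f)"

definition orth_complement :: "'a::chilbert_space set \<Rightarrow> 'a set"
  where "orth_complement S = {f. \<forall>h\<in>S. cinner h f = 0}"

definition generic_position :: "'a::chilbert_space set \<Rightarrow> 'a set \<Rightarrow> bool"
  where "generic_position \<pp> \<qq> \<longleftrightarrow> \<pp> \<inter> \<qq> = {0} \<and> \<pp> \<inter> orth_complement \<qq> = {0} \<and>
    orth_complement \<pp> \<inter> \<qq> = {0} \<and> orth_complement \<pp> \<inter> orth_complement \<qq> = {0}"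


section \<open>The Fock representation\<close>

definition exterior_power :: "'a::chilbert_space set \<Rightarrow> nat \<Rightarrow> 'a list ell2 set"
  where "exterior_power \<pp> n = closure (cspan {wedge ps |ps. length ps = n \<and> set ps \<subseteq> \<pp>})"

text \<open>
  By \<open>cinner_wedge\<close> the exterior powers are mutually orthogonal, so the closed span of
  their union is their Hilbert space direct sum. The vacuum is \<open>wedge []\<close>, and \<open>p \<in> \<pp>\<close> is identified
  with the one-particle vector \<open>wedge [p]\<close>.
\<close>

definition fock :: "'a::chilbert_space set \<Rightarrow> 'a list ell2 set"
  where "fock \<pp> = closure (cspan (\<Union>n. exterior_power \<pp> n))"

definition vacuum :: "'a::chilbert_space list ell2"
  where "vacuum = wedge []"

text \<open>
  Creation and annihilation operators are given on wedge products and extended linearly and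
  continuously: their graphs are the closed linear spans of the pairs below.
\<close>

definition creation :: "'a::chilbert_space set \<Rightarrow> 'a \<Rightarrow> ('a list ell2 \<times> 'a list ell2) set"
  where "creation \<pp> p = closure (cspan {(wedge ps, wedge (p # ps)) |ps. set ps \<subseteq> \<pp>})"

definition annihilation :: "'a::chilbert_space set \<Rightarrow> 'a \<Rightarrow> ('a list ell2 \<times> 'a list ell2) set"
  where "annihilation \<pp> p = closure (cspan {(wedge ps,
      \<Sum>r<length ps. ((-1) ^ r * cinner p (ps ! r)) *\<^sub>C wedge (take r ps @ drop (Suc r) ps)) |ps.
    set ps \<subseteq> \<pp>})"

definition field_operator ::
    "('a::chilbert_space \<Rightarrow> 'a) \<Rightarrow> ('a \<Rightarrow> 'a) \<Rightarrow> 'a \<Rightarrow> ('a list ell2 \<times> 'a list ell2) set"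
  where "field_operator \<Gamma> P f = {(x, y + z) |x y z.
    (x, y) \<in> creation (range P) (P (\<Gamma> f)) \<and> (x, z) \<in> annihilation (range P) (P f)}"

definition field_algebra ::
    "('a::chilbert_space \<Rightarrow> 'a) \<Rightarrow> ('a \<Rightarrow> 'a) \<Rightarrow> 'a set \<Rightarrow> ('a list ell2 \<times> 'a list ell2) set set"
  where "field_algebra \<Gamma> P \<qq> =
    commutant_on (fock (range P)) (commutant_on (fock (range P)) (field_operator \<Gamma> P ` \<qq>))"

end

theory Submission
  imports Defs "Jordan_Normal_Form.Determinant" "HOL-Computational_Algebra.Formal_Power_Series"
begin

text \<open>
  One-particle level. Since \<open>P\<close> is a basis projection, \<open>P \<Gamma> q = \<Gamma> (1 - P) q\<close>, and
  a direct computation gives \<open>\<beta>\<^sup>* = \<alpha>\<close>, \<open>\<alpha>\<^sup>* = \<beta>\<close>; moreover \<open>\<beta>\<close> equals its own inverse. For \<open>p \<in> \<pp>\<close> the pair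
  \<open>(P Q p, P (1 - Q) p)\<close> lies in the graph of \<open>\<beta>\<^sup>* \<beta>\<close> and has sum \<open>p\<close>, so \<open>1 + \<Delta>\<close> is onto and \<open>P Q\<close> is
  its inverse.

  Square roots. A positive self-adjoint \<open>T\<close> is handled through \<open>B = (1 + T)\<^sup>-\<^sup>1\<close>. With \<open>C = \<surd>B\<close> and
  \<open>D = \<surd>(1 - B)\<close>, given by norm convergent binomial series, \<open>C\<^sup>2 + D\<^sup>2 = 1\<close>, and the graph of \<open>\<surd>T\<close> is
  \<open>{(C x, D x)}\<close>. A second positive root \<open>R\<close> has \<open>b = (1 + R)\<^sup>-\<^sup>1\<close> commuting with \<open>B\<close>, and \<open>D b = C (1 - b)\<close>
  because both are positive square roots of the same bounded operator.

  Polar decomposition. For a closed antilinear \<open>S = S\<^sup>-\<^sup>1\<close> put \<open>T = S\<^sup>* S\<close> and \<open>E = \<surd>(B (1 - B))\<close>. The map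
  \<open>E w \<mapsto> S B w\<close> is antiunitary up to closure; this closure is \<open>J\<close>, it satisfies \<open>J\<^sup>2 = 1\<close> and \<open>S = J \<surd>T\<close>.
  As \<open>J\<close> is built from \<open>S\<close> by norm limits, any isometry that intertwines two such operators and
  their adjoints also intertwines their antiunitary parts.

  Fock space. By the CAR, \<open>a(q')\<close> with \<open>q' \<in> \<qq>\<^sup>\<bottom>\<close> anticommutes with \<open>a(q)\<close>, so its product with the parity
  operator lies in the commutant. Hence \<open>\<Omega>\<close> is cyclic and separating, the Tomita operator extends \<open>\<beta>\<close>
  and its adjoint extends \<open>\<alpha> = \<beta>\<^sup>*\<close> on the one-particle space. So \<open>J\<close> restricts there to the antiunitary
  part of \<open>\<beta>\<close>, which sends \<open>P q = \<beta> (P \<Gamma> q)\<close> to \<open>\<surd>\<Delta> (P \<Gamma> q)\<close>.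
\<close>

text \<open>\<open>sqrt_on\<close> and \<open>modular_conjugation\<close> are definite descriptions,
  so a formula for either needs uniqueness of the root or of the polar decomposition, not only a
  candidate. Unboundedness is the obstacle: domains are controlled only through the everywhere
  defined resolvent. If a bounded V maps the graph of one operator T into that of another, it
  already intertwines the resolvents, because 1 + T is onto; the roots are norm limits of real
  polynomials in these. Hence two inclusions of graphs suffice to find \<open>J\<close> on the
  one-particle space, although the Tomita operator is not computed on the rest of Fock space. Real
  coefficients matter, since the graph of an antilinear operator is only a real subspace.
  Orthogonality of q' to \<qq> enters as the vanishing of the scalar <q, \<Gamma> q'> in the
  anticommutator of a(q) and a(q'). The minus sign in \<alpha> matches the sign of the parity
  operator on one-particle vectors.\<close>

instance chilbert_space \<subseteq> banach ..

section \<open>Projections and duality in Hilbert spaces\<close>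

lemmas csubspace_0 = complex_vector.subspace_0 and csubspace_add = complex_vector.subspace_add
  and csubspace_diff = complex_vector.subspace_diff and csubspace_neg = complex_vector.subspace_neg
  and csubspace_scale = complex_vector.subspace_scale
    and csubspace_sum = complex_vector.subspace_sum

lemma csubspace_imp_subspace: "csubspace V \<Longrightarrow> subspace V"
  unfolding subspace_def complex_vector.subspace_def by (auto simp: scaleR_scaleC)

lemma bounded_bilinear_cinner: "bounded_bilinear (cinner :: 'a::chilbert_space \<Rightarrow> 'a \<Rightarrow> complex)"
proof (standard, goal_cases)
  case 5
  show ?case
    by (rule exI[of _ 1]) (simp add: norm_cinner_le)
qed (simp_all add: cinner_add_left cinner_add_right scaleR_scaleC cinner_scaleC_left
    cinner_scaleC_right scaleR_conv_of_real)

interpretation cinner: bounded_bilinear "cinner :: 'a::chilbert_space \<Rightarrow> 'a \<Rightarrow> complex"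
  by (rule bounded_bilinear_cinner)

lemma bounded_linear_scaleC: "bounded_linear (\<lambda>x. c *\<^sub>C x)"
  by (rule bounded_linear_intro[of _ "cmod c"])
    (simp_all add: scaleC_add_right scaleR_scaleC scaleC_scaleC norm_scaleC mult.commute)

lemma cinner_eq_iff: "(\<And>z. cinner x z = cinner y z) \<Longrightarrow> x = y"
  using cinner_self[of "x - y"] by (simp add: cinner.diff_left)

lemma cinner_eqI_on:
  assumes "csubspace H" "x \<in> H" "y \<in> H" "\<And>z. z \<in> H \<Longrightarrow> cinner z x = cinner z y"
  shows "x = y"
proof -
  have "x - y \<in> H" using assms csubspace_diff by blast
  then have "cinner (x - y) (x - y) = 0" using assms(4) by (simp add: cinner.diff_right)
  then show ?thesis by (simp add: cinner_self)
qed

text \<open>A minimising sequence for the distance is Cauchy by the parallelogram law. Real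
  subspaces are allowed because the lemma is later applied to the graph of an antilinear
  operator.\<close>

lemma projection_exists:
  fixes V :: "'a::{real_inner, complete_space} set"
  assumes V: "closed V" "subspace V"
  shows "\<exists>m\<in>V. \<forall>y\<in>V. inner (x - m) y = 0"
proof -
  define \<delta> where "\<delta> = (INF y\<in>V. (norm (x - y))\<^sup>2)"
  have ne: "V \<noteq> {}" using V(2) subspace_0 by blast
  have bdd: "bdd_below ((\<lambda>y. (norm (x - y))\<^sup>2) ` V)" by (rule bdd_belowI[of _ 0]) auto
  have \<delta>: "\<delta> \<le> (norm (x - y))\<^sup>2" if "y \<in> V" for y
    unfolding \<delta>_def using that bdd by (rule cINF_lower[rotated])
  have "\<exists>y\<in>V. (norm (x - y))\<^sup>2 < \<delta> + inverse (real (Suc n))" for n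
    using cINF_less_iff[OF ne bdd, of "\<delta> + inverse (real (Suc n))"] unfolding \<delta>_def[symmetric]
      by simp
  then obtain m where m: "\<And>n. m n \<in> V" "\<And>n. (norm (x - m n))\<^sup>2 < \<delta> + inverse (real (Suc n))"
    by metis
  have parity: "(norm (m i - m j))\<^sup>2 \<le> 2 * inverse (real (Suc i)) + 2 * inverse (real (Suc j))"
    for i j
  proof -
    \<comment> \<open>The midpoint lies in V, so its distance to x is at least the infimum; the
      parallelogram law then bounds the distance of the two terms.\<close>
    have "(1/2) *\<^sub>R (m i + m j) \<in> V"
      using m(1) V(2) by (intro subspace_scale subspace_add)
    from \<delta>[OF this] have "4 * \<delta> \<le> 4 * (norm (x - (1/2) *\<^sub>R (m i + m j)))\<^sup>2" by simp
    also have "4 * (norm (x - (1/2) *\<^sub>R (m i + m j)))\<^sup>2 = 2 * (norm (x - m i))\<^sup>2 + 2 * (norm (x -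
      m j))\<^sup>2 - (norm (m i - m j))\<^sup>2"
      unfolding power2_norm_eq_inner by (simp add: inner_diff inner_add inner_commute field_simps)
    finally show ?thesis using m(2)[of i] m(2)[of j] by linarith
  qed
  have "Cauchy m"
  proof (rule metric_CauchyI)
    fix e :: real assume "0 < e"
    then obtain N where N: "inverse (real (Suc N)) < e\<^sup>2 / 4"
      using reals_Archimedean[of "e\<^sup>2 / 4"] by auto
    have "dist (m i) (m j) < e" if "i \<ge> N" "j \<ge> N" for i j
    proof -
      have "inverse (real (Suc i)) \<le> inverse (real (Suc N))"
        "inverse (real (Suc j)) \<le> inverse (real (Suc N))"
        using that by (simp_all add: le_imp_inverse_le)
      then have "(norm (m i - m j))\<^sup>2 < e\<^sup>2" using parity[of i j] N by linarith
      then show ?thesis using \<open>0 < e\<close> power2_less_imp_less[of "norm (m i - m j)" e]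
        by (simp add: dist_norm)
    qed
    then show "\<exists>M. \<forall>i\<ge>M. \<forall>j\<ge>M. dist (m i) (m j) < e" by blast
  qed
  then obtain l where l: "m \<longlonglongrightarrow> l" using Cauchy_convergent convergentD by blast
  have "l \<in> V" using closed_sequentially[OF V(1)] m(1) l by blast
  have "(norm (x - l))\<^sup>2 \<le> \<delta>"
  proof (rule LIMSEQ_le)
    show "(\<lambda>n. (norm (x - m n))\<^sup>2) \<longlonglongrightarrow> (norm (x - l))\<^sup>2" by (intro tendsto_intros l)
    show "(\<lambda>n. \<delta> + inverse (real (Suc n))) \<longlonglongrightarrow> \<delta>"
      using tendsto_add[OF tendsto_const LIMSEQ_inverse_real_of_nat] by simp
    show "\<exists>N. \<forall>n\<ge>N. (norm (x - m n))\<^sup>2 \<le> \<delta> + inverse (real (Suc n))" using m(2) less_imp_le by blast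
  qed
  have "inner (x - l) y = 0" if "y \<in> V" for y
  proof (cases "y = 0")
    case False
    \<comment> \<open>The minimiser of the quadratic function that sends t to the squared distance
      of x and l + t y.\<close>
    define t where "t = inner (x - l) y / inner y y"
    have "l + t *\<^sub>R y \<in> V" using \<open>l \<in> V\<close> that V(2) by (intro subspace_add subspace_scale)
    from \<delta>[OF this] have "(norm (x - l))\<^sup>2 \<le> (norm (x - (l + t *\<^sub>R y)))\<^sup>2"
      using \<open>(norm (x - l))\<^sup>2 \<le> \<delta>\<close> by linarith
    also have "\<dots> = (norm (x - l))\<^sup>2 - 2 * t * inner (x - l) y + t\<^sup>2 * inner y y"
      unfolding power2_norm_eq_inner
      by (simp add: inner_diff inner_add inner_commute algebra_simps power2_eq_square)
    also have "\<dots> = (norm (x - l))\<^sup>2 - (inner (x - l) y)\<^sup>2 / inner y y"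
      using False by (simp add: t_def power2_eq_square)
    finally have "(inner (x - l) y)\<^sup>2 / inner y y \<le> 0" by simp
    moreover have "0 < inner y y" using False by simp
    ultimately show ?thesis by (simp add: divide_le_0_iff)
  qed simp
  with \<open>l \<in> V\<close> show ?thesis by blast
qed

definition proj :: "'a::{real_inner, complete_space} set \<Rightarrow> 'a \<Rightarrow> 'a"
  where "proj V x = (SOME m. m \<in> V \<and> (\<forall>y\<in>V. inner (x - m) y = 0))"

lemma
  assumes "closed V" "subspace V"
  shows proj_in: "proj V x \<in> V" and proj_orth: "y \<in> V \<Longrightarrow> inner (x - proj V x) y = 0"
proof -
  have "proj V x \<in> V \<and> (\<forall>y\<in>V. inner (x - proj V x) y = 0)"
    unfolding proj_def by (rule someI_ex) (use projection_exists[OF assms, of x] in blast)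
  then show "proj V x \<in> V" "y \<in> V \<Longrightarrow> inner (x - proj V x) y = 0" by auto
qed

lemma proj_eq:
  assumes V: "closed V" "subspace V" and m: "m \<in> V" "\<And>y. y \<in> V \<Longrightarrow> inner (x - m) y = 0"
  shows "proj V x = m"
proof -
  have "proj V x - m \<in> V" using proj_in[OF V] m(1) V(2) subspace_diff by blast
  then have "inner (x - m) (proj V x - m) - inner (x - proj V x) (proj V x - m) = 0"
    using proj_orth[OF V] m(2) by simp
  then have "inner (proj V x - m) (proj V x - m) = 0" by (simp add: inner_diff_left)
  then show ?thesis by simp
qed

lemma proj_id: "closed V \<Longrightarrow> subspace V \<Longrightarrow> x \<in> V \<Longrightarrow> proj V x = x"
  by (rule proj_eq) auto

text \<open>The imaginary part of a scalar product with y is, up to sign, the real part with \<i> y,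
  and a complex subspace contains both vectors.\<close>

lemma Re_cinner_zero_imp:
  assumes "csubspace V" "\<And>y. y \<in> V \<Longrightarrow> inner z y = 0" "y \<in> V"
  shows "cinner z y = 0"
proof (rule complex_eqI)
  have "\<i> *\<^sub>C y \<in> V" by (rule csubspace_scale[OF assms(1,3)])
  then have "Re (cinner z (\<i> *\<^sub>C y)) = 0" using assms(2) by (simp add: Re_cinner)
  then show "Im (cinner z y) = Im 0" by (simp add: cinner_scaleC_right)
qed (use assms in \<open>simp add: Re_cinner\<close>)

lemma proj_corth:
  assumes "closed V" "csubspace V" "y \<in> V"
  shows "cinner (x - proj V x) y = 0" "cinner y (x - proj V x) = 0"
proof -
  show *: "cinner (x - proj V x) y = 0"
    using Re_cinner_zero_imp[OF assms(2) _ assms(3)] proj_orth[OF assms(1)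
      csubspace_imp_subspace[OF assms(2)]]
    by blast
  show "cinner y (x - proj V x) = 0" using * cinner_commute[of y] by simp
qed

lemma proj_sym:
  assumes "closed V" "csubspace V"
  shows "cinner (proj V x) y = cinner x (proj V y)"
proof -
  note in_V = proj_in[OF assms(1) csubspace_imp_subspace[OF assms(2)]]
  have "cinner (proj V x) y = cinner (proj V x) (proj V y)"
    using proj_corth(2)[OF assms in_V, of x y] by (simp add: cinner.diff_right)
  also have "\<dots> = cinner x (proj V y)"
    using proj_corth(1)[OF assms in_V, of x y] by (simp add: cinner.diff_left)
  finally show ?thesis .
qed

lemma norm_proj_le:
  assumes "closed V" "csubspace V"
  shows "norm (proj V x) \<le> norm x"
proof -
  have "complex_of_real ((norm (proj V x))\<^sup>2) = cinner (proj V x) x"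
    using proj_corth(2)[OF assms proj_in[OF assms(1) csubspace_imp_subspace[OF assms(2)]], of x x]
    by (simp add: cinner_self cinner.diff_right)
  then have "(norm (proj V x))\<^sup>2 = cmod (cinner (proj V x) x)" by (metis norm_of_real abs_power2)
  then have "norm (proj V x) * norm (proj V x) \<le> norm (proj V x) * norm x"
    using norm_cinner_le[of "proj V x" x] by (simp add: power2_eq_square)
  then show ?thesis by (cases "norm (proj V x) = 0") (simp_all add: mult_le_cancel_left)
qed

lemma csubspace_image:
  assumes "csubspace V" "\<And>x y. f (x + y) = f x + f y" "\<And>c x. f (c *\<^sub>C x) = c *\<^sub>C f x"
  shows "csubspace (f ` V)"
  unfolding complex_vector.subspace_def
proof (intro conjI ballI allI)
  have "f 0 = 0" using assms(3)[of 0 0] by simp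
  then show "0 \<in> f ` V" using csubspace_0[OF assms(1)] by (metis imageI)
  show "x + y \<in> f ` V" if "x \<in> f ` V" "y \<in> f ` V" for x y
    using that csubspace_add[OF assms(1)] by (auto simp flip: assms(2))
  show "c *\<^sub>C x \<in> f ` V" if "x \<in> f ` V" for c x
    using that csubspace_scale[OF assms(1)] by (auto simp flip: assms(3))
qed

lemma fst_scaleC: "fst (c *\<^sub>C p) = c *\<^sub>C fst p" and snd_scaleC: "snd (c *\<^sub>C p) = c *\<^sub>C snd p"
  by (simp_all add: scaleC_prod_def)

lemma csubspace_Domain: "csubspace T \<Longrightarrow> csubspace (Domain T)"
  unfolding fst_eq_Domain[symmetric] by (rule csubspace_image) (simp_all add: fst_scaleC)

lemma csubspace_Times: "csubspace V \<Longrightarrow> csubspace W \<Longrightarrow> csubspace (V \<times> W)"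
  by (auto simp: complex_vector.subspace_def mem_Times_iff fst_scaleC snd_scaleC)

lemma closure_subspace: "subspace V \<Longrightarrow> subspace (closure V)" for V :: "'a::real_normed_vector set"
  unfolding subspace_def
proof (safe, goal_cases)
  case 1 then show ?case using closure_subset by blast
next
  case (2 x y)
  then obtain f g where "\<And>n. f n \<in> V" "f \<longlonglongrightarrow> x" "\<And>n. g n \<in> V" "g \<longlonglongrightarrow> y"
    unfolding closure_sequential by blast
  then show ?case unfolding closure_sequential
    by (intro exI[of _ "\<lambda>n. f n + g n"]) (use 2 in \<open>auto intro: tendsto_add\<close>)
next
  case (3 c x)
  then obtain f where "\<And>n. f n \<in> V" "f \<longlonglongrightarrow> x" unfolding closure_sequential by blast
  then show ?case unfolding closure_sequential
    by (intro exI[of _ "\<lambda>n. c *\<^sub>R f n"]) (use 3 in \<open>auto intro: tendsto_scaleR\<close>)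
qed

lemma closure_csubspace:
  assumes "csubspace V" shows "csubspace (closure V)"
  unfolding complex_vector.subspace_def
proof (safe, goal_cases)
  case 1 then show ?case using assms closure_subset csubspace_0 by blast
next
  case (2 x y)
  then show ?case using closure_subspace[OF csubspace_imp_subspace[OF assms]] subspace_add by blast
next
  case (3 c x)
  then obtain f where "\<And>n. f n \<in> V" "f \<longlonglongrightarrow> x" unfolding closure_sequential by blast
  then show ?case unfolding closure_sequential
    by (intro exI[of _ "\<lambda>n. c *\<^sub>C f n"])
      (auto intro!: csubspace_scale[OF assms] bounded_linear.tendsto[OF bounded_linear_scaleC])
qed

lemma dense_if_orth_trivial:
  fixes H :: "'a::{real_inner, complete_space} set"
  assumes "subspace H" "closed H" "subspace V" "V \<subseteq> H"
    and "\<And>z. z \<in> H \<Longrightarrow> (\<And>y. y \<in> V \<Longrightarrow> inner z y = 0) \<Longrightarrow> z = 0"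
  shows "H \<subseteq> closure V"
proof
  fix x assume "x \<in> H"
  define m where "m = proj (closure V) x"
  note c = closed_closure closure_subspace[OF assms(3)]
  have "closure V \<subseteq> H" using assms closure_minimal by blast
  then have "x - m \<in> H" using proj_in[OF c] \<open>x \<in> H\<close> assms(1) subspace_diff unfolding m_def by blast
  moreover have "inner (x - m) y = 0" if "y \<in> V" for y
    unfolding m_def using that closure_subset by (intro proj_orth[OF c]) blast
  ultimately have "x - m = 0" using assms(5) by blast
  then show "x \<in> closure V" using proj_in[OF c, of x] by (simp add: m_def)
qed

lemma cdense_if_orth_trivial:
  assumes "csubspace H" "closed H" "csubspace V" "V \<subseteq> H"
    and "\<And>z. z \<in> H \<Longrightarrow> (\<And>y. y \<in> V \<Longrightarrow> cinner z y = 0) \<Longrightarrow> z = 0"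
  shows "H \<subseteq> closure V"
  using assms(1-4) Re_cinner_zero_imp[OF assms(3)]
  by (intro dense_if_orth_trivial) (auto intro: csubspace_imp_subspace assms(5))

lemma orth_closure:
  assumes "\<And>y. y \<in> V \<Longrightarrow> cinner z y = 0" "x \<in> closure V"
  shows "cinner z x = 0"
proof -
  obtain f where f: "\<And>n. f n \<in> V" "f \<longlonglongrightarrow> x" using assms(2) unfolding closure_sequential by blast
  have "(\<lambda>n. cinner z (f n)) \<longlonglongrightarrow> cinner z x" by (intro cinner.tendsto tendsto_const f)
  then show ?thesis using f assms(1) by (simp add: LIMSEQ_const_iff)
qed

text \<open>The representing vector is a multiple of e, the component of some u outside the kernel N
  that is orthogonal to N. The bound is what makes N closed.\<close>

lemma riesz_exists:
  assumes H: "closed H" "csubspace H"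
    and add: "\<And>x y. x \<in> H \<Longrightarrow> y \<in> H \<Longrightarrow> \<phi> (x + y) = \<phi> x + \<phi> y"
    and scale: "\<And>c x. x \<in> H \<Longrightarrow> \<phi> (c *\<^sub>C x) = c * \<phi> x"
    and bound: "\<And>x. x \<in> H \<Longrightarrow> cmod (\<phi> x) \<le> K * norm x"
  shows "\<exists>z\<in>H. \<forall>x\<in>H. \<phi> x = cinner z x"
proof (cases "\<forall>x\<in>H. \<phi> x = 0")
  case True
  then show ?thesis using csubspace_0[OF H(2)] by (intro bexI[of _ 0]) auto
next
  case False
  then obtain u where u: "u \<in> H" "\<phi> u \<noteq> 0" by blast
  define N where "N = {x \<in> H. \<phi> x = 0}"
  have minus: "\<phi> (x - y) = \<phi> x - \<phi> y" if "x \<in> H" "y \<in> H" for x y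
    using add[of "x - y" y] csubspace_diff[OF H(2)] that by simp
  have N: "csubspace N"
    unfolding N_def complex_vector.subspace_def using H(2) add scale[of 0 0] scale
    by (auto intro: csubspace_0 csubspace_add csubspace_scale)
  have "closed N"
    unfolding closed_sequential_limits
  proof (intro allI impI)
    fix f l assume f: "(\<forall>n. f n \<in> N) \<and> f \<longlonglongrightarrow> l"
    have fH: "f n \<in> H" for n using f by (simp add: N_def)
    have l: "l \<in> H" using f fH closed_sequentially[OF H(1), of f l] by blast
    have "(\<lambda>n. K * norm (l - f n)) \<longlonglongrightarrow> K * norm (l - l)" using f by (intro tendsto_intros) auto
    moreover have "cmod (\<phi> l) \<le> K * norm (l - f n)" for n
      using bound[of "l - f n"] minus[OF l fH, of n] f csubspace_diff[OF H(2) l fH, of n]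
      by (simp add: N_def)
    ultimately have "cmod (\<phi> l) \<le> K * norm (l - l)"
      by (intro LIMSEQ_le_const) auto
    then show "l \<in> N" using l by (simp add: N_def)
  qed
  define e where "e = u - proj N u"
  have pN: "proj N u \<in> N" by (rule proj_in[OF \<open>closed N\<close> csubspace_imp_subspace[OF N]])
  have e: "e \<in> H" "\<phi> e = \<phi> u"
    using u pN minus csubspace_diff[OF H(2)] by (auto simp: e_def N_def)
  have "e \<noteq> 0" using e u scale[of 0 0] csubspace_0[OF H(2)] by auto
  define c where "c = cnj (\<phi> e) / cinner e e"
  have "\<phi> x = cinner (c *\<^sub>C e) x" if "x \<in> H" for x
  proof -
    \<comment> \<open>Subtracting the multiple of e with the same value under \<phi> lands in the
      kernel, to which e is orthogonal.\<close>
    define y where "y = x - (\<phi> x / \<phi> e) *\<^sub>C e"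
    have "y \<in> N" unfolding N_def y_def using that e u H(2) minus scale
      by (auto intro!: csubspace_diff csubspace_scale
          simp: csubspace_scale)
    then have "cinner e y = 0" unfolding e_def by (rule proj_corth(1)[OF \<open>closed N\<close> N])
    then have "cinner e x = \<phi> x / \<phi> e * cinner e e"
      by (simp add: y_def cinner.diff_right cinner_scaleC_right)
    then show ?thesis using \<open>e \<noteq> 0\<close> e u
      by (simp add: c_def cinner_scaleC_left cinner_self)
  qed
  then show ?thesis using e(1) csubspace_scale[OF H(2)] by blast
qed

section \<open>Square roots of bounded operators\<close>

text \<open>
  The coefficients of the binomial series of \<open>\<surd>(1 - t)\<close>. The signs and the partial sums show that
  their absolute values sum up to at most 2, so the series converges in norm on contractions.
\<close>

definition sqrt_coeff :: "nat \<Rightarrow> real" where "sqrt_coeff n = (1/2 gchoose n) * (-1) ^ n"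

lemma sqrt_coeff_0 [simp]: "sqrt_coeff 0 = 1"
  by (simp add: sqrt_coeff_def)

lemma sqrt_coeff_eq: "sqrt_coeff n = pochhammer (-1/2) n / fact n"
  unfolding sqrt_coeff_def gbinomial_pochhammer by (cases "even n") simp_all

text \<open>For n > 0 the rising factorial of -1/2 has exactly one negative factor, the
  first.\<close>

lemma sqrt_coeff_nonpos: "n > 0 \<Longrightarrow> sqrt_coeff n \<le> 0"
proof -
  assume "n > 0"
  then obtain m where "n = Suc m" using gr0_conv_Suc by blast
  moreover have "0 \<le> pochhammer (1/2 :: real) m" by (intro pochhammer_nonneg) simp
  ultimately show ?thesis unfolding sqrt_coeff_eq by (simp add: pochhammer_rec divide_nonneg_pos)
qed

text \<open>Partial sums are the coefficients of the series divided by 1 - t, that is, of (1 - t) to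
  the power -1/2, and these are positive.\<close>

lemma sum_sqrt_coeff_nonneg: "0 \<le> (\<Sum>k\<le>m. sqrt_coeff k)"
proof -
  have "(\<Sum>k\<le>m. sqrt_coeff k) = pochhammer (1/2) m / fact m"
    unfolding sqrt_coeff_def gbinomial_sum_lower_neg
    unfolding gbinomial_pochhammer by (cases "even m") simp_all
  then show ?thesis by (simp add: pochhammer_nonneg)
qed

text \<open>All terms after the first have the same sign, so their absolute sum is 1 minus a
  nonnegative partial sum.\<close>

lemma sum_abs_sqrt_coeff_le: "(\<Sum>k<m. \<bar>sqrt_coeff (Suc k)\<bar>) \<le> 1"
proof -
  have "(\<Sum>k\<le>m. sqrt_coeff k) = 1 + (\<Sum>k<m. sqrt_coeff (Suc k))"
    unfolding lessThan_Suc_atMost[symmetric] by (subst sum.lessThan_Suc_shift) simp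
  also have "(\<Sum>k<m. sqrt_coeff (Suc k)) = - (\<Sum>k<m. \<bar>sqrt_coeff (Suc k)\<bar>)"
    unfolding sum_negf[symmetric]
      by (intro sum.cong refl) (simp add: abs_of_nonpos sqrt_coeff_nonpos)
  finally show ?thesis using sum_sqrt_coeff_nonneg[of m] by linarith
qed

lemma summable_abs_sqrt_coeff: "summable (\<lambda>n. \<bar>sqrt_coeff n\<bar>)"
  unfolding summable_Suc_iff[of "\<lambda>n. \<bar>sqrt_coeff n\<bar>", symmetric]
  using sum_abs_sqrt_coeff_le by (intro summableI_nonneg_bounded[of _ 1]) auto

text \<open>These are the coefficients of 1 - t, the square of the series; Vandermonde's identity
  with 1/2 + 1/2 = 1 yields them.\<close>

lemma sqrt_coeff_convolution:
  "(\<Sum>k\<le>n. sqrt_coeff k * sqrt_coeff (n - k)) = (if n = 0 then 1 else if n = 1 then -1 else 0)"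
proof -
  have "(\<Sum>k\<le>n. sqrt_coeff k * sqrt_coeff (n - k))
      = (\<Sum>k\<le>n. (-1) ^ n * ((1/2 gchoose k) * (1/2 gchoose (n - k))))"
    by (intro sum.cong refl) (auto simp: sqrt_coeff_def power_add mult_ac dest!: le_Suc_ex)
  also have "\<dots> = (-1) ^ n * (1 gchoose n)"
    using gbinomial_Vandermonde[of "1/2::real" "1/2" n]
    by (simp add: sum_distrib_left[symmetric] atLeast0AtMost)
  also have "(1::real) gchoose n = of_nat (1 choose n)" by (simp add: binomial_gbinomial)
  also have "(-1) ^ n * real (1 choose n) = (if n = 0 then 1 else if n = 1 then -1 else 0)"
    by (cases n; cases "n - 1") auto
  finally show ?thesis .
qed

section \<open>Operators between 0 and 1 and their powers\<close>

text \<open>The operator inequality 0 \<le> B \<le> 1 in terms of quadratic forms. Symmetry on the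
  whole space forces linearity, and the two bounds force norm at most 1.\<close>

definition effect :: "('a::chilbert_space \<Rightarrow> 'a) \<Rightarrow> bool"
  where "effect B \<longleftrightarrow> (\<forall>x y. cinner (B x) y = cinner x (B y)) \<and>
    (\<forall>x. 0 \<le> inner x (B x) \<and> inner x (B x) \<le> inner x x)"

lemma effect_sym: "effect B \<Longrightarrow> cinner (B x) y = cinner x (B y)"
  by (simp add: effect_def)

lemma effect_sym_inner: "effect B \<Longrightarrow> inner (B x) y = inner x (B y)"
  by (simp add: effect_def Re_cinner[symmetric])

lemma effect_ge0: "effect B \<Longrightarrow> 0 \<le> inner x (B x)"
  by (simp add: effect_def)

lemma effect_le1: "effect B \<Longrightarrow> inner x (B x) \<le> inner x x"
  by (simp add: effect_def)

lemma effect_add: "effect B \<Longrightarrow> B (x + y) = B x + B y"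
  by (rule cinner_eq_iff) (simp add: effect_sym cinner_add_left)

lemma effect_scaleC: "effect B \<Longrightarrow> B (c *\<^sub>C x) = c *\<^sub>C B x"
  by (rule cinner_eq_iff) (simp add: effect_sym cinner_scaleC_left)

lemma effect_scaleR: "effect B \<Longrightarrow> B (c *\<^sub>R x) = c *\<^sub>R B x"
  by (simp add: scaleR_scaleC effect_scaleC)

lemma effect_zero [simp]: "effect B \<Longrightarrow> B 0 = 0"
  using effect_scaleR[of B 0 0] by simp

lemma effect_minus: "effect B \<Longrightarrow> B (- x) = - B x"
  using effect_scaleR[of B "-1" x] by simp

lemma effect_diff: "effect B \<Longrightarrow> B (x - y) = B x - B y"
  using effect_add[of B x "-y"] by (simp add: effect_minus)

text \<open>This is the inequality B^2 \<le> B: expand the form of B at x - B x and estimate the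
  cubic term by the upper bound at B x.\<close>

lemma effect_norm_square_le:
  assumes "effect B" shows "(norm (B x))\<^sup>2 \<le> inner x (B x)"
proof -
  have "0 \<le> inner (x - B x) (B (x - B x))" by (rule effect_ge0[OF assms])
  also have "\<dots> = inner x (B x) - 2 * inner (B x) (B x) + inner (B x) (B (B x))"
    using effect_sym_inner[OF assms, of x "B x"] effect_sym_inner[OF assms, of "B x" "B x"]
    by (simp add: effect_diff[OF assms] inner_diff inner_commute algebra_simps)
  also have "\<dots> \<le> inner x (B x) - inner (B x) (B x)" using effect_le1[OF assms, of "B x"] by simp
  finally show ?thesis by (simp add: power2_norm_eq_inner)
qed

lemma effect_norm_le: assumes "effect B" shows "norm (B x) \<le> norm x"
proof -
  have "norm (B x) * norm (B x) \<le> norm x * norm (B x)"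
    using effect_norm_square_le[OF assms, of x] norm_cauchy_schwarz[of x "B x"]
      by (simp add: power2_eq_square)
  then show ?thesis by (cases "norm (B x) = 0") (simp_all add: mult_le_cancel_right)
qed

lemma effect_bounded_linear: "effect B \<Longrightarrow> bounded_linear B"
  by (rule bounded_linear_intro[of _ 1]) (simp_all add: effect_add effect_scaleR effect_norm_le)

lemma effect_form_zero: "effect B \<Longrightarrow> inner x (B x) = 0 \<Longrightarrow> B x = 0"
  using effect_norm_square_le[of B x] by simp

lemma effect_comp1: "effect B \<Longrightarrow> effect (\<lambda>x. x - B x)"
  unfolding effect_def by (auto simp: cinner.diff_left cinner.diff_right inner_diff_right)

lemma effect_power_sym: "effect A \<Longrightarrow> cinner ((A ^^ n) x) y = cinner x ((A ^^ n) y)"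
proof (induction n arbitrary: y)
  case (Suc n)
  then show ?case by (simp add: effect_sym) (simp add: funpow_swap1)
qed simp

lemma effect_power_norm_le: "effect A \<Longrightarrow> norm ((A ^^ n) x) \<le> norm x"
proof (induction n)
  case (Suc n)
  then show ?case using effect_norm_le[of A "(A ^^ n) x"] by simp
qed simp

lemma effect_power_bounded_linear: "effect A \<Longrightarrow> bounded_linear (A ^^ n)"
proof (induction n)
  case (Suc n)
  then show ?case using bounded_linear_compose[OF effect_bounded_linear[of A], of "A ^^ n"]
    by (simp add: o_def)
qed (simp add: bounded_linear_ident id_def)

lemma effect_power:
  assumes "effect A" shows "effect (A ^^ n)"
  unfolding effect_def
proof (intro conjI allI effect_power_sym[OF assms])
  fix x
  \<comment> \<open>Half of the powers are moved to the left factor; what remains is the form of 1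
    or of A at the k-th power applied to x.\<close>
  define k where "k = n div 2"
  have "0 \<le> inner ((A ^^ k) x) ((A ^^ (n - 2 * k)) ((A ^^ k) x))"
  proof (cases "even n")
    case False
    then have "n - 2 * k = Suc 0" by (simp add: k_def) presburger
    then show ?thesis using effect_ge0[OF assms] by simp
  qed (simp add: k_def)
  also have "\<dots> = inner x ((A ^^ (k + (n - 2 * k) + k)) x)"
    unfolding Re_cinner[symmetric] effect_power_sym[OF assms] by (simp add: funpow_add)
  also have "k + (n - 2 * k) + k = n" by (simp add: k_def)
  finally show "0 \<le> inner x ((A ^^ n) x)" .
  have "inner x ((A ^^ n) x) \<le> norm x * norm ((A ^^ n) x)" by (rule norm_cauchy_schwarz)
  also have "\<dots> \<le> norm x * norm x" by (intro mult_left_mono effect_power_norm_le assms) simp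
  finally show "inner x ((A ^^ n) x) \<le> inner x x"
    by (simp add: power2_norm_eq_inner[symmetric] power2_eq_square)
qed

lemma effect_dense_range:
  assumes X: "effect X" and H: "closed H" "csubspace H" and inv: "\<And>x. x \<in> H \<Longrightarrow> X x \<in> H"
    and inj: "\<And>x. x \<in> H \<Longrightarrow> X x = 0 \<Longrightarrow> x = 0"
  shows "H \<subseteq> closure (X ` H)"
proof (rule cdense_if_orth_trivial[OF H(2,1)])
  show "csubspace (X ` H)" by (rule csubspace_image[OF H(2) effect_add[OF X] effect_scaleC[OF X]])
  show "X ` H \<subseteq> H" using inv by blast
  fix z assume z: "z \<in> H" "\<And>y. y \<in> X ` H \<Longrightarrow> cinner z y = 0"
  then have "cinner z (X (X z)) = 0" using inv by blast
  then have "cinner (X z) (X z) = 0" by (simp add: effect_sym[OF X])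
  then show "z = 0" using inj z by (simp add: cinner_self)
qed

section \<open>Square roots by the binomial series\<close>

definition opsqrt :: "('a::chilbert_space \<Rightarrow> 'a) \<Rightarrow> 'a \<Rightarrow> 'a"
  where "opsqrt B x = (\<Sum>n. sqrt_coeff n *\<^sub>R ((\<lambda>x. x - B x) ^^ n) x)"

lemma summable_norm_power:
  assumes "effect A"
  shows "summable (\<lambda>n. norm (sqrt_coeff n *\<^sub>R (A ^^ n) x))"
proof (rule summable_comparison_test')
  show "summable (\<lambda>n. \<bar>sqrt_coeff n\<bar> * norm x)" by (intro summable_mult2 summable_abs_sqrt_coeff)
  show "norm (norm (sqrt_coeff n *\<^sub>R (A ^^ n) x)) \<le> \<bar>sqrt_coeff n\<bar> * norm x" if "n \<ge> 0" for n
    using effect_power_norm_le[OF assms, of n x] by (simp add: mult_left_mono)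
qed

lemma opsqrt_sums:
  assumes "effect B"
  shows "(\<lambda>n. sqrt_coeff n *\<^sub>R ((\<lambda>x. x - B x) ^^ n) x) sums opsqrt B x"
  unfolding opsqrt_def
  by (rule summable_sums[OF summable_norm_cancel[OF summable_norm_power[OF effect_comp1[OF
    assms]]]])

text \<open>The roots are pointwise limits of the same real polynomials in B1 and B2, so every
  closed real subspace that the pair preserves is preserved by the roots. Taking G as the graph of a
  bounded operator gives commutation, as V \<times> V invariance, and as the graph of an antilinear
  operator the intertwining that the polar decomposition needs.\<close>

lemma opsqrt_closed_graph:
  assumes B: "effect B1" "effect B2" and G: "closed G" "subspace G"
    and inv: "\<And>x y. (x, y) \<in> G \<Longrightarrow> (B1 x, B2 y) \<in> G" and xy: "(x, y) \<in> G"
  shows "(opsqrt B1 x, opsqrt B2 y) \<in> G"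
proof -
  define A1 A2 where "A1 = (\<lambda>x. x - B1 x)" and "A2 = (\<lambda>x. x - B2 x)"
  have p: "((A1 ^^ n) x, (A2 ^^ n) y) \<in> G" for n
  proof (induction n)
    case (Suc n)
    from subspace_diff[OF G(2) this inv[OF this]] show ?case by (simp add: A1_def A2_def)
  qed (simp add: xy)
  have s: "(\<Sum>n<N. sqrt_coeff n *\<^sub>R ((A1 ^^ n) x, (A2 ^^ n) y)) \<in> G" for N
    by (intro subspace_sum subspace_scale G p)
  have "(\<Sum>n<N. sqrt_coeff n *\<^sub>R ((A1 ^^ n) x, (A2 ^^ n) y))
      = (\<Sum>n<N. sqrt_coeff n *\<^sub>R (A1 ^^ n) x, \<Sum>n<N. sqrt_coeff n *\<^sub>R (A2 ^^ n) y)" for N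
    by (induction N) (auto simp: zero_prod_def)
  then have "(\<lambda>N. (\<Sum>n<N. sqrt_coeff n *\<^sub>R (A1 ^^ n) x, \<Sum>n<N. sqrt_coeff n *\<^sub>R (A2 ^^ n) y)) \<longlonglongrightarrow>
    (opsqrt B1 x, opsqrt B2 y) \<Longrightarrow> ?thesis"
    using s closed_sequentially[OF G(1)] by (metis (no_types, lifting))
  moreover have "(\<lambda>N. (\<Sum>n<N. sqrt_coeff n *\<^sub>R (A1 ^^ n) x, \<Sum>n<N. sqrt_coeff n *\<^sub>R (A2 ^^ n) y)) \<longlonglongrightarrow>
    (opsqrt B1 x, opsqrt B2 y)"
    using opsqrt_sums[OF B(1)] opsqrt_sums[OF B(2)] unfolding A1_def A2_def sums_def
      by (intro tendsto_Pair)
  ultimately show ?thesis by blast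
qed

lemma opsqrt_commute:
  assumes "effect B" "bounded_linear X" "\<And>x. X (B x) = B (X x)"
  shows "X (opsqrt B x) = opsqrt B (X x)"
proof -
  interpret X: bounded_linear X by fact
  have "closed {p. X (fst p) = snd p}"
    by (rule closed_Collect_eq[OF X.continuous_on[OF continuous_on_fst[OF continuous_on_id]]
          continuous_on_snd[OF continuous_on_id]])
  moreover have "subspace {p. X (fst p) = snd p}" by (auto simp: subspace_def X.add X.scaleR X.zero)
  ultimately have "(opsqrt B x, opsqrt B (X x)) \<in> {p. X (fst p) = snd p}"
    by (rule opsqrt_closed_graph[OF assms(1) assms(1)]) (auto simp: assms(3))
  then show ?thesis by simp
qed

lemma opsqrt_in:
  assumes "effect B" "closed V" "subspace V" "\<And>x. x \<in> V \<Longrightarrow> B x \<in> V" "x \<in> V"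
  shows "opsqrt B x \<in> V"
proof -
  have "(opsqrt B x, opsqrt B x) \<in> V \<times> V"
    by (rule opsqrt_closed_graph[OF assms(1) assms(1)]) (use assms in
      \<open>auto intro: closed_Times subspace_Times\<close>)
  then show ?thesis by simp
qed

text \<open>With A = 1 - B all forms of powers of A at x lie between 0 and \<open>inner x x\<close>.
  The coefficients after the leading 1 are nonpositive with absolute sum at most 1, so the tail
  contributes between -\<open>inner x x\<close> and 0.\<close>

lemma effect_opsqrt:
  assumes B: "effect B" shows "effect (opsqrt B)"
  unfolding effect_def
proof (intro conjI allI)
  define A where "A = (\<lambda>x. x - B x)"
  have A: "effect A" unfolding A_def by (rule effect_comp1[OF B])
  note s = opsqrt_sums[OF B, folded A_def]
  fix x y
  have "(\<lambda>n. cinner (sqrt_coeff n *\<^sub>R (A ^^ n) x) y) sums cinner (opsqrt B x) y"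
    by (rule bounded_linear.sums[OF cinner.bounded_linear_left s])
  moreover have "(\<lambda>n. cinner x (sqrt_coeff n *\<^sub>R (A ^^ n) y)) sums cinner x (opsqrt B y)"
    by (rule bounded_linear.sums[OF cinner.bounded_linear_right s])
  moreover have "cinner (sqrt_coeff n *\<^sub>R (A ^^ n) x) y = cinner x (sqrt_coeff n *\<^sub>R (A ^^ n) y)"
    for n
    by (simp add: cinner.scaleR_left cinner.scaleR_right effect_power_sym[OF A])
  ultimately show "cinner (opsqrt B x) y = cinner x (opsqrt B y)" using sums_unique2 by simp
  have "(\<lambda>n. inner x (sqrt_coeff n *\<^sub>R (A ^^ n) x)) sums inner x (opsqrt B x)"
    by (rule bounded_linear.sums[OF bounded_linear_inner_right s])
  then have "(\<lambda>n. inner x (sqrt_coeff (Suc n) *\<^sub>R (A ^^ Suc n) x)) sums (inner x (opsqrt B x) -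
    inner x x)"
    unfolding sums_Suc_iff[of "\<lambda>n. inner x (sqrt_coeff n *\<^sub>R (A ^^ n) x)"] by simp
  then have S: "(\<lambda>n. sqrt_coeff (Suc n) * inner x ((A ^^ Suc n) x)) sums (inner x (opsqrt B x) -
    inner x x)"
    unfolding inner_scaleR_right .
  have nonneg: "0 \<le> inner x ((A ^^ n) x)" and le: "inner x ((A ^^ n) x) \<le> inner x x" for n
    using effect_ge0[OF effect_power[OF A]] effect_le1[OF effect_power[OF A]] by blast+
  have "inner x (opsqrt B x) - inner x x \<le> 0"
  proof (rule LIMSEQ_le_const2[OF S[unfolded sums_def]], intro exI allI impI sum_nonpos)
    show "sqrt_coeff (Suc n) * inner x ((A ^^ Suc n) x) \<le> 0" for n
      using sqrt_coeff_nonpos[of "Suc n"] nonneg[of "Suc n"] by (intro mult_nonpos_nonneg) auto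
  qed
  then show "inner x (opsqrt B x) \<le> inner x x" by simp
  have "- inner x x \<le> inner x (opsqrt B x) - inner x x"
  proof (rule LIMSEQ_le_const[OF S[unfolded sums_def]], intro exI allI impI)
    fix m :: nat
    have "- inner x x \<le> - ((\<Sum>k<m. \<bar>sqrt_coeff (Suc k)\<bar>) * inner x x)"
      using mult_right_mono[OF sum_abs_sqrt_coeff_le[of m], of "inner x x"] by simp
    also have "\<dots> = (\<Sum>k<m. - (\<bar>sqrt_coeff (Suc k)\<bar> * inner x x))"
      by (simp add: sum_distrib_right sum_negf)
    also have "\<dots> \<le> (\<Sum>k<m. sqrt_coeff (Suc k) * inner x ((A ^^ Suc k) x))"
    proof (rule sum_mono)
      fix k
      have "\<bar>sqrt_coeff (Suc k)\<bar> * inner x ((A ^^ Suc k) x) \<le> \<bar>sqrt_coeff (Suc k)\<bar> * inner x x"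
        by (intro mult_left_mono le) simp
      then show "- (\<bar>sqrt_coeff (Suc k)\<bar> * inner x x) \<le> sqrt_coeff (Suc k) * inner x ((A ^^ Suc k)
        x)"
        using sqrt_coeff_nonpos[of "Suc k"] by (simp add: abs_of_nonpos del: funpow.simps)
    qed
    finally show "- inner x x \<le> (\<Sum>k<m. sqrt_coeff (Suc k) * inner x ((A ^^ Suc k) x))" .
  qed
  then show "0 \<le> inner x (opsqrt B x)" by simp
qed

text \<open>A Cauchy product: the double family is absolutely summable, its sum by rows is the
  square of the root, and its sum by diagonals has the coefficients of
  \<open>sqrt_coeff_convolution\<close>, which leaves 1 - A = B.\<close>

lemma opsqrt_square:
  assumes B: "effect B" shows "opsqrt B (opsqrt B x) = B x"
proof -
  define A where "A = (\<lambda>x. x - B x)"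
  have A: "effect A" unfolding A_def by (rule effect_comp1[OF B])
  note sums = opsqrt_sums[OF B, folded A_def]
  have hs: "((\<lambda>n. sqrt_coeff n *\<^sub>R (A ^^ n) y) has_sum opsqrt B y) UNIV" for y
    using norm_summable_imp_has_sum[OF summable_norm_power[OF A] sums] .
  define F where "F = (\<lambda>(i, j). (sqrt_coeff i * sqrt_coeff j) *\<^sub>R (A ^^ (i + j)) x)"
  \<comment> \<open>A complex copy of the coefficients, so that \<open>has_sum_times\<close> applies
    and dominates the double family \<open>F\<close>.\<close>
  define cc where "cc n = complex_of_real (sqrt_coeff n)" for n
  have abs: "(\<lambda>n. norm (cc n)) summable_on UNIV"
    using norm_summable_imp_summable_on[of "\<lambda>n. \<bar>sqrt_coeff n\<bar>"] summable_abs_sqrt_coeff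
      by (simp add: cc_def)
  obtain t where t: "(cc has_sum t) UNIV"
    using abs_summable_summable[OF abs] by (auto simp: summable_on_def)
  have "(\<lambda>p. norm (case p of (a, b) \<Rightarrow> cc a * cc b) * norm x) summable_on UNIV"
    by (rule summable_on_cmult_left[OF has_sum_times(1)[OF abs t abs t]])
  then have "F abs_summable_on UNIV"
  proof (rule summable_on_comparison_test)
    show "norm (F p) \<le> norm (case p of (a, b) \<Rightarrow> cc a * cc b) * norm x" for p
      by (cases p) (simp add: F_def cc_def norm_mult abs_mult mult_left_mono
        effect_power_norm_le[OF A])
  qed simp
  then have "F summable_on UNIV" by (rule abs_summable_summable)
  then obtain b where b: "(F has_sum b) UNIV" by (auto simp: summable_on_def)
  have "((\<lambda>i. sqrt_coeff i *\<^sub>R (A ^^ i) (opsqrt B x)) has_sum b) UNIV"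
  proof (rule has_sum_SigmaD[where f = F and B = "\<lambda>_. UNIV"])
    fix i
    have "((\<lambda>j. sqrt_coeff i *\<^sub>R (A ^^ i) (sqrt_coeff j *\<^sub>R (A ^^ j) x)) has_sum sqrt_coeff i *\<^sub>R
      (A ^^ i) (opsqrt B x)) UNIV"
      by (intro has_sum_bounded_linear[OF bounded_linear_scaleR_right] has_sum_bounded_linear[OF
        effect_power_bounded_linear[OF A]] hs)
    moreover have "sqrt_coeff i *\<^sub>R (A ^^ i) (sqrt_coeff j *\<^sub>R (A ^^ j) x) = F (i, j)" for j
      by (simp add: F_def linear_simps[OF effect_power_bounded_linear[OF A]] funpow_add)
    ultimately show "((\<lambda>j. F (i, j)) has_sum sqrt_coeff i *\<^sub>R (A ^^ i) (opsqrt B x)) UNIV" by simp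
  qed (use b in simp)
  then have 1: "opsqrt B (opsqrt B x) = b" using hs has_sum_unique by blast
  \<comment> \<open>Re-indexing by diagonals: n is the total degree and i the degree of the first
    factor.\<close>
  have bij: "bij_betw (\<lambda>(n, i). (i, n - i)) (Sigma UNIV (\<lambda>n. {..n})) (UNIV :: (nat \<times> nat) set)"
    by (rule bij_betwI[where g = "\<lambda>(i, j). (i + j, i)"]) auto
  have b': "((\<lambda>p. F ((\<lambda>(n, i). (i, n - i)) p)) has_sum b) (Sigma UNIV (\<lambda>n. {..n}))"
    using has_sum_reindex_bij_betw[OF bij, of F b] b by simp
  define g where "g n = (\<Sum>k\<le>n. sqrt_coeff k * sqrt_coeff (n - k)) *\<^sub>R (A ^^ n) x" for n
  have "(g has_sum b) UNIV"
  proof (rule has_sum_SigmaD[OF b'])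
    fix n :: nat
    have "((\<lambda>i. F (i, n - i)) has_sum (\<Sum>i\<le>n. F (i, n - i))) {..n}" by (intro has_sum_finite) simp
    moreover have "(\<Sum>i\<le>n. F (i, n - i)) = g n"
      by (simp add: F_def g_def scaleR_sum_left)
    ultimately show "((\<lambda>i. F ((\<lambda>(n, i). (i, n - i)) (n, i))) has_sum g n) {..n}" by simp
  qed
  moreover have "(g has_sum s) UNIV \<longleftrightarrow> (g has_sum s) {0, 1}" for s
    by (rule has_sum_cong_neutral) (auto simp: g_def sqrt_coeff_convolution)
  moreover have "(g has_sum sum g {0, 1}) {0, 1}" by (rule has_sum_finite) simp
  ultimately have "b = sum g {0, 1}" using has_sum_unique by blast
  also have "\<dots> = B x" unfolding g_def sqrt_coeff_convolution by (simp add: A_def)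
  finally show ?thesis using 1 by simp
qed

text \<open>Commutation with X passes to its root, so the form of the product at x is the form of Y
  at \<open>opsqrt X x\<close>.\<close>

lemma effect_compose:
  assumes X: "effect X" and Y: "effect Y" and commutant: "\<And>x. X (Y x) = Y (X x)"
  shows "effect (\<lambda>x. X (Y x))"
  unfolding effect_def
proof (intro conjI allI)
  fix x y
  show "cinner (X (Y x)) y = cinner x (X (Y y))"
    by (simp add: effect_sym[OF X] effect_sym[OF Y] commutant)
  define s where "s = opsqrt X x"
  have "inner x (X (Y x)) = inner s (Y s)"
    unfolding s_def using opsqrt_commute[OF X effect_bounded_linear[OF Y]]
    by (simp add: commutant effect_sym_inner[OF effect_opsqrt[OF X]] opsqrt_square[OF X])
  moreover have "inner s s = inner x (X x)"
    unfolding s_def by (simp add: effect_sym_inner[OF effect_opsqrt[OF X]] opsqrt_square[OF X])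
  ultimately show "0 \<le> inner x (X (Y x))" "inner x (X (Y x)) \<le> inner x x"
    using effect_ge0[OF Y, of s] effect_le1[OF Y, of s] effect_le1[OF X, of x] by auto
qed

text \<open>For y = (X - Y) x commutation gives (X + Y) y = 0. Both forms at y are nonnegative, so X
  y = Y y = 0, and then the scalar product of y with (X - Y) x vanishes.\<close>

lemma effect_sqrt_unique:
  assumes X: "effect X" and Y: "effect Y" and commutant: "\<And>x. X (Y x) = Y (X x)"
    and sq: "\<And>x. X (X x) = Y (Y x)"
  shows "X x = Y x"
proof -
  define y where "y = X x - Y x"
  have "X y + Y y = 0" by (simp add: y_def effect_diff[OF X] effect_diff[OF Y] commutant sq)
  then have "inner y (X y) + inner y (Y y) = 0" by (simp flip: inner_add_right)
  then have "X y = 0" "Y y = 0"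
    using effect_ge0[OF X, of y] effect_ge0[OF Y, of y] effect_form_zero[OF X, of y]
      effect_form_zero[OF Y, of y] by auto
  then have "inner y y = 0"
    using effect_sym_inner[OF X, of y x] effect_sym_inner[OF Y, of y x]
    unfolding y_def by (simp add: inner_diff_right)
  then show ?thesis by (simp add: y_def)
qed

section \<open>Positive self-adjoint operators\<close>

lemma inner_le_norm_add:
  fixes a t :: "'a::real_inner"
  assumes "0 \<le> inner a t"
  shows "(norm a)\<^sup>2 \<le> (norm (a + t))\<^sup>2" "(norm a)\<^sup>2 + inner a t \<le> (norm (a + t))\<^sup>2"
    "norm a \<le> norm (a + t)"
proof -
  have "(norm (a + t))\<^sup>2 = (norm a)\<^sup>2 + 2 * inner a t + (norm t)\<^sup>2"
    unfolding power2_norm_eq_inner by (simp add: inner_add inner_commute)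
  then show *: "(norm a)\<^sup>2 \<le> (norm (a + t))\<^sup>2" "(norm a)\<^sup>2 + inner a t \<le> (norm (a + t))\<^sup>2"
    using assms by auto
  show "norm a \<le> norm (a + t)" using *(1) by (rule power2_le_imp_le) simp
qed

lemma inner_self_le_zero: "inner a a \<le> 0 \<Longrightarrow> a = 0" for a :: "'a::real_inner"
  by (simp add: power2_norm_eq_inner[symmetric])

lemma adjoint_on_iff:
  "(x, z) \<in> adjoint_on H T \<longleftrightarrow> x \<in> H \<and> z \<in> H \<and> (\<forall>y w. (y, w) \<in> T \<longrightarrow> cinner z y = cinner x w)"
  by (auto simp: adjoint_on_def)

lemma closed_adjoint_on:
  assumes "closed H" shows "closed (adjoint_on H T)"
proof -
  have "p \<in> adjoint_on H T \<longleftrightarrow>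
      p \<in> (H \<times> H) \<inter> (\<Inter>t\<in>T. {p. cinner (snd p) (fst t) = cinner (fst p) (snd t)})" for p
    by (cases p) (simp add: adjoint_on_def case_prod_beta)
  then have "adjoint_on H T = (H \<times> H) \<inter> (\<Inter>t\<in>T. {p. cinner (snd p) (fst t) = cinner (fst p) (snd
    t)})"
    by blast
  then show ?thesis
    by (simp, intro closed_Int closed_Times closed_INT ballI closed_Collect_eq cinner.continuous_on
        continuous_intros assms)
qed

lemma single_valuedI_csubspace:
  assumes "csubspace T" "\<And>y. (0, y) \<in> T \<Longrightarrow> y = 0" shows "single_valued T"
proof (rule single_valuedI)
  fix x y z assume "(x, y) \<in> T" "(x, z) \<in> T"
  then have "(x, y) - (x, z) \<in> T" using assms(1) csubspace_diff by blast
  then show "y = z" using assms(2)[of "y - z"] by simp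
qed

text \<open>A symmetric operator whose sum with 1 is onto admits no larger adjoint; surjectivity
  also gives density of the domain, since a vector z orthogonal to it is orthogonal to its own
  preimage a.\<close>

lemma selfadjointI_resolvent:
  assumes H: "closed H" "csubspace H" and T: "T \<subseteq> H \<times> H" "csubspace T" "single_valued T"
    and sym: "\<And>x y x' y'. (x, y) \<in> T \<Longrightarrow> (x', y') \<in> T \<Longrightarrow> cinner y x' = cinner x y'"
    and pos: "\<And>x y. (x, y) \<in> T \<Longrightarrow> 0 \<le> inner x y"
    and res: "\<And>x. x \<in> H \<Longrightarrow> \<exists>a. (a, x - a) \<in> T"
  shows "selfadjoint_on H T" "positive_operator T"
proof -
  have zero: "(0, 0) \<in> T" using csubspace_0[OF T(2)] by (simp add: zero_prod_def)
  have dom: "csubspace (Domain T)" by (rule csubspace_Domain[OF T(2)])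
  have dense: "densely_defined_on H T"
    unfolding densely_defined_on_def
  proof (rule cdense_if_orth_trivial[OF H(2,1) dom])
    show "Domain T \<subseteq> H" using T(1) by auto
    fix z assume z: "z \<in> H" "\<And>y. y \<in> Domain T \<Longrightarrow> cinner z y = 0"
    obtain a where a: "(a, z - a) \<in> T" using res[OF z(1)] by blast
    then have "cinner z a = 0" using z(2) by blast
    then have "inner z a = 0" by (simp add: Re_cinner[symmetric])
    moreover have "inner z a = inner a (z - a) + inner a a"
      by (simp add: inner_diff_right inner_commute)
    ultimately have "inner a a \<le> 0" using pos[OF a] by linarith
    then have "a = 0" by (rule inner_self_le_zero)
    then show "z = 0" using a zero single_valuedD[OF T(3), of 0 z 0] by simp
  qed
  have "adjoint_on H T \<subseteq> T"
  proof
    fix p assume "p \<in> adjoint_on H T"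
    then obtain u v where p: "p = (u, v)" "u \<in> H" "v \<in> H"
      and uv: "\<And>y w. (y, w) \<in> T \<Longrightarrow> cinner v y = cinner u w" by (cases p) (auto simp: adjoint_on_iff)
    \<comment> \<open>The vector a solves (1 + T) a = u + v, so d = u - a is mapped to -d by the
      adjoint. Testing against the solution e of (1 + T) e = d gives d = 0.\<close>
    have "u + v \<in> H" using p H(2) csubspace_add by blast
    then obtain a where a: "(a, u + v - a) \<in> T" using res by blast
    define d where "d = u - a"
    have "d \<in> H" using a p T(1) H(2) csubspace_diff by (auto simp: d_def)
    then obtain e where e: "(e, d - e) \<in> T" using res by blast
    have "cinner (v - (u + v - a)) e = cinner (u - a) (d - e)"
      by (simp only: cinner.diff_left[of v "u + v - a"] cinner.diff_left[of u a] uv[OF e] sym[OF a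
        e])
    moreover have "v - (u + v - a) = - d" by (simp add: d_def)
    ultimately have "cinner d d = 0" by (simp add: cinner.minus_left cinner.diff_right flip: d_def)
    then have "u = a" by (simp add: cinner_self d_def)
    then show "p \<in> T" using a p by simp
  qed
  moreover have "T \<subseteq> adjoint_on H T" using T(1) sym by (auto simp: adjoint_on_def)
  ultimately show "selfadjoint_on H T"
    using T dense by (auto simp: selfadjoint_on_def linear_operator_on_def)
  show "positive_operator T"
    unfolding positive_operator_def
  proof (clarify, intro conjI)
    fix x y assume xy: "(x, y) \<in> T"
    show "cinner x y \<in> \<real>" using sym[OF xy xy] cinner_commute[of x y]
      by (simp add: complex_is_Real_iff complex_eq_iff)
    show "0 \<le> Re (cinner x y)" using pos[OF xy] by (simp add: Re_cinner)
  qed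
qed

text \<open>The operator \<open>(1 + T)\<^sup>-\<^sup>1\<close> on \<open>H\<close>, extended by \<open>0\<close> to the orthogonal complement of \<open>H\<close>.\<close>

definition resolvent :: "'a::chilbert_space set \<Rightarrow> ('a \<times> 'a) set \<Rightarrow> 'a \<Rightarrow> 'a"
  where "resolvent H T x = (SOME a. (a, proj H x - a) \<in> T)"

section \<open>The resolvent and the root of a positive self-adjoint operator\<close>

locale positive_selfadjoint =
  fixes H :: "'a::chilbert_space set" and T
  assumes closed_H: "closed H" and csubspace_H: "csubspace H"
    and sa: "selfadjoint_on H T" and posT: "positive_operator T"
begin

abbreviation "B \<equiv> resolvent H T"

lemma subspace_H: "subspace H" by (rule csubspace_imp_subspace[OF csubspace_H])

lemma T_sub: "T \<subseteq> H \<times> H" and csubspace_T: "csubspace T" and single_valued_T: "single_valued T"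
  and adjoint_T: "adjoint_on H T = T"
  using sa by (auto simp: selfadjoint_on_def linear_operator_on_def)

lemma closed_T: "closed T"
  using closed_adjoint_on[OF closed_H, of T] by (simp add: adjoint_T)

lemma T_sym: "(x, y) \<in> T \<Longrightarrow> (x', y') \<in> T \<Longrightarrow> cinner y x' = cinner x y'"
  using adjoint_T unfolding adjoint_on_def by blast

lemma T_pos: "(x, y) \<in> T \<Longrightarrow> 0 \<le> inner x y"
  using posT by (auto simp: positive_operator_def Re_cinner)

lemma T_add: "(x, y) \<in> T \<Longrightarrow> (x', y') \<in> T \<Longrightarrow> (x + x', y + y') \<in> T"
  using csubspace_add[OF csubspace_T, of "(x, y)" "(x', y')"] by simp

lemma T_diff: "(x, y) \<in> T \<Longrightarrow> (x', y') \<in> T \<Longrightarrow> (x - x', y - y') \<in> T"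
  using csubspace_diff[OF csubspace_T, of "(x, y)" "(x', y')"] by simp

lemma T_scale: "(x, y) \<in> T \<Longrightarrow> (c *\<^sub>C x, c *\<^sub>C y) \<in> T"
  using csubspace_scale[OF csubspace_T, of "(x, y)" c] by (simp add: scaleC_prod_def)

lemma T_zero: "(0, 0) \<in> T"
  using csubspace_0[OF csubspace_T] by (simp add: zero_prod_def)

text \<open>By positivity the norm of a is at most that of a + t for (a, t) in T, so the range V of
  1 + T is closed. A vector z orthogonal to V gives the pair (z, -z) in the adjoint, which is T, and
  positivity makes z vanish.\<close>

lemma resolvent_ex:
  assumes "x \<in> H" shows "\<exists>a. (a, x - a) \<in> T"
proof -
  define V where "V = (\<lambda>(a, t). a + t) ` T"
  have V_sub: "V \<subseteq> H" using T_sub csubspace_add[OF csubspace_H] by (auto simp: V_def)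
  have csub: "csubspace V"
    unfolding V_def
    by (intro csubspace_image csubspace_T) (auto simp: fst_scaleC snd_scaleC scaleC_add_right
      case_prod_beta)
  have "closed V"
    unfolding closed_sequential_limits
  proof (intro allI impI, elim conjE)
    fix f l assume f: "\<forall>n. f n \<in> V" and lim: "f \<longlonglongrightarrow> l"
    have "\<exists>a. (a, f n - a) \<in> T" for n
    proof -
      obtain b t where "f n = b + t" "(b, t) \<in> T" using f[rule_format, of n] by (auto simp: V_def)
      then show ?thesis by (intro exI[of _ b]) simp
    qed
    then obtain a where a: "\<And>n. (a n, f n - a n) \<in> T" by metis
    have le: "norm (a m - a n) \<le> norm (f m - f n)" for m n
      using inner_le_norm_add(3)[OF T_pos[OF T_diff[OF a[of m] a[of n]]]]
        by (simp add: algebra_simps)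
    have "Cauchy a"
    proof (rule metric_CauchyI)
      fix e :: real assume "0 < e"
      moreover have "Cauchy f" using lim LIMSEQ_imp_Cauchy by blast
      ultimately obtain M where "\<forall>m\<ge>M. \<forall>n\<ge>M. dist (f m) (f n) < e" unfolding Cauchy_def by blast
      then show "\<exists>M. \<forall>m\<ge>M. \<forall>n\<ge>M. dist (a m) (a n) < e"
        using le unfolding dist_norm by (meson order_le_less_trans)
    qed
    then obtain b where b: "a \<longlonglongrightarrow> b" using Cauchy_convergent convergentD by blast
    have "(\<lambda>n. (a n, f n - a n)) \<longlonglongrightarrow> (b, l - b)" by (intro tendsto_intros b lim)
    then have "(b, l - b) \<in> T" by (rule closed_sequentially[OF closed_T a])
    then show "l \<in> V" unfolding V_def by (intro image_eqI[of _ _ "(b, l - b)"]) auto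
  qed
  have "x \<in> V"
  proof -
    define z where "z = x - proj V x"
    have pV: "proj V x \<in> V" by (rule proj_in[OF \<open>closed V\<close> csubspace_imp_subspace[OF csub]])
    have "z \<in> H" using assms pV V_sub csubspace_diff[OF csubspace_H] by (auto simp: z_def)
    moreover have "cinner (- z) y = cinner z w" if "(y, w) \<in> T" for y w
    proof -
      have "y + w \<in> V" unfolding V_def by (intro image_eqI[of _ _ "(y, w)"]) (use that in auto)
      then have "cinner z (y + w) = 0" unfolding z_def by (rule proj_corth(1)[OF \<open>closed V\<close> csub])
      then show ?thesis by (simp add: cinner_add_right cinner.minus_left add_eq_0_iff)
    qed
    ultimately have "(z, - z) \<in> adjoint_on H T"
      using csubspace_neg[OF csubspace_H] by (auto simp: adjoint_on_def)
    then have "0 \<le> inner z (- z)" using T_pos adjoint_T by blast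
    then have "z = 0" by (intro inner_self_le_zero) simp
    then show ?thesis using pV by (simp add: z_def)
  qed
  then obtain a t where "(a, t) \<in> T" "x = a + t" by (auto simp: V_def)
  then show ?thesis by (intro exI[of _ a]) simp
qed

lemma proj_H: "x \<in> H \<Longrightarrow> proj H x = x" "proj H x \<in> H"
  by (auto intro: proj_id proj_in closed_H subspace_H)

lemma B_T: "(B x, proj H x - B x) \<in> T"
  unfolding resolvent_def using resolvent_ex[OF proj_H(2), of x] by (rule someI_ex)

lemma B_T': "x \<in> H \<Longrightarrow> (B x, x - B x) \<in> T"
  using B_T[of x] by (simp add: proj_H)

text \<open>Two solutions differ by a vector that T sends to its negative, which positivity forces
  to be 0.\<close>

lemma B_eq: assumes "(a, t) \<in> T" shows "B (a + t) = a"
proof -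
  have "a + t \<in> H" using assms T_sub csubspace_add[OF csubspace_H] by blast
  from T_diff[OF B_T'[OF this] assms] have "0 \<le> inner (B (a + t) - a) (a + t - B (a + t) - t)"
    by (rule T_pos)
  also have "a + t - B (a + t) - t = - (B (a + t) - a)" by simp
  finally have "B (a + t) - a = 0"
    by (intro inner_self_le_zero) (simp only: inner_minus_right neg_0_le_iff_le)
  then show ?thesis by simp
qed

lemma B_proj: "B (proj H x) = B x"
  using B_eq[OF B_T[of x]] by simp

lemma B_in: "B x \<in> H"
  using B_T[of x] T_sub by blast

lemma T_E:
  assumes "(a, t) \<in> T" obtains w where "w \<in> H" "a = B w" "t = w - B w"
  using assms B_eq[OF assms] T_sub csubspace_add[OF csubspace_H] that[of "a + t"] by auto

lemma B_inj: "x \<in> H \<Longrightarrow> B x = 0 \<Longrightarrow> x = 0"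
  using B_T'[of x] T_zero single_valuedD[OF single_valued_T, of 0 x 0] by simp

lemma effect_B: "effect B"
  unfolding effect_def
proof (intro conjI allI)
  fix x y
  have *: "cinner (B x) y = cinner (B x) (B y) + cinner (B x) (proj H y - B y)" for x y
    using proj_corth(2)[OF closed_H csubspace_H B_in, of x y] by (simp add: cinner.diff_right)
  have "cinner x (B y) = cnj (cinner (B y) x)" by (rule cinner_commute)
  also have "\<dots> = cinner (B x) (B y) + cinner (proj H x - B x) (B y)"
    unfolding *[of y x] using cinner_commute[of "B x" "B y"] cinner_commute[of "proj H x - B x"
      "B y"] by simp
  finally show "cinner (B x) y = cinner x (B y)" using *[of x y] T_sym[OF B_T[of x] B_T[of y]]
    by simp
  have pos: "0 \<le> inner (B x) (proj H x - B x)" by (rule T_pos[OF B_T])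
  have eq: "inner x (B x) = (norm (B x))\<^sup>2 + inner (B x) (proj H x - B x)"
    using arg_cong[OF *[of x x], of Re] by (simp add: Re_cinner inner_commute power2_norm_eq_inner)
  show "0 \<le> inner x (B x)" using eq pos by simp
  have "inner x (B x) \<le> (norm (proj H x))\<^sup>2" using inner_le_norm_add(2)[OF pos] eq by simp
  also have "\<dots> \<le> (norm x)\<^sup>2" by (intro power_mono norm_proj_le closed_H csubspace_H) simp
  finally show "inner x (B x) \<le> inner x x" by (simp add: power2_norm_eq_inner)
qed

definition C where "C = opsqrt B"
definition D where "D = opsqrt (\<lambda>x. x - B x)"

lemma effect_C: "effect C" and effect_D: "effect D"
  by (auto simp: C_def D_def intro: effect_opsqrt effect_B effect_comp1)

lemma C_square: "C (C x) = B x" and D_square: "D (D x) = x - B x"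
  by (auto simp: C_def D_def opsqrt_square effect_B effect_comp1)

lemma commute_CD:
  assumes "bounded_linear X" "\<And>x. X (B x) = B (X x)"
  shows "X (C x) = C (X x)" "X (D x) = D (X x)"
  unfolding C_def D_def
  by (rule opsqrt_commute[OF effect_B assms])
    (rule opsqrt_commute[OF effect_comp1[OF effect_B] assms(1)], simp add: linear_simps[OF
      assms(1)] assms(2))

lemma C_B: "C (B x) = B (C x)" and D_B: "D (B x) = B (D x)"
  by (rule commute_CD[OF effect_bounded_linear[OF effect_B] refl, symmetric])+

lemma C_D: "C (D x) = D (C x)"
  by (rule commute_CD(2)[OF effect_bounded_linear[OF effect_C] C_B])

lemma C_in: "x \<in> H \<Longrightarrow> C x \<in> H" and D_in: "x \<in> H \<Longrightarrow> D x \<in> H"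
  unfolding C_def D_def
  by (rule opsqrt_in[OF effect_B closed_H subspace_H B_in], assumption)
    (rule opsqrt_in[OF effect_comp1[OF effect_B] closed_H subspace_H], rule subspace_diff[OF
      subspace_H _ B_in])

lemma C_inj: "x \<in> H \<Longrightarrow> C x = 0 \<Longrightarrow> x = 0"
  by (rule B_inj) (simp_all add: C_square[symmetric] effect_zero[OF effect_C])

definition R where "R = {(C x, D x) |x. x \<in> H}"

lemma C_dense: "H \<subseteq> closure (C ` H)"
  by (rule effect_dense_range[OF effect_C closed_H csubspace_H C_in C_inj])

text \<open>Since C and D commute and their squares add up to 1, the parameter is recovered from its
  pair as C u + D v. The condition on the right is stable under adjoints and is how membership in
  \<open>R\<close> is tested throughout.\<close>

lemma R_char:
  assumes "u \<in> H" "v \<in> H" "C v = D u"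
  shows "(u, v) \<in> R"
proof -
  define x where "x = C u + D v"
  have "C x = C (C u) + D (D u)" by (simp add: x_def effect_add[OF effect_C] C_D assms(3))
  then have 1: "C x = u" by (simp add: C_square D_square)
  have "D x = C (C v) + D (D v)"
    by (simp add: x_def effect_add[OF effect_D] C_D[symmetric] assms(3))
  then have "D x = v" by (simp add: C_square D_square)
  moreover have "x \<in> H" using assms C_in D_in csubspace_add[OF csubspace_H] by (auto simp: x_def)
  ultimately show ?thesis using 1 unfolding R_def by blast
qed

lemma R_sa: "selfadjoint_on H R" and R_pos: "positive_operator R"
proof -
  have sub: "R \<subseteq> H \<times> H" using C_in D_in by (auto simp: R_def)
  have "R = (\<lambda>x. (C x, D x)) ` H" by (auto simp: R_def)
  then have cs: "csubspace R"
    by (simp, intro csubspace_image csubspace_H)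
      (auto simp: effect_add[OF effect_C] effect_add[OF effect_D]
        effect_scaleC[OF effect_C] effect_scaleC[OF effect_D] scaleC_prod_def)
  have sv: "single_valued R"
    by (rule single_valuedI_csubspace[OF cs]) (auto simp: R_def effect_zero[OF effect_D] dest:
      C_inj)
  have sym: "cinner y x' = cinner x y'" if "(x, y) \<in> R" "(x', y') \<in> R" for x y x' y'
    using that by (auto simp: R_def effect_sym[OF effect_D] effect_sym[OF effect_C] C_D)
  have "adjoint_on H R \<subseteq> R"
  proof
    fix p assume "p \<in> adjoint_on H R"
    then obtain u v where p: "p = (u, v)" "u \<in> H" "v \<in> H"
      and uv: "\<And>y w. (y, w) \<in> R \<Longrightarrow> cinner v y = cinner u w" by (cases p) (auto simp: adjoint_on_iff)
    \<comment> \<open>Moving C and D to the other side turns the adjoint relation into the criterion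
      of \<open>R_char\<close>.\<close>
    have "C v = D u"
    proof (rule cinner_eqI_on[OF csubspace_H C_in[OF p(3)] D_in[OF p(2)]])
      fix z assume "z \<in> H"
      then have "cinner v (C z) = cinner u (D z)" using uv unfolding R_def by blast
      then have "cinner (C v) z = cinner (D u) z"
        by (simp add: effect_sym[OF effect_C] effect_sym[OF effect_D])
      then show "cinner z (C v) = cinner z (D u)" using cinner_commute[of z] by simp
    qed
    then show "p \<in> R" using p R_char by blast
  qed
  moreover have "R \<subseteq> adjoint_on H R" using sub sym by (auto simp: adjoint_on_def)
  moreover have "Domain R = C ` H" by (auto simp: R_def)
  ultimately show "selfadjoint_on H R"
    unfolding selfadjoint_on_def linear_operator_on_def densely_defined_on_def
    using sub cs sv C_dense by auto
  have "effect (\<lambda>x. C (D x))" by (rule effect_compose[OF effect_C effect_D C_D])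
  then have "0 \<le> inner (C x) (D x)" for x using effect_ge0
    by (simp add: effect_sym_inner[OF effect_C])
  then show "positive_operator R"
    unfolding positive_operator_def
  proof (clarify, intro conjI)
    fix x y assume xy: "(x, y) \<in> R"
    show "cinner x y \<in> \<real>" using sym[OF xy xy] cinner_commute[of x y]
      by (simp add: complex_is_Real_iff complex_eq_iff)
    show "0 \<le> Re (cinner x y)" using xy \<open>\<And>x. 0 \<le> inner (C x) (D x)\<close> by (auto simp: R_def Re_cinner)
  qed
qed

lemma R_square: "R O R = T"
proof (intro equalityI subsetI)
  fix p assume "p \<in> R O R"
  then obtain x y where p: "p = (C x, D y)" "D x = C y" "x \<in> H" "y \<in> H" unfolding R_def by blast
  \<comment> \<open>The common parameter with C w = x and D w = y, found as in
    \<open>R_char\<close>; the composite pair is then (C C w, D D w).\<close>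
  define w where "w = C x + D y"
  have "C w = C (C x) + D (D x)" by (simp add: w_def effect_add[OF effect_C] C_D p(2))
  then have 1: "C w = x" by (simp add: C_square D_square)
  have "D w = C (C y) + D (D y)" by (simp add: w_def effect_add[OF effect_D] C_D[symmetric] p(2))
  then have "D w = y" by (simp add: C_square D_square)
  then have "p = (B w, w - B w)" using 1 p C_square[of w] D_square[of w] by simp
  moreover have "w \<in> H" using p C_in D_in csubspace_add[OF csubspace_H] by (auto simp: w_def)
  ultimately show "p \<in> T" using B_T' by simp
next
  fix p assume "p \<in> T"
  then obtain w where w: "p = (B w, w - B w)" "w \<in> H" by (cases p) (auto elim: T_E)
  have "(C (C w), D (C w)) \<in> R" using w C_in unfolding R_def by blast
  moreover have "(C (D w), D (D w)) \<in> R" using w D_in unfolding R_def by blast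
  ultimately show "p \<in> R O R" using w by (auto simp: C_square D_square C_D)
qed

lemma R_unique:
  assumes "selfadjoint_on H R'" "positive_operator R'" "R' O R' = T"
  shows "R' = R"
proof -
  interpret R': positive_selfadjoint H R'
    by standard (use assms closed_H csubspace_H in auto)
  let ?b = "R'.B"
  note eb = R'.effect_B and eB = effect_B and eC = effect_C and eD = effect_D
  note e_simps = effect_add[OF eb] effect_add[OF eB] effect_diff[OF eb] effect_diff[OF eB]
    effect_diff[OF eC] effect_diff[OF eD] effect_add[OF eC] effect_add[OF eD]
  have dH: "x - y \<in> H" if "x \<in> H" "y \<in> H" for x y using that csubspace_diff[OF csubspace_H] by blast
  \<comment> \<open>Write b for \<open>?b\<close>. The operator R' sends b w to (1 - b) w, hence T
    sends b^2 w to (1 - b)^2 w, which says B (b^2 + (1 - b)^2) = b^2 on H.\<close>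
  have BG: "B (?b (?b w) + (w - ?b w - ?b (w - ?b w))) = ?b (?b w)" if "w \<in> H" for w
  proof (rule B_eq)
    have "(?b (?b w), ?b w - ?b (?b w)) \<in> R'" by (rule R'.B_T'[OF R'.B_in])
    moreover have "(?b (w - ?b w), (w - ?b w) - ?b (w - ?b w)) \<in> R'"
      by (intro R'.B_T' dH that R'.B_in)
    ultimately show "(?b (?b w), w - ?b w - ?b (w - ?b w)) \<in> T" using assms(3)
      by (auto simp: e_simps)
  qed
  \<comment> \<open>The intermediate value r of R' O R' at B z equals both (1 - b) u and b v, so w =
    u + v satisfies b w = u and w - b w = v.\<close>
  have Gsurj: "\<exists>w\<in>H. z = ?b (?b w) + (w - ?b w - ?b (w - ?b w))" if z: "z \<in> H" for z
  proof -
    obtain r where r: "(B z, r) \<in> R'" "(r, z - B z) \<in> R'" using B_T'[OF z] assms(3) by blast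
    obtain u where u: "u \<in> H" "B z = ?b u" "r = u - ?b u" by (rule R'.T_E[OF r(1)])
    obtain v where v: "v \<in> H" "r = ?b v" "z - B z = v - ?b v" by (rule R'.T_E[OF r(2)])
    have "?b (u + v) = u" using u v by (simp add: e_simps)
    moreover have "z = ?b u + (v - ?b v)" using u v
      by (metis add_diff_cancel_left' diff_add_cancel add.commute)
    ultimately show ?thesis using u v csubspace_add[OF csubspace_H]
      by (intro bexI[of _ "u + v"]) (auto simp: e_simps)
  qed
  \<comment> \<open>By \<open>Gsurj\<close> the identity \<open>BG\<close> describes B on all of H
    through b alone, so B commutes with b.\<close>
  have comm0: "B (?b z) = ?b (B z)" if z: "z \<in> H" for z
  proof -
    obtain w where w: "w \<in> H" "z = ?b (?b w) + (w - ?b w - ?b (w - ?b w))" using Gsurj[OF z]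
      by blast
    have "?b z = ?b (?b (?b w)) + (?b w - ?b (?b w) - ?b (?b w - ?b (?b w)))" unfolding w(2)
      by (simp add: e_simps)
    then show ?thesis using BG[OF R'.B_in, of w] BG[OF w(1)] w(2) by simp
  qed
  have commutant: "B (?b z) = ?b (B z)" for z
    using comm0[OF proj_H(2), of z] by (simp add: B_proj R'.B_proj)
  have cb: "?b (C x) = C (?b x)" "?b (D x) = D (?b x)" for x
    by (auto intro!: commute_CD effect_bounded_linear eb simp: commutant)
  have sq: "B (?b (?b x) + (x - ?b x - (?b x - ?b (?b x)))) = ?b (?b x)" for x
  proof -
    have "B (proj H x) = B x" "?b (proj H x) = ?b x" by (simp_all add: B_proj R'.B_proj)
    then show ?thesis using BG[OF proj_H(2), of x] by (simp add: e_simps)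
  qed
  have "D (?b w) = C (w - ?b w)" for w
  proof (rule effect_sqrt_unique[of "\<lambda>x. D (?b x)" "\<lambda>x. C (x - ?b x)"])
    show "effect (\<lambda>x. D (?b x))" by (rule effect_compose[OF eD eb]) (simp add: cb)
    show "effect (\<lambda>x. C (x - ?b x))"
      by (rule effect_compose[OF eC effect_comp1[OF eb]]) (simp add: cb e_simps)
    show "D (?b (C (x - ?b x))) = C (D (?b x) - ?b (D (?b x)))" for x
      by (simp add: e_simps cb C_D)
    fix x
    \<comment> \<open>The two squares are (1 - B) b^2 and B (1 - b)^2; their equality is a
      rearrangement of \<open>sq\<close>.\<close>
    have "D (?b (D (?b x))) = ?b (?b x) - B (?b (?b x))" by (simp add: cb D_square)
    also have "\<dots> = B (x - ?b x - (?b x - ?b (?b x)))"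
      using sq[of x] by (simp only: e_simps) (metis add_diff_cancel_left')
    also have "\<dots> = C (C (x - ?b x) - ?b (C (x - ?b x)))"
      by (simp add: e_simps cb C_square)
    finally show "D (?b (D (?b x))) = C (C (x - ?b x) - ?b (C (x - ?b x)))" .
  qed
  \<comment> \<open>Adjoints reverse inclusions, so one self-adjoint operator contained in another
    equals it.\<close>
  then have "R' \<subseteq> R" using R_char R'.B_in dH by (auto elim!: R'.T_E)
  moreover from this have "adjoint_on H R \<subseteq> adjoint_on H R'" by (auto simp: adjoint_on_def)
  ultimately show ?thesis using R_sa R'.adjoint_T by (auto simp: selfadjoint_on_def)
qed

lemma sqrt_on_eq: "sqrt_on H T = R"
  unfolding sqrt_on_def
proof (rule the_equality)
  show "selfadjoint_on H R \<and> positive_operator R \<and> R O R = T"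
    by (intro conjI R_sa R_pos R_square)
  show "R' = R" if "selfadjoint_on H R' \<and> positive_operator R' \<and> R' O R' = T" for R'
    using that by (elim conjE) (rule R_unique)
qed

end

section \<open>Polar decomposition of antilinear involutions\<close>

lemma antilinear_adjoint_on_iff:
  "(x, z) \<in> antilinear_adjoint_on H T \<longleftrightarrow> x \<in> H \<and> z \<in> H \<and> (\<forall>y w. (y, w) \<in> T \<longrightarrow> cinner z y = cinner w
    x)"
  by (auto simp: antilinear_adjoint_on_def)

lemma closure_converse:
  fixes G :: "('a::metric_space \<times> 'b::metric_space) set"
  shows "closure (G\<inverse>) = (closure G)\<inverse>"
proof (intro equalityI)
  have cl: "closed ((closure K)\<inverse>)" for K :: "('c::metric_space \<times> 'd::metric_space) set"
  proof -
    have "(closure K)\<inverse> = (\<lambda>p. (snd p, fst p)) -` closure K" by auto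
    then show ?thesis by (simp add: closed_vimage continuous_intros)
  qed
  show "closure (G\<inverse>) \<subseteq> (closure G)\<inverse>"
    using closure_subset by (intro closure_minimal cl) fastforce
  have "G \<subseteq> (closure (G\<inverse>))\<inverse>" using closure_subset by fastforce
  then have "closure G \<subseteq> (closure (G\<inverse>))\<inverse>" by (intro closure_minimal cl)
  then show "(closure G)\<inverse> \<subseteq> closure (G\<inverse>)" by blast
qed

lemma Domain_closure_bounded:
  fixes G :: "('a::real_normed_vector \<times> 'b::banach) set"
  assumes G: "subspace G" and K: "\<And>x y. (x, y) \<in> G \<Longrightarrow> norm y \<le> K * norm x"
    and x: "x \<in> closure (Domain G)"
  shows "\<exists>y. (x, y) \<in> closure G"
proof -
  obtain f where f: "\<And>n. f n \<in> Domain G" "f \<longlonglongrightarrow> x" using x unfolding closure_sequential by blast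
  then have "\<exists>y. (f n, y) \<in> G" for n by blast
  then obtain g where g: "\<And>n. (f n, g n) \<in> G" by metis
  have le: "norm (g m - g n) \<le> K * norm (f m - f n)" for m n
    using K subspace_diff[OF G g[of m] g[of n]] by simp
  \<comment> \<open>K may be zero or negative; the enlarged constant is positive and can be divided
    by.\<close>
  have le': "norm (g m - g n) \<le> (\<bar>K\<bar> + 1) * norm (f m - f n)" for m n
    by (rule order_trans[OF le]) (auto intro!: mult_right_mono)
  have "Cauchy g"
  proof (rule metric_CauchyI)
    fix e :: real assume "0 < e"
    then have "0 < e / (\<bar>K\<bar> + 1)" by simp
    then obtain M where M: "\<forall>m\<ge>M. \<forall>n\<ge>M. dist (f m) (f n) < e / (\<bar>K\<bar> + 1)"
      using LIMSEQ_imp_Cauchy[OF f(2)] unfolding Cauchy_def by blast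
    have "dist (g m) (g n) < e" if "m \<ge> M" "n \<ge> M" for m n
    proof -
      have "(\<bar>K\<bar> + 1) * norm (f m - f n) < e"
        using M that by (simp add: dist_norm pos_less_divide_eq mult.commute)
      then show ?thesis using le'[of m n] by (simp add: dist_norm)
    qed
    then show "\<exists>M. \<forall>m\<ge>M. \<forall>n\<ge>M. dist (g m) (g n) < e" by blast
  qed
  then obtain y where y: "g \<longlonglongrightarrow> y" using Cauchy_convergent convergentD by blast
  then have "(\<lambda>n. (f n, g n)) \<longlonglongrightarrow> (x, y)" by (intro tendsto_Pair f)
  then show ?thesis unfolding closure_sequential using g
    by (intro exI[of _ y] exI[of _ "\<lambda>n. (f n, g n)"]) simp
qed

lemma antilinear_imp_subspace: "antilinear_operator_on H S \<Longrightarrow> subspace S"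
  unfolding subspace_def antilinear_operator_on_def
proof (elim conjE, intro conjI ballI allI)
  fix r x assume "\<forall>c. \<forall>(x, y)\<in>S. (c *\<^sub>C x, cnj c *\<^sub>C y) \<in> S" "x \<in> S"
  then have "(complex_of_real r *\<^sub>C fst x, cnj (complex_of_real r) *\<^sub>C snd x) \<in> S" by fastforce
  then show "r *\<^sub>R x \<in> S" by (simp add: scaleR_prod_def scaleR_scaleC)
qed (simp_all add: zero_prod_def plus_prod_def case_prod_beta)

lemma antilinear_operatorD:
  assumes "antilinear_operator_on H S"
  shows "S \<subseteq> H \<times> H" "(0, 0) \<in> S" "(x, y) \<in> S \<Longrightarrow> (x', y') \<in> S \<Longrightarrow> (x + x', y + y') \<in> S"
    "(x, y) \<in> S \<Longrightarrow> (c *\<^sub>C x, cnj c *\<^sub>C y) \<in> S" "(x, y) \<in> S \<Longrightarrow> (x, z) \<in> S \<Longrightarrow> y = z"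
proof -
  note * = assms[unfolded antilinear_operator_on_def]
  show "S \<subseteq> H \<times> H" "(0, 0) \<in> S" using * by blast+
  show "(x, y) \<in> S \<Longrightarrow> (x', y') \<in> S \<Longrightarrow> (x + x', y + y') \<in> S" using * by fastforce
  show "(x, y) \<in> S \<Longrightarrow> (c *\<^sub>C x, cnj c *\<^sub>C y) \<in> S" using * by fastforce
  show "(x, y) \<in> S \<Longrightarrow> (x, z) \<in> S \<Longrightarrow> y = z" using * unfolding single_valued_def by blast
qed

lemma bounded_linear_twist: "bounded_linear (\<lambda>p. (c *\<^sub>C fst p, d *\<^sub>C snd p))"
  by (intro bounded_linear_Pair bounded_linear_compose[OF bounded_linear_scaleC]
    bounded_linear_fst bounded_linear_snd)

lemma antilinear_closure:
  assumes H: "closed H" and G: "antilinear_operator_on H G" and sv: "\<And>y. (0, y) \<in> closure G \<Longrightarrow> y = 0"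
  shows "antilinear_operator_on H (closure G)"
proof -
  have sub: "subspace (closure G)" by (intro closure_subspace antilinear_imp_subspace[OF G])
  have "closure G \<subseteq> H \<times> H"
    using G H by (intro closure_minimal closed_Times) (auto simp: antilinear_operator_on_def)
  moreover have "single_valued (closure G)"
  proof (rule single_valuedI)
    fix x y z assume "(x, y) \<in> closure G" "(x, z) \<in> closure G"
    from subspace_diff[OF sub this] show "y = z" using sv[of "y - z"] by simp
  qed
  moreover have "(c *\<^sub>C x, cnj c *\<^sub>C y) \<in> closure G" if "(x, y) \<in> closure G" for c x y
  proof -
    have "(x, y) \<in> closure G" by (fact that)
    then obtain f where f: "\<And>n. f n \<in> G" "f \<longlonglongrightarrow> (x, y)" unfolding closure_sequential by blast
    have "(\<lambda>n. (c *\<^sub>C fst (f n), cnj c *\<^sub>C snd (f n))) \<longlonglongrightarrow> (c *\<^sub>C x, cnj c *\<^sub>C y)"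
      using bounded_linear.tendsto[OF bounded_linear_twist f(2), of c "cnj c"] by simp
    moreover have "(c *\<^sub>C fst (f n), cnj c *\<^sub>C snd (f n)) \<in> G" for n
      using G f(1)[of n] unfolding antilinear_operator_on_def by (cases "f n") fastforce
    ultimately show ?thesis unfolding closure_sequential
      by (intro exI[of _ "\<lambda>n. (c *\<^sub>C fst (f n), cnj c *\<^sub>C snd (f n))"]) simp
  qed
  ultimately show ?thesis
    unfolding antilinear_operator_on_def
    using subspace_0[OF sub] subspace_add[OF sub] by (fastforce simp: zero_prod_def)
qed

lemma antiunitary_closure:
  assumes H: "closed H" and G: "antilinear_operator_on H G"
    and iso: "\<And>x y x' y'. (x, y) \<in> G \<Longrightarrow> (x', y') \<in> G \<Longrightarrow> cinner y y' = cinner x' x"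
    and dense: "H \<subseteq> closure (Domain G)" "H \<subseteq> closure (Range G)"
  shows "antiunitary_on H (closure G)"
proof -
  have isoc: "cinner y y' = cinner x' x" if p: "(x, y) \<in> closure G" "(x', y') \<in> closure G"
    for x y x' y'
  proof -
    obtain f g where f: "\<And>n. f n \<in> G" "f \<longlonglongrightarrow> (x, y)" and g: "\<And>n. g n \<in> G" "g \<longlonglongrightarrow> (x', y')"
      using p unfolding closure_sequential by metis
    have "cinner (snd (f n)) (snd (g n)) = cinner (fst (g n)) (fst (f n))" for n
      using iso[of "fst (f n)" "snd (f n)" "fst (g n)" "snd (g n)"] f(1)[of n] g(1)[of n] by simp
    moreover have "(\<lambda>n. cinner (snd (f n)) (snd (g n))) \<longlonglongrightarrow> cinner y y'"
      using cinner.tendsto[OF tendsto_snd[OF f(2)] tendsto_snd[OF g(2)]] by simp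
    moreover have "(\<lambda>n. cinner (fst (g n)) (fst (f n))) \<longlonglongrightarrow> cinner x' x"
      using cinner.tendsto[OF tendsto_fst[OF g(2)] tendsto_fst[OF f(2)]] by simp
    ultimately show ?thesis using LIMSEQ_unique by simp
  qed
  have al: "antilinear_operator_on H (closure G)"
  proof (rule antilinear_closure[OF H G])
    fix y assume "(0, y) \<in> closure G"
    from isoc[OF this this] show "y = 0" by (simp add: cinner_self)
  qed
  then have sub: "closure G \<subseteq> H \<times> H" by (simp add: antilinear_operator_on_def)
  have norm_eq: "norm y = norm x" if "(x, y) \<in> G" for x y
    using iso[OF that that] unfolding cinner_self of_real_eq_iff by simp
  have G': "subspace G" by (rule antilinear_imp_subspace[OF G])
  \<comment> \<open>The converse of G is again a real subspace on which norms agree, so surjectivity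
    of the closure is totality of the closure of the converse.\<close>
  have "(b + b', a + a') \<in> G" if "(b, a) \<in> G" "(b', a') \<in> G" for a b a' b'
    using subspace_add[OF G' that] by simp
  moreover have "(c *\<^sub>R b, c *\<^sub>R a) \<in> G" if "(b, a) \<in> G" for a b c
    using subspace_scale[OF G' that] by simp
  ultimately have Gc: "subspace (G\<inverse>)"
    using subspace_0[OF G'] unfolding subspace_def by (auto simp: zero_prod_def)
  have "\<exists>y. (x, y) \<in> closure G" if "x \<in> H" for x
    by (rule Domain_closure_bounded[OF G', of 1]) (use norm_eq dense that in auto)
  moreover have "\<exists>x. (x, y) \<in> closure G" if "y \<in> H" for y
  proof -
    have "\<exists>x. (y, x) \<in> closure (G\<inverse>)"
      by (rule Domain_closure_bounded[OF Gc, of 1]) (use norm_eq dense that in auto)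
    then show ?thesis by (simp add: closure_converse)
  qed
  ultimately have "Domain (closure G) = H" "Range (closure G) = H" using sub by blast+
  moreover have "\<forall>(x, y)\<in>closure G. \<forall>(x', y')\<in>closure G. cinner y y' = cinner x' x"
    by clarify (rule isoc)
  ultimately show ?thesis unfolding antiunitary_on_def using al by blast
qed

lemma antiunitary_norm_diff:
  assumes "antiunitary_on H J" "(x, y) \<in> J" "(x', y') \<in> J"
  shows "norm (y - y') = norm (x - x')"
proof -
  have "subspace J" using assms(1) antilinear_imp_subspace unfolding antiunitary_on_def by blast
  from subspace_diff[OF this assms(2,3)] have d: "(x - x', y - y') \<in> J" by simp
  then have "cinner (y - y') (y - y') = cinner (x - x') (x - x')"
    using assms(1) unfolding antiunitary_on_def by blast
  then show ?thesis unfolding cinner_self of_real_eq_iff by simp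
qed

lemma antiunitary_cinner:
  "antiunitary_on H J \<Longrightarrow> (x, y) \<in> J \<Longrightarrow> (x', y') \<in> J \<Longrightarrow> cinner y y' = cinner x' x"
  unfolding antiunitary_on_def by blast

lemma antiunitary_ex: "antiunitary_on H J \<Longrightarrow> x \<in> H \<Longrightarrow> \<exists>y\<in>H. (x, y) \<in> J"
  unfolding antiunitary_on_def by blast

lemma antiunitary_sv: "antiunitary_on H J \<Longrightarrow> (x, y) \<in> J \<Longrightarrow> (x, z) \<in> J \<Longrightarrow> y = z"
  unfolding antiunitary_on_def antilinear_operator_on_def by (blast dest: single_valuedD)

lemma antiunitary_eqI_dense:
  assumes J: "antiunitary_on H J" "antiunitary_on H J'" and D: "D \<subseteq> H" "H \<subseteq> closure D"
    and agree: "\<And>d y. d \<in> D \<Longrightarrow> (d, y) \<in> J \<Longrightarrow> (d, y) \<in> J'"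
  shows "J = J'"
proof -
  have sub: "J \<subseteq> J'"
  proof
    fix p assume "p \<in> J"
    then obtain x y where p: "p = (x, y)" "(x, y) \<in> J" by (cases p) auto
    then have "x \<in> H" using J(1) unfolding antiunitary_on_def by blast
    then obtain y' where y': "(x, y') \<in> J'" using antiunitary_ex[OF J(2)] by blast
    have "x \<in> closure D" using \<open>x \<in> H\<close> D by blast
    then obtain f where f: "\<And>n. f n \<in> D" "f \<longlonglongrightarrow> x" unfolding closure_sequential by blast
    then have "\<And>n. f n \<in> H" using D by blast
    then have "\<exists>y. (f n, y) \<in> J" for n using antiunitary_ex[OF J(1)] by blast
    then obtain g where g: "\<And>n. (f n, g n) \<in> J" by metis
    have lim: "(\<lambda>n. norm (f n - x)) \<longlonglongrightarrow> 0" using f(2) by (simp add: tendsto_norm_zero LIM_zero)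
    have "(\<lambda>n. norm (g n - y)) \<longlonglongrightarrow> 0" using lim antiunitary_norm_diff[OF J(1) g p(2)] by simp
    then have "g \<longlonglongrightarrow> y" by (simp add: tendsto_norm_zero_iff LIM_zero_iff)
    moreover have "(\<lambda>n. norm (g n - y')) \<longlonglongrightarrow> 0"
      using lim antiunitary_norm_diff[OF J(2) agree[OF f(1) g] y'] by simp
    then have "g \<longlonglongrightarrow> y'" by (simp add: tendsto_norm_zero_iff LIM_zero_iff)
    ultimately have "y = y'" using LIMSEQ_unique by blast
    then show "p \<in> J'" using p y' by simp
  qed
  moreover have "J' \<subseteq> J"
  proof
    fix p assume "p \<in> J'"
    then obtain x y where p: "p = (x, y)" "(x, y) \<in> J'" by (cases p) auto
    then have "x \<in> H" using J(2) unfolding antiunitary_on_def by blast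
    then obtain y' where y': "(x, y') \<in> J" using antiunitary_ex[OF J(1)] by blast
    then have "y' = y" using sub p antiunitary_sv[OF J(2)] by blast
    then show "p \<in> J" using p y' by simp
  qed
  ultimately show ?thesis by blast
qed

section \<open>The polar decomposition of a closed antilinear S with S = S^-1\<close>

locale antilinear_involution =
  fixes H :: "'a::chilbert_space set" and S
  assumes closed_H: "closed H" and csubspace_H: "csubspace H"
    and al: "antilinear_operator_on H S" and closed_S: "closed S"
    and dd: "densely_defined_on H S" and S_swap: "(x, y) \<in> S \<Longrightarrow> (y, x) \<in> S"
begin

abbreviation "adj \<equiv> antilinear_adjoint_on H S"

definition T where "T = S O adj"

lemma S_sub: "S \<subseteq> H \<times> H" and S_zero: "(0, 0) \<in> S"
  and S_add: "(x, y) \<in> S \<Longrightarrow> (x', y') \<in> S \<Longrightarrow> (x + x', y + y') \<in> S"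
  and S_scale: "(x, y) \<in> S \<Longrightarrow> (c *\<^sub>C x, cnj c *\<^sub>C y) \<in> S"
  and S_sv: "(x, y) \<in> S \<Longrightarrow> (x, z) \<in> S \<Longrightarrow> y = z"
  by (fact antilinear_operatorD[OF al])+

lemma subspace_S: "subspace S" by (rule antilinear_imp_subspace[OF al])

lemma S_diff: "(x, y) \<in> S \<Longrightarrow> (x', y') \<in> S \<Longrightarrow> (x - x', y - y') \<in> S"
  using subspace_diff[OF subspace_S, of "(x, y)" "(x', y')"] by simp

lemma S_dense: "H \<subseteq> closure (Domain S)"
  using dd by (simp add: densely_defined_on_def)

lemma adj_S: "(x, z) \<in> adj \<Longrightarrow> (y, w) \<in> S \<Longrightarrow> cinner z y = cinner w x"
  by (simp add: antilinear_adjoint_on_iff)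

lemma adj_swap: "(x, z) \<in> adj \<Longrightarrow> (z, x) \<in> adj"
  unfolding antilinear_adjoint_on_iff
proof (elim conjE, intro conjI allI impI)
  fix y w assume a: "\<forall>y w. (y, w) \<in> S \<longrightarrow> cinner z y = cinner w x" and "(y, w) \<in> S"
  then have "cinner z w = cinner y x" using S_swap by blast
  then show "cinner x y = cinner w z" using cinner_commute[of w z] cinner_commute[of x y] by simp
qed

lemma adj_sv:
  assumes "(x, y) \<in> adj" "(x, z) \<in> adj" shows "y = z"
proof -
  have "cinner (y - z) a = 0" if "a \<in> Domain S" for a
    using that adj_S[OF assms(1)] adj_S[OF assms(2)] by (auto simp: cinner.diff_left)
  moreover have "y - z \<in> H" using assms csubspace_diff[OF csubspace_H]
    by (auto simp: antilinear_adjoint_on_iff)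
  ultimately have "cinner (y - z) (y - z) = 0" using orth_closure[of "Domain S"] S_dense by blast
  then show ?thesis by (simp add: cinner_self)
qed

lemma adj_zero: "(0, 0) \<in> adj"
  by (simp add: antilinear_adjoint_on_iff csubspace_0[OF csubspace_H])

lemma adj_add: "(x, y) \<in> adj \<Longrightarrow> (x', y') \<in> adj \<Longrightarrow> (x + x', y + y') \<in> adj"
  by (simp add: antilinear_adjoint_on_iff csubspace_add[OF csubspace_H] cinner_add_left
    cinner_add_right)

lemma adj_scale: "(x, y) \<in> adj \<Longrightarrow> (c *\<^sub>C x, cnj c *\<^sub>C y) \<in> adj"
  by (simp add: antilinear_adjoint_on_iff csubspace_scale[OF csubspace_H] cinner_scaleC_left
    cinner_scaleC_right)

lemma adj_cnj: "(x, z) \<in> adj \<Longrightarrow> (y, w) \<in> S \<Longrightarrow> cinner y z = cinner x w"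
  using adj_S cinner_commute[of y z] cinner_commute[of x w] by simp

text \<open>The orthogonal decomposition of \<open>(x, 0)\<close> with respect to the graph of \<open>S\<close> solves \<open>x = a + S\<^sup>* S a\<close>.\<close>

lemma T_resolvent:
  assumes "x \<in> H" shows "\<exists>a. (a, x - a) \<in> T"
proof -
  obtain a s where as: "proj S (x, 0) = (a, s)" by (cases "proj S (x, 0)")
  have aS: "(a, s) \<in> S" using proj_in[OF closed_S subspace_S, of "(x, 0)"] as by simp
  have orth: "inner (x - a) y = inner s w" if "(y, w) \<in> S" for y w
    using proj_orth[OF closed_S subspace_S that, of "(x, 0)"] as by (simp add: inner_prod_def)
  have "cinner (x - a) y = cinner w s" if "(y, w) \<in> S" for y w
  proof (rule complex_eqI)
    show "Re (cinner (x - a) y) = Re (cinner w s)" using orth[OF that]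
      by (simp add: Re_cinner inner_commute)
    \<comment> \<open>The graph of S is only real-linear, so the projection yields real
      orthogonality; the pair for \<i> y, whose second entry is -\<i> w, supplies the imaginary
      part.\<close>
    have "Re (cinner (x - a) (\<i> *\<^sub>C y)) = Re (cinner s (cnj \<i> *\<^sub>C w))"
      using orth[OF S_scale[OF that, of \<i>]] by (simp add: Re_cinner)
    then show "Im (cinner (x - a) y) = Im (cinner w s)"
      using cinner_commute[of w s] by (simp add: cinner_scaleC_right cinner.minus_right)
  qed
  moreover have "a \<in> H" "s \<in> H" using aS S_sub by auto
  moreover from this have "x - a \<in> H" using assms csubspace_diff[OF csubspace_H] by blast
  ultimately have "(s, x - a) \<in> adj" by (simp add: antilinear_adjoint_on_iff)
  then show ?thesis using aS unfolding T_def by blast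
qed

lemma T_selfadjoint: "selfadjoint_on H T" and T_positive: "positive_operator T"
proof -
  have sub: "T \<subseteq> H \<times> H" using S_sub by (auto simp: T_def antilinear_adjoint_on_iff)
  have cs: "csubspace T"
    unfolding complex_vector.subspace_def
  proof (intro conjI ballI allI)
    show "0 \<in> T" unfolding T_def zero_prod_def using S_zero adj_zero by blast
    show "p + q \<in> T" if "p \<in> T" "q \<in> T" for p q
      using that S_add adj_add unfolding T_def by (cases p; cases q) (auto; blast)
    show "c *\<^sub>C p \<in> T" if "p \<in> T" for c p
    proof -
      have "p \<in> T" by (fact that)
      then obtain x s y where "p = (x, y)" "(x, s) \<in> S" "(s, y) \<in> adj" unfolding T_def
        by (cases p) blast
      then show ?thesis using S_scale[of x s c] adj_scale[of s y "cnj c"]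
        by (auto simp: T_def scaleC_prod_def)
    qed
  qed
  have sv: "single_valued T"
    unfolding T_def by (rule single_valuedI) (auto dest: S_sv adj_sv)
  have sym: "cinner y x' = cinner x y'" if "(x, y) \<in> T" "(x', y') \<in> T" for x y x' y'
  proof -
    have "(x, y) \<in> T" "(x', y') \<in> T" by (fact that)+
    then obtain s s' where s: "(x, s) \<in> S" "(s, y) \<in> adj" "(x', s') \<in> S" "(s', y') \<in> adj"
      unfolding T_def by blast
    show ?thesis using adj_S[OF s(2,3)] adj_cnj[OF s(4,1)] by simp
  qed
  have pos: "0 \<le> inner x y" if xy: "(x, y) \<in> T" for x y
  proof -
    obtain s where s: "(x, s) \<in> S" "(s, y) \<in> adj" using xy by (auto simp: T_def)
    from adj_cnj[OF s(2,1)] have "inner x y = inner s s" by (simp add: Re_cinner[symmetric])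
    then show ?thesis by simp
  qed
  show "selfadjoint_on H T" "positive_operator T"
    using selfadjointI_resolvent[OF closed_H csubspace_H sub cs sv sym pos T_resolvent] by blast+
qed

sublocale T: positive_selfadjoint H T
  by standard (rule closed_H csubspace_H T_selfadjoint T_positive)+

abbreviation "B \<equiv> resolvent H T"

text \<open>For w in H this is S B w. The adjoint condition keeps the second half of T B w = w - B w
  at hand.\<close>

definition F where "F w = (SOME s. (B w, s) \<in> S \<and> (s, w - B w) \<in> adj)"

lemma F: assumes "w \<in> H" shows "(B w, F w) \<in> S" "(F w, w - B w) \<in> adj"
proof -
  have "\<exists>s. (B w, s) \<in> S \<and> (s, w - B w) \<in> adj"
    using T.B_T'[OF assms] unfolding T_def by blast
  then have "(B w, F w) \<in> S \<and> (F w, w - B w) \<in> adj" unfolding F_def by (rule someI_ex)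
  then show "(B w, F w) \<in> S" "(F w, w - B w) \<in> adj" by auto
qed

lemma F_in: "w \<in> H \<Longrightarrow> F w \<in> H"
  using F(1) S_sub by blast

lemma F_eq: "w \<in> H \<Longrightarrow> (B w, s) \<in> S \<Longrightarrow> F w = s"
  using F(1) S_sv by blast

lemma F_add: "w \<in> H \<Longrightarrow> w' \<in> H \<Longrightarrow> F (w + w') = F w + F w'"
  by (intro F_eq csubspace_add[OF csubspace_H])
    (simp_all add: effect_add[OF T.effect_B] S_add F(1))

lemma F_scale: "w \<in> H \<Longrightarrow> F (c *\<^sub>C w) = cnj c *\<^sub>C F w"
  by (intro F_eq csubspace_scale[OF csubspace_H])
    (simp_all add: effect_scaleC[OF T.effect_B] S_scale F(1))

lemma F_zero: "F 0 = 0"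
  using F_scale[of 0 0] csubspace_0[OF csubspace_H] by simp

text \<open>Split z as B z plus z - B z. The adjoint of S sends F w to w - B w, which trades the
  first pairing for one with F z; the second is treated with w and z exchanged.\<close>

lemma F_sym:
  assumes "w \<in> H" "z \<in> H" shows "cinner (F w) z = cinner (F z) w"
proof -
  have "cinner (F w) (B z) = cinner (F z) (w - B w)"
    by (rule adj_S[OF adj_swap[OF F(2)] F(1)]) (use assms in auto)
  moreover have "cinner (F z) (B w) = cinner (F w) (z - B z)"
    by (rule adj_S[OF adj_swap[OF F(2)] F(1)]) (use assms in auto)
  ultimately have "cinner (F w) (B z) + cinner (F w) (z - B z) = cinner (F z) (w - B w) + cinner
    (F z) (B w)" by simp
  then show ?thesis by (simp add: cinner_add_right[symmetric])
qed

text \<open>Because S is its own inverse, it conjugates T into T^-1, and the resolvent of T^-1 is 1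
  - B. So S exchanges B and 1 - B.\<close>

lemma S_B: assumes "(x, y) \<in> S" shows "(B x, y - B y) \<in> S"
proof -
  have xy: "x \<in> H" "y \<in> H" using assms S_sub by auto
  have 1: "(x - B x, y - F x) \<in> S" by (rule S_diff[OF assms F(1)[OF xy(1)]])
  have "(y - F x, F x) \<in> T" unfolding T_def using S_swap[OF 1] adj_swap[OF F(2)[OF xy(1)]] by blast
  then have "B (y - F x + F x) = y - F x" by (rule T.B_eq)
  then show ?thesis using F(1)[OF xy(1)] by simp
qed

text \<open>The product B (1 - B) is invariant under the exchange of B and 1 - B, so E commutes with
  S. Moreover E is the root of T applied after B, so the polar decomposition forces J to send E w to
  S B w = F w.\<close>

definition E where "E = opsqrt (\<lambda>x. B (x - B x))"

lemma effect_BB: "effect (\<lambda>x. B (x - B x))"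
  by (rule effect_compose[OF T.effect_B effect_comp1[OF T.effect_B]]) (simp add: effect_diff[OF
    T.effect_B])

lemma effect_E: "effect E"
  unfolding E_def by (rule effect_opsqrt[OF effect_BB])

lemma E_square: "E (E x) = B (x - B x)"
  unfolding E_def by (rule opsqrt_square[OF effect_BB])

lemma E_commute:
  assumes "bounded_linear X" "\<And>x. X (B x) = B (X x)" shows "X (E x) = E (X x)"
  unfolding E_def
  by (rule opsqrt_commute[OF effect_BB assms(1)]) (simp add: assms(2) linear_simps[OF assms(1)])

lemma E_in: "x \<in> H \<Longrightarrow> E x \<in> H"
  unfolding E_def by (rule opsqrt_in[OF effect_BB closed_H T.subspace_H T.B_in])

lemma E_eq: "E x = T.C (T.D x)"
proof (rule effect_sqrt_unique[OF effect_E])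
  show e: "effect (\<lambda>x. T.C (T.D x))" by (rule effect_compose[OF T.effect_C T.effect_D T.C_D])
  show "E (T.C (T.D x)) = T.C (T.D (E x))" for x
    by (rule E_commute[OF effect_bounded_linear[OF e], symmetric]) (simp add: T.C_B T.D_B)
  have "T.C (T.D (T.C (T.D x))) = T.C (T.C (T.D (T.D x)))" for x by (simp only: T.C_D)
  then show "E (E x) = T.C (T.D (T.C (T.D x)))" for x by (simp add: E_square T.C_square T.D_square)
qed

text \<open>Two uses of \<open>S_B\<close>, one of them through the swapped pair, show that S
  preserves B (1 - B); the closed real subspace S then admits
  \<open>opsqrt_closed_graph\<close>.\<close>

lemma S_E: "(x, y) \<in> S \<Longrightarrow> (E x, E y) \<in> S"
  unfolding E_def
proof (rule opsqrt_closed_graph[OF effect_BB effect_BB closed_S subspace_S])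
  fix x y assume "(x, y) \<in> S"
  then have "(x - B x, B y) \<in> S" using S_swap[OF S_B[OF S_swap]] by blast
  then show "(B (x - B x), B (y - B y)) \<in> S" using S_B
    by (fastforce simp: effect_diff[OF T.effect_B])
qed

lemma E_F: assumes "w \<in> H" shows "E (F w) = F (E w)"
proof -
  have "B (E w) = E (B w)" by (rule E_commute[OF effect_bounded_linear[OF T.effect_B] refl])
  then show ?thesis using S_E[OF F(1)[OF assms]] F_eq[OF E_in[OF assms]] by simp
qed

lemma eq_zero_if_F: "z \<in> H \<Longrightarrow> F z = 0 \<Longrightarrow> z = 0"
  using S_sv[OF S_swap[OF F(1)[of z]], of 0] S_zero T.B_inj[of z] by simp

lemma E_inj: assumes "z \<in> H" "E z = 0" shows "z = 0"
proof -
  have "B (z - B z) = 0" using E_square[of z] assms effect_zero[OF effect_E] by simp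
  then have "z - B z = 0" using T.B_inj csubspace_diff[OF csubspace_H assms(1) T.B_in] by blast
  then have "(0, F z) \<in> adj" using adj_swap[OF F(2)[OF assms(1)]] by simp
  then have "F z = 0" using adj_zero adj_sv by blast
  then show ?thesis using eq_zero_if_F assms by blast
qed

definition G where "G = {(E w, F w) |w. w \<in> H}"

lemma G_antilinear: "antilinear_operator_on H G"
  unfolding antilinear_operator_on_def
proof (intro conjI)
  show "G \<subseteq> H \<times> H" using E_in F_in by (auto simp: G_def)
  show "single_valued G"
  proof (rule single_valuedI)
    fix x y z assume "(x, y) \<in> G" "(x, z) \<in> G"
    then obtain w w' where w: "x = E w" "y = F w" "x = E w'" "z = F w'" "w \<in> H" "w' \<in> H"
      unfolding G_def by blast
    then have "E (w - w') = 0" by (simp add: effect_diff[OF effect_E])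
    then have "w = w'" using E_inj[of "w - w'"] w csubspace_diff[OF csubspace_H] by simp
    then show "y = z" using w by simp
  qed
  have "(E 0, F 0) \<in> G" unfolding G_def using csubspace_0[OF csubspace_H] by blast
  then show "(0, 0) \<in> G" by (simp add: F_zero effect_zero[OF effect_E])
  show "\<forall>(x, y)\<in>G. \<forall>(x', y')\<in>G. (x + x', y + y') \<in> G"
  proof (clarify)
    fix x y x' y' assume "(x, y) \<in> G" "(x', y') \<in> G"
    then obtain w w' where w: "x = E w" "y = F w" "x' = E w'" "y' = F w'" "w \<in> H" "w' \<in> H"
      unfolding G_def by blast
    then have "(x + x', y + y') = (E (w + w'), F (w + w'))" "w + w' \<in> H"
      using csubspace_add[OF csubspace_H] by (auto simp: effect_add[OF effect_E] F_add)
    then show "(x + x', y + y') \<in> G" unfolding G_def by blast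
  qed
  show "\<forall>c. \<forall>(x, y)\<in>G. (c *\<^sub>C x, cnj c *\<^sub>C y) \<in> G"
  proof (clarify)
    fix c x y assume "(x, y) \<in> G"
    then obtain w where w: "x = E w" "y = F w" "w \<in> H" unfolding G_def by blast
    then have "(c *\<^sub>C x, cnj c *\<^sub>C y) = (E (c *\<^sub>C w), F (c *\<^sub>C w))" "c *\<^sub>C w \<in> H"
      using csubspace_scale[OF csubspace_H] by (auto simp: effect_scaleC[OF effect_E] F_scale)
    then show "(c *\<^sub>C x, cnj c *\<^sub>C y) \<in> G" unfolding G_def by blast
  qed
qed

text \<open>The adjoint relation turns the product of F w and F w' into the form of B (1 - B) =
  E^2.\<close>

lemma G_iso: "(x, y) \<in> G \<Longrightarrow> (x', y') \<in> G \<Longrightarrow> cinner y y' = cinner x' x"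
proof -
  assume "(x, y) \<in> G" "(x', y') \<in> G"
  then obtain w w' where w: "x = E w" "y = F w" "x' = E w'" "y' = F w'" "w \<in> H" "w' \<in> H"
    unfolding G_def by blast
  have "cinner (F w) (F w') = cinner (w' - B w') (B w)" using adj_S[OF F(2) F(1)] w by simp
  also have "\<dots> = cinner w' (B (w - B w))"
    using effect_sym[OF effect_BB, of w' w] effect_sym[OF T.effect_B, of "w' - B w'" w] by simp
  also have "\<dots> = cinner (E w') (E w)" by (simp add: effect_sym[OF effect_E] E_square)
  finally show ?thesis using w by simp
qed

lemma F_dense: "H \<subseteq> closure (F ` H)"
proof (rule cdense_if_orth_trivial[OF csubspace_H closed_H])
  show "csubspace (F ` H)"
    unfolding complex_vector.subspace_def
  proof (intro conjI ballI allI)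
    show "0 \<in> F ` H" using F_zero csubspace_0[OF csubspace_H] by (metis imageI)
    show "x + y \<in> F ` H" if "x \<in> F ` H" "y \<in> F ` H" for x y
      using that csubspace_add[OF csubspace_H] by (auto simp flip: F_add)
    show "c *\<^sub>C x \<in> F ` H" if x: "x \<in> F ` H" for c x
    proof -
      obtain w where w: "w \<in> H" "x = F w" using x by blast
      then have "c *\<^sub>C x = F (cnj c *\<^sub>C w)" by (simp add: F_scale)
      then show ?thesis using w csubspace_scale[OF csubspace_H] by blast
    qed
  qed
  show "F ` H \<subseteq> H" using F_in by blast
  fix z assume z: "z \<in> H" "\<And>y. y \<in> F ` H \<Longrightarrow> cinner z y = 0"
  have "cinner (F z) w = 0" if "w \<in> H" for w
    using z that F_sym[OF z(1) that] cinner_commute[of "F w" z] by simp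
  then have "cinner (F z) (F z) = 0" using F_in z by blast
  then show "z = 0" using eq_zero_if_F z by (simp add: cinner_self)
qed

lemma E_dense: "H \<subseteq> closure (E ` H)"
  by (rule effect_dense_range[OF effect_E closed_H csubspace_H E_in E_inj])

definition J where "J = closure G"

lemma J_antiunitary: "antiunitary_on H J"
  unfolding J_def
proof (rule antiunitary_closure[OF closed_H G_antilinear])
  show "cinner y y' = cinner x' x" if "(x, y) \<in> G" "(x', y') \<in> G" for x y x' y'
    by (rule G_iso[OF that])
  have "Domain G = E ` H" "Range G = F ` H" by (auto simp: G_def)
  then show "H \<subseteq> closure (Domain G)" "H \<subseteq> closure (Range G)" using E_dense F_dense by simp_all
qed

lemma J_gen: "w \<in> H \<Longrightarrow> (E w, F w) \<in> J"
  unfolding J_def G_def by (rule subsetD[OF closure_subset]) blast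

text \<open>Shows that J is an involution. The image v of F w is compared with E w by pairing both
  with the dense range of F, using that E commutes with F and that F is symmetric.\<close>

lemma J_gen_swap: assumes "w \<in> H" shows "(F w, E w) \<in> J"
proof -
  obtain v where v: "v \<in> H" "(F w, v) \<in> J" using antiunitary_ex[OF J_antiunitary F_in[OF assms]]
    by blast
  have "cinner (v - E w) y = 0" if "y \<in> F ` H" for y
  proof -
    have "y \<in> F ` H" by (fact that)
    then obtain w' where w': "w' \<in> H" "y = F w'" by blast
    have "cinner v (F w') = cinner (E w') (F w)"
      by (rule antiunitary_cinner[OF J_antiunitary v(2) J_gen[OF w'(1)]])
    also have "\<dots> = cinner w' (F (E w))" by (simp add: effect_sym[OF effect_E] E_F[OF assms])
    also have "\<dots> = cnj (cinner (F (E w)) w')" by (rule cinner_commute)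
    also have "\<dots> = cnj (cinner (F w') (E w))" using F_sym[OF E_in[OF assms] w'(1)] by simp
    also have "\<dots> = cinner (E w) (F w')" by (rule cinner_commute[symmetric])
    finally show ?thesis using w' by (simp add: cinner.diff_left)
  qed
  moreover have "v - E w \<in> H" using v E_in[OF assms] csubspace_diff[OF csubspace_H] by blast
  ultimately have "cinner (v - E w) (v - E w) = 0" using orth_closure[of "F ` H"] F_dense by blast
  then show ?thesis using v by (simp add: cinner_self)
qed

lemma J_swap: assumes "(x, y) \<in> J" shows "(y, x) \<in> J"
proof -
  have "G\<inverse> \<subseteq> J" using J_gen_swap by (auto simp: G_def)
  then have "closure (G\<inverse>) \<subseteq> J" unfolding J_def by (intro closure_minimal) auto
  then show ?thesis using assms closure_converse[of G] unfolding J_def by blast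
qed

lemma polar: "S = T.R O J"
proof (intro equalityI subsetI)
  fix p assume "p \<in> S"
  then obtain y s where p: "p = (y, s)" "(y, s) \<in> S" by (cases p) simp
  have ys: "y \<in> H" "s \<in> H" using p S_sub by auto
  obtain j where j: "j \<in> H" "(s, j) \<in> J" using antiunitary_ex[OF J_antiunitary ys(2)] by blast
  \<comment> \<open>Since E = D C, this reads D C j = D^2 y; cancelling D leaves C j = D y, the
    criterion for (y, j) to lie in the root.\<close>
  have Ej: "E j = y - B y"
  proof (rule cinner_eqI_on[OF csubspace_H E_in[OF j(1)]])
    show "y - B y \<in> H" using ys T.B_in csubspace_diff[OF csubspace_H] by blast
    fix w assume w: "w \<in> H"
    have "cinner w (E j) = cinner (E w) j" by (simp add: effect_sym[OF effect_E])
    also have "\<dots> = cinner s (F w)"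
      by (rule antiunitary_cinner[OF J_antiunitary J_gen_swap[OF w] j(2)])
    also have "\<dots> = cinner (w - B w) y" using adj_S[OF F(2)[OF w] p(2)] by simp
    also have "\<dots> = cinner w (y - B y)"
      by (simp add: cinner.diff_left cinner.diff_right effect_sym[OF T.effect_B])
    finally show "cinner w (E j) = cinner w (y - B y)" .
  qed
  have CH: "T.C j \<in> H" "T.D y \<in> H" using T.C_in T.D_in j ys by auto
  have "T.D (T.C j - T.D y) = 0"
    using Ej by (simp add: E_eq T.C_D effect_diff[OF T.effect_D] T.D_square)
  then have "E (T.C j - T.D y) = 0" by (simp add: E_eq effect_zero[OF T.effect_C])
  then have "T.C j = T.D y" using E_inj CH csubspace_diff[OF csubspace_H] by fastforce
  then have "(y, j) \<in> T.R" by (intro T.R_char ys j)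
  then show "p \<in> T.R O J" using J_swap[OF j(2)] p by blast
next
  fix p assume "p \<in> T.R O J"
  then obtain h s where p: "p = (T.C h, s)" "h \<in> H" "(T.D h, s) \<in> J" unfolding T.R_def by blast
  \<comment> \<open>For h = C w the pair is (B w, F w), which lies in S. The range of C is dense in
    H and S is closed, which covers every h.\<close>
  have "h \<in> closure (T.C ` H)" using p(2) T.C_dense by blast
  then obtain f where f: "\<And>n. f n \<in> T.C ` H" "f \<longlonglongrightarrow> h" unfolding closure_sequential by blast
  then obtain w where w: "\<And>n. w n \<in> H" "\<And>n. f n = T.C (w n)" unfolding image_iff by metis
  have DC: "T.D (f n) = E (w n)" for n by (simp add: w E_eq T.C_D)
  have "(\<lambda>n. T.D (f n)) \<longlonglongrightarrow> T.D h"
    by (rule bounded_linear.tendsto[OF effect_bounded_linear[OF T.effect_D] f(2)])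
  then have "(\<lambda>n. norm (E (w n) - T.D h)) \<longlonglongrightarrow> 0" by (simp add: DC tendsto_norm_zero LIM_zero)
  then have "(\<lambda>n. norm (F (w n) - s)) \<longlonglongrightarrow> 0"
    using antiunitary_norm_diff[OF J_antiunitary J_gen[OF w(1)] p(3)] by simp
  then have "(\<lambda>n. F (w n)) \<longlonglongrightarrow> s" by (simp add: tendsto_norm_zero_iff LIM_zero_iff)
  moreover have "(\<lambda>n. T.C (f n)) \<longlonglongrightarrow> T.C h"
    by (rule bounded_linear.tendsto[OF effect_bounded_linear[OF T.effect_C] f(2)])
  then have "(\<lambda>n. B (w n)) \<longlonglongrightarrow> T.C h" by (simp add: w T.C_square)
  ultimately have "(\<lambda>n. (B (w n), F (w n))) \<longlonglongrightarrow> (T.C h, s)" by (intro tendsto_Pair)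
  then show "p \<in> S" unfolding p(1) by (rule closed_sequentially[OF closed_S F(1)[OF w(1)]])
qed

text \<open>Any such decomposition has \<Delta> inside the product of S and its adjoint, hence equal
  to it by self-adjointness. The two antiunitaries then agree on the dense range of E.\<close>

lemma polar_unique:
  assumes J': "antiunitary_on H J'" and \<Delta>: "selfadjoint_on H \<Delta>" "positive_operator \<Delta>"
    and S: "S = sqrt_on H \<Delta> O J'"
  shows "J' = J"
proof -
  interpret \<Delta>: positive_selfadjoint H \<Delta>
    by standard (use closed_H csubspace_H \<Delta> in auto)
  have S': "S = \<Delta>.R O J'" using S \<Delta>.sqrt_on_eq by simp
  interpret R: positive_selfadjoint H \<Delta>.R
    by standard (use closed_H csubspace_H \<Delta>.R_sa \<Delta>.R_pos in auto)
  have "\<Delta> \<subseteq> T"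
  proof
    fix p assume "p \<in> \<Delta>"
    then obtain x r y where p: "p = (x, y)" "(x, r) \<in> \<Delta>.R" "(r, y) \<in> \<Delta>.R"
      using \<Delta>.R_square by (cases p) blast
    have H: "r \<in> H" "y \<in> H" using p R.T_sub by auto
    obtain s where s: "s \<in> H" "(r, s) \<in> J'" using antiunitary_ex[OF J' H(1)] by blast
    have "(x, s) \<in> S" unfolding S' using p s by blast
    moreover have "(s, y) \<in> adj"
      unfolding antilinear_adjoint_on_iff
    proof (intro conjI allI impI s H)
      fix a b assume "(a, b) \<in> S"
      then obtain c where c: "(a, c) \<in> \<Delta>.R" "(c, b) \<in> J'" unfolding S' by blast
      show "cinner y a = cinner b s"
        using R.T_sym[OF p(3) c(1)] antiunitary_cinner[OF J' c(2) s(2)] by simp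
    qed
    ultimately show "p \<in> T" using p unfolding T_def by blast
  qed
  moreover from this have "adjoint_on H T \<subseteq> adjoint_on H \<Delta>" by (auto simp: adjoint_on_def)
  ultimately have "\<Delta> = T" using T.adjoint_T \<Delta>.adjoint_T by auto
  then have S'': "S = T.R O J'" using S' by simp
  show ?thesis
  proof (rule antiunitary_eqI_dense[OF J' J_antiunitary, of "E ` H"])
    show "E ` H \<subseteq> H" "H \<subseteq> closure (E ` H)" using E_in E_dense by auto
    fix d y assume d: "d \<in> E ` H" "(d, y) \<in> J'"
    then obtain w where w: "w \<in> H" "d = E w" by blast
    have R: "(T.C (T.C w), d) \<in> T.R" unfolding T.R_def using w T.C_in T.C_D E_eq by auto
    have "(T.C (T.C w), y) \<in> S" using R d equalityD2[OF S''] by blast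
    then have "y = F w" using F_eq[OF w(1)] by (simp add: T.C_square)
    then show "(d, y) \<in> J" using J_gen w by simp
  qed
qed

lemma modular_conjugation_eq:
  assumes "tomita_operator H \<M> \<Omega> = S"
  shows "modular_conjugation H \<M> \<Omega> = J"
  unfolding modular_conjugation_def assms
proof (rule the_equality)
  show "antiunitary_on H J \<and> (\<exists>\<Delta>. selfadjoint_on H \<Delta> \<and> positive_operator \<Delta> \<and> S = sqrt_on H \<Delta> O J)"
    using J_antiunitary T_selfadjoint T_positive polar T.sqrt_on_eq by metis
  show "J' = J" if "antiunitary_on H J' \<and> (\<exists>\<Delta>. selfadjoint_on H \<Delta> \<and> positive_operator \<Delta> \<and> S =
    sqrt_on H \<Delta> O J')" for J'
    using that polar_unique by blast
qed

end

section \<open>Transfer of the antiunitary part along a bounded linear map\<close>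

lemma modular_transfer:
  fixes V :: "'a::chilbert_space \<Rightarrow> 'b::chilbert_space"
  assumes inv: "antilinear_involution H1 S1" "antilinear_involution H2 S2"
    and V: "bounded_linear V" and VH: "\<And>x. x \<in> H1 \<Longrightarrow> V x \<in> H2"
    and S: "\<And>x y. (x, y) \<in> S1 \<Longrightarrow> (V x, V y) \<in> S2"
    and adj: "\<And>x y. (x, y) \<in> antilinear_adjoint_on H1 S1 \<Longrightarrow> (V x, V y) \<in> antilinear_adjoint_on H2 S2"
    and xy: "(x, y) \<in> antilinear_involution.J H1 S1"
  shows "(V x, V y) \<in> antilinear_involution.J H2 S2"
proof -
  interpret A: antilinear_involution H1 S1 by fact
  interpret B: antilinear_involution H2 S2 by fact
  interpret V: bounded_linear V by fact
  have T: "(V x, V y) \<in> B.T" if "(x, y) \<in> A.T" for x y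
    using that S adj unfolding A.T_def B.T_def by blast
  \<comment> \<open>An inclusion of graphs suffices: every x in H1 is a + t with (a, t) in
    \<open>A.T\<close>, and \<open>B_eq\<close> evaluates the other resolvent at V x.\<close>
  have B: "B.B (V x) = V (A.B x)" if x: "x \<in> H1" for x
    using B.T.B_eq[OF T[OF A.T.B_T'[OF x]]] by (simp add: V.diff)
  \<comment> \<open>The graph of V over H1, where alone the resolvents are known to be intertwined;
    \<open>opsqrt_closed_graph\<close> carries this over to E.\<close>
  define G where "G = (H1 \<times> UNIV) \<inter> {p. V (fst p) = snd p}"
  have "closed {p. V (fst p) = snd p}"
    by (rule closed_Collect_eq[OF V.continuous_on[OF continuous_on_fst[OF continuous_on_id]]
          continuous_on_snd[OF continuous_on_id]])
  then have "closed G" unfolding G_def by (intro closed_Int closed_Times A.closed_H) auto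
  moreover have "subspace G"
    using A.T.subspace_H unfolding G_def subspace_def
      by (auto simp: V.add V.scaleR V.zero mem_Times_iff)
  moreover have "(A.B (x - A.B x), B.B (y - B.B y)) \<in> G" if "(x, y) \<in> G" for x y
    using that subspace_diff[OF A.T.subspace_H _ A.T.B_in] B A.T.B_in
    by (auto simp: G_def B V.diff[symmetric])
  ultimately have "(A.E x, B.E y) \<in> G" if "(x, y) \<in> G" for x y
    unfolding A.E_def B.E_def using that
      by (intro opsqrt_closed_graph[OF A.effect_BB B.effect_BB]) auto
  then have E: "B.E (V x) = V (A.E x)" if "x \<in> H1" for x
    using that unfolding G_def by fastforce
  have F: "B.F (V x) = V (A.F x)" if x: "x \<in> H1" for x
    using B.F_eq[OF VH[OF x]] S[OF A.F(1)[OF x]] B[OF x] by simp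
  define K where "K = (\<lambda>p. (V (fst p), V (snd p))) -` closure B.G"
  have "closed K" unfolding K_def
    by (intro closed_vimage closed_closure continuous_intros V.continuous_on)
  have "A.G \<subseteq> K"
  proof
    fix p assume "p \<in> A.G"
    then obtain w where w: "p = (A.E w, A.F w)" "w \<in> H1" unfolding A.G_def by blast
    have "(B.E (V w), B.F (V w)) \<in> B.G" unfolding B.G_def using VH w by blast
    then have "(V (A.E w), V (A.F w)) \<in> closure B.G"
      using subsetD[OF closure_subset] unfolding E[OF w(2)] F[OF w(2)] by blast
    then show "p \<in> K" using w by (simp add: K_def)
  qed
  then have "closure A.G \<subseteq> K" using \<open>closed K\<close> closure_minimal by blast
  then show ?thesis using xy unfolding A.J_def B.J_def K_def by auto
qed

section \<open>Bounded operators and commutants\<close>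

text \<open>Bounded operators on H are represented by total linear functions with values in H, so
  that composition and continuity need no domain conditions. Only the restriction to H counts, and
  \<open>graph\<close> cuts it out.\<close>

definition endo :: "'a::chilbert_space set \<Rightarrow> ('a \<Rightarrow> 'a) \<Rightarrow> bool"
  where "endo H f \<longleftrightarrow> (\<forall>x y. f (x + y) = f x + f y) \<and> (\<forall>c x. f (c *\<^sub>C x) = c *\<^sub>C f x) \<and>
    (\<forall>x. f x \<in> H) \<and> (\<exists>K. \<forall>x. norm (f x) \<le> K * norm x)"

definition graph :: "'a set \<Rightarrow> ('a \<Rightarrow> 'a) \<Rightarrow> ('a \<times> 'a) set"
  where "graph H f = {(x, f x) |x. x \<in> H}"

lemma graph_iff: "(x, y) \<in> graph H f \<longleftrightarrow> x \<in> H \<and> y = f x"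
  by (auto simp: graph_def)

lemma endo_add: "endo H f \<Longrightarrow> f (x + y) = f x + f y"
  and endo_scaleC: "endo H f \<Longrightarrow> f (c *\<^sub>C x) = c *\<^sub>C f x"
  and endo_in: "endo H f \<Longrightarrow> f x \<in> H"
  by (auto simp: endo_def)

lemma endo_bounded_linear: "endo H f \<Longrightarrow> bounded_linear f"
proof -
  assume f: "endo H f"
  then obtain K where "\<And>x. norm (f x) \<le> K * norm x" by (auto simp: endo_def)
  then show "bounded_linear f"
    using f by (intro bounded_linear_intro[of _ K]) (simp_all add: endo_def scaleR_scaleC
      mult.commute)
qed

lemma endo_plus: "csubspace H \<Longrightarrow> endo H f \<Longrightarrow> endo H g \<Longrightarrow> endo H (\<lambda>x. f x + g x)"
proof -
  assume H: "csubspace H" and fg: "endo H f" "endo H g"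
  then obtain K L where "\<And>x. norm (f x) \<le> K * norm x" "\<And>x. norm (g x) \<le> L * norm x"
    unfolding endo_def by blast
  then have "norm (f x + g x) \<le> (K + L) * norm x" for x
    using norm_triangle_ineq[of "f x" "g x"] by (smt (verit) distrib_right)
  then show ?thesis using fg H unfolding endo_def
    by (auto simp: scaleC_add_right csubspace_add)
qed

lemma endo_compose: "endo H f \<Longrightarrow> endo H g \<Longrightarrow> endo H (\<lambda>x. f (g x))"
proof -
  assume fg: "endo H f" "endo H g"
  then obtain K where "\<And>x. norm (f (g x)) \<le> norm x * K"
    using bounded_linear.bounded[OF bounded_linear_compose[OF endo_bounded_linear[OF fg(1)]
      endo_bounded_linear[OF fg(2)]]] by blast
  then show ?thesis using fg unfolding endo_def by (auto simp: mult.commute intro!: exI[of _ K])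
qed

lemma endo_scale: "csubspace H \<Longrightarrow> endo H f \<Longrightarrow> endo H (\<lambda>x. c *\<^sub>C f x)"
proof -
  assume H: "csubspace H" and f: "endo H f"
  obtain K where "\<And>x. norm (c *\<^sub>C f x) \<le> norm x * K"
    using bounded_linear.bounded[OF bounded_linear_compose[OF bounded_linear_scaleC
      endo_bounded_linear[OF f]]] by blast
  then show ?thesis using f H unfolding endo_def
    by (auto simp: scaleC_add_right scaleC_scaleC mult.commute csubspace_scale intro!: exI[of _ K])
qed

lemma endo_zero: "endo H f \<Longrightarrow> f 0 = 0"
  using endo_scaleC[of H f 0 0] by simp

lemma endo_minus: "endo H f \<Longrightarrow> f (- x) = - f x"
  using endo_scaleC[of H f "-1" x] by simp

lemma bounded_operator_on_graph:
  assumes H: "closed H" "csubspace H" and f: "endo H f"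
  shows "bounded_operator_on H (graph H f)"
proof -
  obtain K where K: "\<And>x. norm (f x) \<le> K * norm x" using f by (auto simp: endo_def)
  have "graph H f = (\<lambda>x. (x, f x)) ` H" by (auto simp: graph_def)
  then have "csubspace (graph H f)"
    by (simp, intro csubspace_image H) (simp_all add: endo_add[OF f] endo_scaleC[OF f]
      scaleC_prod_def)
  moreover have "graph H f \<subseteq> H \<times> H" "Domain (graph H f) = H" "single_valued (graph H f)"
    using endo_in[OF f] by (auto simp: graph_def single_valued_def)
  ultimately show ?thesis
    unfolding bounded_operator_on_def linear_operator_on_def using K
      by (auto simp: graph_iff intro!: exI[of _ K])
qed

lemma endo_proj: assumes "closed H" "csubspace H" shows "endo H (proj H)"
  unfolding endo_def
proof (intro conjI allI exI)
  show "proj H (x + y) = proj H x + proj H y" "proj H (c *\<^sub>C x) = c *\<^sub>C proj H x" for x y c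
    by (rule cinner_eq_iff; simp add: proj_sym[OF assms] cinner_add_left cinner_scaleC_left)+
  show "proj H x \<in> H" "norm (proj H x) \<le> 1 * norm x" for x
    using proj_in[OF assms(1) csubspace_imp_subspace[OF assms(2)]] norm_proj_le[OF assms] by auto
qed

text \<open>Precomposing with the projection onto H makes the operator total on the ambient space
  without leaving the bounded linear maps.\<close>

lemma bounded_operator_on_imp_graph:
  assumes H: "closed H" "csubspace H" and T: "bounded_operator_on H T"
  obtains f where "endo H f" "T = graph H f"
proof -
  have sub: "T \<subseteq> H \<times> H" and cs: "csubspace T" and sv: "single_valued T" and dom: "Domain T = H"
    using T by (auto simp: bounded_operator_on_def linear_operator_on_def)
  obtain K where K: "\<And>x y. (x, y) \<in> T \<Longrightarrow> norm y \<le> K * norm x" using T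
    unfolding bounded_operator_on_def by blast
  note rH = csubspace_imp_subspace[OF H(2)]
  have "\<exists>y. (proj H x, y) \<in> T" for x using proj_in[OF H(1) rH, of x] dom by blast
  then obtain f where f: "\<And>x. (proj H x, f x) \<in> T" by metis
  have eq: "f x = y" if "(proj H x, y) \<in> T" for x y using f that sv single_valuedD by metis
  note proj = endo_add[OF endo_proj[OF H]] endo_scaleC[OF endo_proj[OF H]]
  have "endo H f"
    unfolding endo_def
  proof (intro conjI allI exI)
    show "f (x + y) = f x + f y" for x y
      using csubspace_add[OF cs f[of x] f[of y]] by (intro eq) (simp add: proj)
    show "f (c *\<^sub>C x) = c *\<^sub>C f x" for c x
      using csubspace_scale[OF cs f[of x], of c] by (intro eq) (simp add: proj scaleC_prod_def)
    show "f x \<in> H" for x using f sub by blast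
    fix x
    have "norm (f x) \<le> K * norm (proj H x)" by (rule K[OF f])
    also have "\<dots> \<le> \<bar>K\<bar> * norm x" by (intro mult_mono norm_proj_le H) auto
    finally show "norm (f x) \<le> \<bar>K\<bar> * norm x" .
  qed
  moreover have "T = graph H f"
  proof (intro equalityI subsetI)
    fix p assume "p \<in> T"
    then obtain x y where p: "p = (x, y)" "(x, y) \<in> T" "x \<in> H" using sub by (cases p) auto
    then have "f x = y" using proj_id[OF H(1) rH, of x] by (intro eq) simp
    then show "p \<in> graph H f" using p by (simp add: graph_iff)
  next
    fix p assume "p \<in> graph H f"
    then obtain x where p: "p = (x, f x)" "x \<in> H" by (auto simp: graph_def)
    then show "p \<in> T" using f[of x] proj_id[OF H(1) rH, of x] by simp
  qed
  ultimately show thesis by (rule that)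
qed

lemma bounded_operator_on_closure:
  assumes H: "closed H" and G: "csubspace G" "G \<subseteq> H \<times> H" "H \<subseteq> closure (Domain G)"
    and K: "\<And>x y. (x, y) \<in> G \<Longrightarrow> norm y \<le> K * norm x"
  shows "bounded_operator_on H (closure G)"
proof -
  have cs: "csubspace (closure G)" by (rule closure_csubspace[OF G(1)])
  have "closed {p :: 'a \<times> 'a. norm (snd p) \<le> K * norm (fst p)}"
    by (intro closed_Collect_le continuous_intros)
  then have "closure G \<subseteq> {p. norm (snd p) \<le> K * norm (fst p)}" using K
    by (intro closure_minimal) auto
  then have bound: "norm y \<le> K * norm x" if "(x, y) \<in> closure G" for x y using that by auto
  then have sv: "single_valued (closure G)"
    by (intro single_valuedI_csubspace[OF cs]) force
  have sub: "closure G \<subseteq> H \<times> H" using G(2) H by (intro closure_minimal closed_Times) auto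
  have "\<exists>y. (x, y) \<in> closure G" if "x \<in> H" for x
    by (rule Domain_closure_bounded[OF csubspace_imp_subspace[OF G(1)] K]) (use that G(3) in auto)
  then have "Domain (closure G) = H" using sub by blast
  then show ?thesis
    unfolding bounded_operator_on_def linear_operator_on_def using sub cs sv bound by blast
qed

definition adjoint_pair :: "'a::chilbert_space set \<Rightarrow> ('a \<Rightarrow> 'a) \<Rightarrow> ('a \<Rightarrow> 'a) \<Rightarrow> bool"
  where "adjoint_pair H f g \<longleftrightarrow> (\<forall>x\<in>H. \<forall>y\<in>H. cinner (f x) y = cinner x (g y))"

lemma adjoint_pairD: "adjoint_pair H f g \<Longrightarrow> x \<in> H \<Longrightarrow> y \<in> H \<Longrightarrow> cinner (f x) y = cinner x (g y)"
  by (simp add: adjoint_pair_def)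

lemma adjoint_pair_sym: assumes "adjoint_pair H f g" shows "adjoint_pair H g f"
  unfolding adjoint_pair_def
proof (intro ballI)
  fix x y assume "x \<in> H" "y \<in> H"
  then have "cinner (f y) x = cinner y (g x)" using adjoint_pairD[OF assms] by blast
  then show "cinner (g x) y = cinner x (f y)"
    using cinner_commute[of "g x" y] cinner_commute[of x "f y"] by simp
qed

lemma adjoint_pair_exists:
  assumes H: "closed H" "csubspace H" and f: "endo H f"
  obtains g where "endo H g" "adjoint_pair H f g"
proof -
  note rH = csubspace_imp_subspace[OF H(2)]
  obtain K where K: "\<And>x. norm (f x) \<le> K * norm x" using f by (auto simp: endo_def)
  have "\<exists>z\<in>H. \<forall>x\<in>H. cinner y (f x) = cinner z x" for y
  proof (rule riesz_exists[OF H])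
    fix x
    have "cmod (cinner y (f x)) \<le> norm y * norm (f x)" by (rule norm_cinner_le)
    also have "\<dots> \<le> norm y * (K * norm x)" by (intro mult_left_mono K) simp
    finally show "cmod (cinner y (f x)) \<le> norm y * K * norm x" by simp
  qed (simp_all add: endo_add[OF f] endo_scaleC[OF f] cinner_add_right cinner_scaleC_right)
  then obtain g where g: "\<And>y. g y \<in> H" "\<And>y x. x \<in> H \<Longrightarrow> cinner y (f x) = cinner (g y) x" by metis
  have eq: "g y = z" if "z \<in> H" "\<And>x. x \<in> H \<Longrightarrow> cinner y (f x) = cinner z x" for y z
  proof (rule cinner_eqI_on[OF H(2) g(1) that(1)])
    fix x assume "x \<in> H"
    then show "cinner x (g y) = cinner x z"
      using g(2)[of x y] that(2)[of x] cinner_commute[of x "g y"] cinner_commute[of x z] by simp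
  qed
  have "endo H g"
    unfolding endo_def
  proof (intro conjI allI exI g(1))
    show "g (x + y) = g x + g y" for x y
      by (intro eq csubspace_add[OF H(2)] g(1)) (simp add: cinner_add_left g(2))
    show "g (c *\<^sub>C x) = c *\<^sub>C g x" for c x
      by (intro eq csubspace_scale[OF H(2)] g(1)) (simp add: cinner_scaleC_left g(2))
    fix y
    have "(norm (g y))\<^sup>2 = cmod (cinner (g y) (g y))" by (simp add: cinner_self norm_power)
    also have "\<dots> = cmod (cinner y (f (g y)))" by (simp add: g)
    also have "\<dots> \<le> norm y * norm (f (g y))" by (rule norm_cinner_le)
    also have "\<dots> \<le> norm y * (\<bar>K\<bar> * norm (g y))"
    proof (rule mult_left_mono)
      show "norm (f (g y)) \<le> \<bar>K\<bar> * norm (g y)"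
        by (rule order_trans[OF K]) (simp add: mult_right_mono)
    qed simp
    finally have "norm (g y) * norm (g y) \<le> \<bar>K\<bar> * norm y * norm (g y)"
      by (simp add: power2_eq_square mult_ac)
    then show "norm (g y) \<le> \<bar>K\<bar> * norm y"
      by (cases "norm (g y) = 0") (simp_all add: mult_le_cancel_right)
  qed
  moreover have "adjoint_pair H f g"
    by (rule adjoint_pair_sym) (simp add: adjoint_pair_def g(2)[symmetric])
  ultimately show thesis by (rule that)
qed

lemma adjoint_on_graph:
  assumes H: "closed H" "csubspace H" and fg: "endo H g" "adjoint_pair H f g"
  shows "adjoint_on H (graph H f) = graph H g"
proof (intro equalityI subsetI)
  fix p assume "p \<in> adjoint_on H (graph H f)"
  then obtain x z where p: "p = (x, z)" "x \<in> H" "z \<in> H" "\<And>y. y \<in> H \<Longrightarrow> cinner z y = cinner x (f y)"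
    by (cases p) (auto simp: adjoint_on_iff graph_iff)
  have "z = g x"
  proof (rule cinner_eqI_on[OF H(2) p(3) endo_in[OF fg(1)]])
    fix y assume y: "y \<in> H"
    have "cinner y z = cnj (cinner x (f y))" using p(4)[OF y] cinner_commute[of y z] by simp
    also have "\<dots> = cinner (f y) x" by (rule cinner_commute[symmetric])
    also have "\<dots> = cinner y (g x)" by (rule adjoint_pairD[OF fg(2) y p(2)])
    finally show "cinner y z = cinner y (g x)" .
  qed
  then show "p \<in> graph H g" using p by (simp add: graph_iff)
next
  fix p assume "p \<in> graph H g"
  then obtain x where p: "p = (x, g x)" "x \<in> H" by (auto simp: graph_def)
  then show "p \<in> adjoint_on H (graph H f)"
    using endo_in[OF fg(1)] adjoint_pairD[OF adjoint_pair_sym[OF fg(2)]]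
      by (simp add: adjoint_on_iff graph_iff)
qed

section \<open>Commutants\<close>

definition commutant :: "'a::chilbert_space set \<Rightarrow> ('a \<Rightarrow> 'a) set \<Rightarrow> ('a \<Rightarrow> 'a) set"
  where "commutant H X = {g. endo H g \<and> (\<forall>f\<in>X. \<forall>x\<in>H. f (g x) = g (f x))}"

lemma commutant_on_graph:
  assumes H: "closed H" "csubspace H" and X: "\<And>f. f \<in> X \<Longrightarrow> endo H f"
  shows "commutant_on H (graph H ` X) = graph H ` commutant H X"
proof -
  have eq: "graph H f O graph H g = graph H g O graph H f \<longleftrightarrow> (\<forall>x\<in>H. f (g x) = g (f x))"
    if "endo H f" "endo H g" for f g
  proof -
    have "(x, z) \<in> graph H f O graph H g \<longleftrightarrow> (x, z) \<in> graph H (\<lambda>x. g (f x))"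
      "(x, z) \<in> graph H g O graph H f \<longleftrightarrow> (x, z) \<in> graph H (\<lambda>x. f (g x))" for x z
      using endo_in[OF that(1)] endo_in[OF that(2)] by (auto simp: relcomp.simps graph_iff)
    then have "graph H f O graph H g = graph H (\<lambda>x. g (f x))"
      "graph H g O graph H f = graph H (\<lambda>x. f (g x))"
      unfolding set_eq_iff split_paired_All by blast+
    moreover have "graph H f' = graph H g' \<longleftrightarrow> (\<forall>x\<in>H. f' x = g' x)" for f' g'
      unfolding graph_def by auto
    ultimately show ?thesis by auto
  qed
  show ?thesis
  proof (intro equalityI subsetI)
    fix T assume T: "T \<in> commutant_on H (graph H ` X)"
    then obtain g where g: "endo H g" "T = graph H g"
      using bounded_operator_on_imp_graph[OF H] unfolding commutant_on_def by blast
    have "g \<in> commutant H X" using T g eq[OF X g(1)] by (auto simp: commutant_def commutant_on_def)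
    then show "T \<in> graph H ` commutant H X" using g by blast
  next
    fix T assume "T \<in> graph H ` commutant H X"
    then obtain g where g: "T = graph H g" "g \<in> commutant H X" by blast
    then have "endo H g" by (simp add: commutant_def)
    then show "T \<in> commutant_on H (graph H ` X)"
      using g eq[OF X] bounded_operator_on_graph[OF H]
        by (auto simp: commutant_def commutant_on_def)
  qed
qed

lemma commutant_endo: "g \<in> commutant H X \<Longrightarrow> endo H g"
  by (simp add: commutant_def)

lemma commutant_adjoint:
  assumes H: "csubspace H" and X: "\<And>f. f \<in> X \<Longrightarrow> \<exists>f'\<in>X. endo H f' \<and> endo H f \<and> adjoint_pair H f f'"
    and g: "g \<in> commutant H X" "endo H g'" "adjoint_pair H g g'"
  shows "g' \<in> commutant H X"
  unfolding commutant_def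
proof (intro CollectI conjI g(2) ballI)
  fix f x assume f: "f \<in> X" and x: "x \<in> H"
  obtain f' where f': "f' \<in> X" "endo H f'" "endo H f" "adjoint_pair H f f'" using X[OF f] by blast
  note in_H = endo_in[OF f'(2)] endo_in[OF f'(3)] endo_in[OF g(2)] endo_in[OF commutant_endo[OF
    g(1)]]
  show "f (g' x) = g' (f x)"
  proof (rule cinner_eqI_on[OF H in_H(2,3)])
    fix y assume y: "y \<in> H"
    have "cinner y (f (g' x)) = cinner (g (f' y)) x"
      using adjoint_pairD[OF adjoint_pair_sym[OF f'(4)] y in_H(3)] adjoint_pairD[OF g(3) in_H(1)
        x] by simp
    also have "g (f' y) = f' (g y)" using g(1) f'(1) y by (simp add: commutant_def)
    also have "cinner (f' (g y)) x = cinner y (g' (f x))"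
      using adjoint_pairD[OF adjoint_pair_sym[OF f'(4)] in_H(4) x] adjoint_pairD[OF g(3) y
        in_H(2)] by simp
    finally show "cinner y (f (g' x)) = cinner y (g' (f x))" .
  qed
qed

lemma commutant_plus:
  "csubspace H \<Longrightarrow> (\<And>f. f \<in> X \<Longrightarrow> endo H f) \<Longrightarrow> g \<in> commutant H X \<Longrightarrow> h \<in> commutant H X \<Longrightarrow> (\<lambda>x. g x + h x)
    \<in> commutant H X"
  unfolding commutant_def by (auto simp: endo_plus) (metis endo_add)

lemma commutant_scale:
  "csubspace H \<Longrightarrow> (\<And>f. f \<in> X \<Longrightarrow> endo H f) \<Longrightarrow> g \<in> commutant H X \<Longrightarrow> (\<lambda>x. c *\<^sub>C g x) \<in> commutant H X"
  unfolding commutant_def by (auto simp: endo_scale) (metis endo_scaleC)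

lemma commutant_compose: "g \<in> commutant H X \<Longrightarrow> h \<in> commutant H X \<Longrightarrow> (\<lambda>x. g (h x)) \<in> commutant H X"
  unfolding commutant_def by (auto simp: endo_compose endo_in)

lemma commutant_orbit_csubspace:
  assumes H: "csubspace H" and X: "\<And>f. f \<in> X \<Longrightarrow> endo H f"
  shows "csubspace ((\<lambda>g. g \<Omega>) ` commutant H X)"
  unfolding complex_vector.subspace_def
proof (intro conjI ballI allI)
  have "endo H (\<lambda>x. 0)" using csubspace_0[OF H] by (auto simp: endo_def intro!: exI[of _ 0])
  moreover have "f 0 = 0" if "f \<in> X" for f using endo_scaleC[OF X[OF that], of 0 0] by simp
  ultimately have "(\<lambda>x. 0) \<in> commutant H X" by (simp add: commutant_def)
  then show "0 \<in> (\<lambda>g. g \<Omega>) ` commutant H X" by (rule image_eqI[rotated]) simp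
next
  fix x y assume "x \<in> (\<lambda>g. g \<Omega>) ` commutant H X" "y \<in> (\<lambda>g. g \<Omega>) ` commutant H X"
  then show "x + y \<in> (\<lambda>g. g \<Omega>) ` commutant H X" using commutant_plus[OF H X]
    by (auto intro!: image_eqI[of _ "\<lambda>g. g \<Omega>"])
next
  fix c x assume "x \<in> (\<lambda>g. g \<Omega>) ` commutant H X"
  then show "c *\<^sub>C x \<in> (\<lambda>g. g \<Omega>) ` commutant H X" using commutant_scale[OF H X]
    by (auto intro!: image_eqI[of _ "\<lambda>g. g \<Omega>"])
qed

section \<open>The Tomita operator of a cyclic and separating vector\<close>

text \<open>Separation is expressed in the form in which it is used: \<Omega> is cyclic for the
  commutant.\<close>

locale cyclic_separating =
  fixes H :: "'a::chilbert_space set" and X \<Omega>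
  assumes closed_H: "closed H" and csubspace_H: "csubspace H" and \<Omega>: "\<Omega> \<in> H"
    and X_adj: "\<And>f. f \<in> X \<Longrightarrow> \<exists>f'\<in>X. endo H f' \<and> endo H f \<and> adjoint_pair H f f'"
    and cyclic: "H \<subseteq> closure ((\<lambda>g. g \<Omega>) ` commutant H (commutant H X))"
    and separating: "H \<subseteq> closure ((\<lambda>g. g \<Omega>) ` commutant H X)"
begin

definition N where "N = commutant H X"
definition M where "M = commutant H N"

lemma N_endo: "g \<in> N \<Longrightarrow> endo H g" and M_endo: "g \<in> M \<Longrightarrow> endo H g"
  by (auto simp: N_def M_def commutant_endo)

lemma N_adjoint: assumes "g \<in> N" shows "\<exists>g'\<in>N. adjoint_pair H g g'"
proof -
  obtain g' where "endo H g'" "adjoint_pair H g g'"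
    using adjoint_pair_exists[OF closed_H csubspace_H N_endo[OF assms]] by blast
  then show ?thesis using commutant_adjoint[OF csubspace_H X_adj, of g g'] assms unfolding N_def
    by blast
qed

lemma M_adjoint: assumes "g \<in> M" shows "\<exists>g'\<in>M. adjoint_pair H g g'"
proof -
  obtain g' where g': "endo H g'" "adjoint_pair H g g'"
    using adjoint_pair_exists[OF closed_H csubspace_H M_endo[OF assms]] by blast
  have "\<exists>f'\<in>N. endo H f' \<and> endo H f \<and> adjoint_pair H f f'" if "f \<in> N" for f
    using N_adjoint[OF that] N_endo that by blast
  then show ?thesis using commutant_adjoint[OF csubspace_H, of N g g'] assms g' unfolding M_def
    by blast
qed

lemma M_N: "f \<in> M \<Longrightarrow> g \<in> N \<Longrightarrow> x \<in> H \<Longrightarrow> f (g x) = g (f x)"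
  by (simp add: M_def commutant_def)

definition S0 where "S0 = {(f \<Omega>, g \<Omega>) |f g. f \<in> M \<and> g \<in> M \<and> adjoint_pair H f g}"

lemma tomita_eq: "tomita_operator H (graph H ` M) \<Omega> = closure S0"
proof -
  have "{(x, y). \<exists>T\<in>graph H ` M. (\<Omega>, x) \<in> T \<and> (\<Omega>, y) \<in> adjoint_on H T} = S0" (is "?L = _")
  proof (intro equalityI subsetI)
    fix p assume "p \<in> ?L"
    then obtain f where f: "f \<in> M" "fst p = f \<Omega>" "(\<Omega>, snd p) \<in> adjoint_on H (graph H f)"
      by (auto simp: graph_iff)
    obtain g where g: "g \<in> M" "adjoint_pair H f g" using M_adjoint[OF f(1)] by blast
    have "snd p = g \<Omega>" using f(3) adjoint_on_graph[OF closed_H csubspace_H M_endo[OF g(1)] g(2)]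
      by (simp add: graph_iff)
    then show "p \<in> S0" unfolding S0_def using f g by (cases p) auto
  next
    fix p assume "p \<in> S0"
    then obtain f g where fg: "p = (f \<Omega>, g \<Omega>)" "f \<in> M" "g \<in> M" "adjoint_pair H f g"
      unfolding S0_def by blast
    then show "p \<in> ?L" using adjoint_on_graph[OF closed_H csubspace_H M_endo[OF fg(3)] fg(4)] \<Omega>
      by (auto simp: graph_iff)
  qed
  then show ?thesis unfolding tomita_operator_def by simp
qed

text \<open>Commuting g past f moves both operators to the vacuum: <g' \<Omega>, f \<Omega>> =
  <\<Omega>, f g \<Omega>> = <f' \<Omega>, g \<Omega>>. The identity puts (g \<Omega>, g' \<Omega>)
  in the adjoint of the Tomita operator and also yields its closability.\<close>

lemma commutant_adjoint_S0:
  assumes "g \<in> N" "g' \<in> N" "adjoint_pair H g g'" "(x, y) \<in> closure S0"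
  shows "cinner (g' \<Omega>) x = cinner y (g \<Omega>)"
proof -
  have "closed {p. cinner (g' \<Omega>) (fst p) = cinner (snd p) (g \<Omega>)}"
    by (intro closed_Collect_eq cinner.continuous_on continuous_intros)
  moreover have "S0 \<subseteq> {p. cinner (g' \<Omega>) (fst p) = cinner (snd p) (g \<Omega>)}"
  proof
    fix p assume "p \<in> S0"
    then obtain f f' where f: "p = (f \<Omega>, f' \<Omega>)" "f \<in> M" "f' \<in> M" "adjoint_pair H f f'"
      unfolding S0_def by blast
    have "cinner (g' \<Omega>) (f \<Omega>) = cinner \<Omega> (g (f \<Omega>))"
      by (rule adjoint_pairD[OF adjoint_pair_sym[OF assms(3)] \<Omega> endo_in[OF M_endo[OF f(2)]]])
    also have "\<dots> = cinner \<Omega> (f (g \<Omega>))" using M_N[OF f(2) assms(1) \<Omega>] by simp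
    also have "\<dots> = cinner (f' \<Omega>) (g \<Omega>)"
      by (rule adjoint_pairD[OF adjoint_pair_sym[OF f(4)] \<Omega> endo_in[OF N_endo[OF assms(1)]],
        symmetric])
    finally show "p \<in> {p. cinner (g' \<Omega>) (fst p) = cinner (snd p) (g \<Omega>)}" using f by simp
  qed
  ultimately have "closure S0 \<subseteq> {p. cinner (g' \<Omega>) (fst p) = cinner (snd p) (g \<Omega>)}"
    by (rule closure_minimal[rotated])
  then show ?thesis using assms(4) by auto
qed

lemma S0I: "f \<in> M \<Longrightarrow> g \<in> M \<Longrightarrow> adjoint_pair H f g \<Longrightarrow> (f \<Omega>, g \<Omega>) \<in> S0"
  unfolding S0_def by blast

lemma S0_antilinear: "antilinear_operator_on H (closure S0)"
proof (rule antilinear_closure[OF closed_H])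
  have sv: "y = 0" if "(0, y) \<in> closure S0" "y \<in> H" for y
  proof -
    \<comment> \<open>A limit pair (0, y) makes y orthogonal to the orbit of \<Omega> under the
      commutant, which is dense by separation.\<close>
    have "cinner y x = 0" if x: "x \<in> (\<lambda>g. g \<Omega>) ` commutant H X" for x
    proof -
      obtain g where g: "g \<in> N" "x = g \<Omega>" using x unfolding N_def by blast
      obtain g' where "g' \<in> N" "adjoint_pair H g g'" using N_adjoint[OF g(1)] by blast
      from commutant_adjoint_S0[OF g(1) this \<open>(0, y) \<in> closure S0\<close>] show ?thesis using g by simp
    qed
    then have "cinner y y = 0"
      using orth_closure[of "(\<lambda>g. g \<Omega>) ` commutant H X" y y] separating that by blast
    then show ?thesis by (simp add: cinner_self)
  qed
  have sub: "S0 \<subseteq> H \<times> H" unfolding S0_def using endo_in M_endo by blast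
  then have subc: "closure S0 \<subseteq> H \<times> H" using closed_H by (intro closure_minimal closed_Times)
  show "y = 0" if "(0, y) \<in> closure S0" for y using sv that subc by blast
  have add: "(x + x', y + y') \<in> S0" if xy: "(x, y) \<in> S0" "(x', y') \<in> S0" for x y x' y'
  proof -
    obtain f g where f: "x = f \<Omega>" "y = g \<Omega>" "f \<in> M" "g \<in> M" "adjoint_pair H f g" using xy
      unfolding S0_def by blast
    obtain f' g' where f': "x' = f' \<Omega>" "y' = g' \<Omega>" "f' \<in> M" "g' \<in> M" "adjoint_pair H f' g'"
      using xy unfolding S0_def by blast
    have "adjoint_pair H (\<lambda>x. f x + f' x) (\<lambda>x. g x + g' x)"
      using f(5) f'(5) by (simp add: adjoint_pair_def cinner_add_left cinner_add_right)
    moreover have "(\<lambda>x. f x + f' x) \<in> M" "(\<lambda>x. g x + g' x) \<in> M"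
      using commutant_plus[OF csubspace_H N_endo] f f' unfolding M_def by auto
    ultimately show ?thesis using S0I unfolding f f' by fast
  qed
  have scale: "(c *\<^sub>C x, cnj c *\<^sub>C y) \<in> S0" if xy: "(x, y) \<in> S0" for c x y
  proof -
    obtain f g where f: "x = f \<Omega>" "y = g \<Omega>" "f \<in> M" "g \<in> M" "adjoint_pair H f g" using xy
      unfolding S0_def by blast
    have "adjoint_pair H (\<lambda>x. c *\<^sub>C f x) (\<lambda>x. cnj c *\<^sub>C g x)"
      using f(5) by (simp add: adjoint_pair_def cinner_scaleC_left cinner_scaleC_right)
    moreover have "(\<lambda>x. c *\<^sub>C f x) \<in> M" "(\<lambda>x. cnj c *\<^sub>C g x) \<in> M"
      using commutant_scale[OF csubspace_H N_endo] f unfolding M_def by auto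
    ultimately show ?thesis using S0I unfolding f by fast
  qed
  have zero: "(0, 0) \<in> S0"
  proof -
    obtain h where "h \<in> M" using cyclic \<Omega> unfolding M_def N_def by fastforce
    then obtain h' where "h' \<in> M" "adjoint_pair H h h'" using M_adjoint by blast
    then have "(h \<Omega>, h' \<Omega>) \<in> S0" using \<open>h \<in> M\<close> unfolding S0_def by blast
    from scale[OF this, of 0] show ?thesis by simp
  qed
  have svs: "single_valued S0"
  proof (rule single_valuedI)
    fix x y z assume xy: "(x, y) \<in> S0" "(x, z) \<in> S0"
    have "(0, y - z) \<in> S0" using add[OF xy(1) scale[OF xy(2), of "-1"]] by simp
    then have "(0, y - z) \<in> closure S0" by (rule subsetD[OF closure_subset])
    moreover from this have "y - z \<in> H" using subc by blast
    ultimately show "y = z" using sv by fastforce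
  qed
  show "antilinear_operator_on H S0"
    unfolding antilinear_operator_on_def using sub svs zero add scale by blast
qed

lemma antilinear_involution_tomita: "antilinear_involution H (closure S0)"
proof
  show "closed H" "csubspace H" "closed (closure S0)" by (simp_all add: closed_H csubspace_H)
  show "antilinear_operator_on H (closure S0)" by (rule S0_antilinear)
  have "(\<lambda>g. g \<Omega>) ` commutant H (commutant H X) \<subseteq> Domain S0"
  proof
    fix x assume "x \<in> (\<lambda>g. g \<Omega>) ` commutant H (commutant H X)"
    then obtain f where f: "f \<in> M" "x = f \<Omega>" unfolding M_def N_def by blast
    then show "x \<in> Domain S0" using M_adjoint[OF f(1)] unfolding S0_def by blast
  qed
  also have "Domain S0 \<subseteq> Domain (closure S0)" using closure_subset by (rule Domain_mono)
  finally show "densely_defined_on H (closure S0)"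
    unfolding densely_defined_on_def using cyclic closure_mono by blast
  have "S0\<inverse> \<subseteq> S0" unfolding S0_def using adjoint_pair_sym by blast
  then have "closure (S0\<inverse>) \<subseteq> closure S0" by (rule closure_mono)
  then show "(y, x) \<in> closure S0" if "(x, y) \<in> closure S0" for x y
    using that unfolding closure_converse by blast
qed

lemma adjoint_tomita:
  assumes "g \<in> N" "g' \<in> N" "adjoint_pair H g g'"
  shows "(g \<Omega>, g' \<Omega>) \<in> antilinear_adjoint_on H (closure S0)"
  unfolding antilinear_adjoint_on_iff
  using commutant_adjoint_S0[OF assms] endo_in[OF N_endo[OF assms(1)]] endo_in[OF N_endo[OF
    assms(2)]] by blast

lemma in_M: "f \<in> X \<Longrightarrow> f \<in> M"
  using X_adj[of f] unfolding M_def N_def commutant_def by auto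

lemma in_S0: "f \<in> M \<Longrightarrow> g \<in> M \<Longrightarrow> adjoint_pair H f g \<Longrightarrow> (f \<Omega>, g \<Omega>) \<in> closure S0"
  unfolding S0_def by (rule subsetD[OF closure_subset]) blast

end

section \<open>Wedge products\<close>

definition omit :: "nat \<Rightarrow> 'a list \<Rightarrow> 'a list"
  where "omit r xs = take r xs @ drop (Suc r) xs"

lemma omit_0: "omit 0 (x # xs) = xs" and omit_Suc: "omit (Suc r) (x # xs) = x # omit r xs"
  by (simp_all add: omit_def)

lemma length_omit: "r < length xs \<Longrightarrow> length (omit r xs) = length xs - 1"
  by (simp add: omit_def)

lemma set_omit: "set (omit r xs) \<subseteq> set xs"
  unfolding omit_def using set_take_subset[of r xs] set_drop_subset[of "Suc r" xs] by auto

lemma nth_omit: "r < length xs \<Longrightarrow> k < length xs - 1 \<Longrightarrow> omit r xs ! k = xs ! (if k < r then k else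
  Suc k)"
  by (auto simp: omit_def nth_append min_def)

text \<open>The interior product, written as a function of the list: before boundedness is known,
  annihilation is not yet a function of the vector \<open>wedge qs\<close>.\<close>

definition contract :: "'a::chilbert_space \<Rightarrow> 'a list \<Rightarrow> 'a list ell2"
  where "contract v qs = (\<Sum>r<length qs. ((-1) ^ r * cinner v (qs ! r)) *\<^sub>C wedge (omit r qs))"

lemma cinner_wedge_det:
  assumes "length xs = n" "length ys = n"
  shows "cinner (wedge xs) (wedge ys) = Determinant.det (Matrix.mat n n (\<lambda>(i, j). cinner (xs ! i)
    (ys ! j)))"
proof -
  have "(\<Prod>i<n. cinner (xs ! i) (ys ! \<sigma> i)) = (\<Prod>i = 0..<n. Matrix.mat n n (\<lambda>(i, j). cinner (xs ! i)
    (ys ! j)) $$ (i, \<sigma> i))"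
    if "\<sigma> permutes {0..<n}" for \<sigma>
    unfolding lessThan_atLeast0
  proof (rule prod.cong[OF refl])
    fix i assume "i \<in> {0..<n}"
    moreover from this have "\<sigma> i \<in> {0..<n}" using permutes_in_image[OF that] by blast
    ultimately show "cinner (xs ! i) (ys ! \<sigma> i) = Matrix.mat n n (\<lambda>(i, j). cinner (xs ! i) (ys !
      j)) $$ (i, \<sigma> i)" by simp
  qed
  then show ?thesis
    unfolding Determinant.det_def cinner_wedge using assms
      by (auto simp: lessThan_atLeast0 intro!: sum.cong)
qed

text \<open>Laplace expansion of the Gram determinant along its first row; it is the formal
  adjointness of creation and annihilation.\<close>

lemma cinner_wedge_Cons: "cinner (wedge (v # ps)) (wedge qs) = cinner (wedge ps) (contract v qs)"
proof (cases "length qs = Suc (length ps)")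
  case True
  define n where "n = length ps"
  have len: "length (v # ps) = Suc n" "length qs = Suc n" using True by (auto simp: n_def)
  define A where "A = Matrix.mat (Suc n) (Suc n) (\<lambda>(i, j). cinner ((v # ps) ! i) (qs ! j))"
  have A: "A \<in> carrier_mat (Suc n) (Suc n)" by (simp add: A_def)
  have del: "Determinant.det (mat_delete A 0 j) = cinner (wedge ps) (wedge (omit j qs))"
    if j: "j < Suc n" for j
  proof -
    have "mat_delete A 0 j = Matrix.mat n n (\<lambda>(i, k). cinner (ps ! i) (omit j qs ! k))"
      using j by (intro eq_matI) (auto simp: A_def mat_delete_def nth_omit len)
    then show ?thesis using j len by (subst cinner_wedge_det[of _ n]) (auto simp: length_omit n_def)
  qed
  have A0: "A $$ (0, j) = cinner v (qs ! j)" if "j < Suc n" for j using that by (simp add: A_def)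
  have "cinner (wedge (v # ps)) (wedge qs) = Determinant.det A"
    unfolding A_def by (rule cinner_wedge_det[OF len])
  also have "\<dots> = (\<Sum>j<Suc n. A $$ (0, j) * cofactor A 0 j)"
    by (rule laplace_expansion_row[OF A]) simp
  also have "\<dots> = (\<Sum>j<Suc n. ((-1) ^ j * cinner v (qs ! j)) * cinner (wedge ps) (wedge (omit j qs)))"
    by (rule sum.cong) (simp_all add: cofactor_def del A0)
  also have "\<dots> = cinner (wedge ps) (contract v qs)"
    unfolding contract_def len by (simp only: cinner_sum_right cinner_scaleC_right)
  finally show ?thesis .
next
  case False
  then have "cinner (wedge ps) (wedge (omit r qs)) = 0" if "r < length qs" for r
    using that by (auto simp: cinner_wedge length_omit)
  then show ?thesis using False
    by (simp add: contract_def cinner_sum_right cinner_scaleC_right cinner_wedge[of "v # ps"])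
qed

text \<open>The derivation rule of the interior product: positions in q # qs are shifted by one,
  which flips every sign of the remaining sum.\<close>

lemma contract_Cons: "contract v (q # qs) = cinner v q *\<^sub>C wedge qs -
    (\<Sum>r<length qs. ((-1) ^ r * cinner v (qs ! r)) *\<^sub>C wedge (q # omit r qs))"
  by (simp add: contract_def sum.lessThan_Suc_shift omit_0 omit_Suc sum_negf
    complex_vector.scale_minus_left del: sum.lessThan_Suc)

lemma contract_Nil: "contract v [] = 0"
  by (simp add: contract_def)

lemma contract_add: "contract (v + w) qs = contract v qs + contract w qs"
  by (simp add: contract_def cinner_add_left distrib_left scaleC_add_left sum.distrib)

lemma contract_scale: "contract (c *\<^sub>C v) qs = cnj c *\<^sub>C contract v qs"
  by (simp add: contract_def cinner_scaleC_left complex_vector.scale_sum_right scaleC_scaleC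
    mult_ac)

lemma csubspace_cinner_zero: "csubspace {y. cinner x y = 0}"
  by (auto simp: complex_vector.subspace_def cinner_add_right cinner_scaleC_right)

text \<open>Reduces an identity between wedge products to scalar products with wedge products, where
  determinants are available.\<close>

lemma wedge_span_zero:
  assumes "x \<in> cspan (range wedge)" "\<And>qs. cinner x (wedge qs) = 0"
  shows "x = 0"
proof -
  have "cspan (range wedge) \<subseteq> {y. cinner x y = 0}"
    using assms(2) by (intro complex_vector.span_minimal csubspace_cinner_zero) auto
  then have "cinner x x = 0" using assms(1) by blast
  then show ?thesis by (simp add: cinner_self)
qed

lemma wedge_add: "wedge ((v + w) # ps) = wedge (v # ps) + wedge (w # ps)"
proof -
  have "wedge ((v + w) # ps) - (wedge (v # ps) + wedge (w # ps)) = 0"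
    by (rule wedge_span_zero)
      (auto intro!: complex_vector.span_diff complex_vector.span_add intro: complex_vector.span_base
        simp: cinner.diff_left cinner_add_left cinner_wedge_Cons contract_add cinner_add_right)
  then show ?thesis by simp
qed

lemma wedge_scaleC: "wedge ((c *\<^sub>C v) # ps) = c *\<^sub>C wedge (v # ps)"
proof -
  have "wedge ((c *\<^sub>C v) # ps) - c *\<^sub>C wedge (v # ps) = 0"
    by (rule wedge_span_zero)
      (auto intro!: complex_vector.span_diff complex_vector.span_scale intro:
        complex_vector.span_base
        simp: cinner.diff_left cinner_scaleC_left cinner_wedge_Cons contract_scale
          cinner_scaleC_right)
  then show ?thesis by simp
qed

text \<open>Exchanging the two factors swaps the first two rows of the Gram matrix.\<close>

lemma wedge_swap: "wedge (v # w # ps) = - wedge (w # v # ps)"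
proof -
  have "wedge (v # w # ps) + wedge (w # v # ps) = 0"
  proof (rule wedge_span_zero)
    show "wedge (v # w # ps) + wedge (w # v # ps) \<in> cspan (range wedge)"
      by (intro complex_vector.span_add complex_vector.span_base) auto
    fix qs :: "'a list"
    show "cinner (wedge (v # w # ps) + wedge (w # v # ps)) (wedge qs) = 0"
    proof (cases "length qs = Suc (Suc (length ps))")
      case True
      define n where "n = Suc (Suc (length ps))"
      define A where "A = Matrix.mat n n (\<lambda>(i, j). cinner ((v # w # ps) ! i) (qs ! j))"
      have n: "length (v # w # ps) = n" "length (w # v # ps) = n" "length qs = n" using True
        by (auto simp: n_def)
      have swap: "swaprows 0 1 A = Matrix.mat n n (\<lambda>(i, j). cinner ((w # v # ps) ! i) (qs ! j))"
        by (rule eq_matI) (auto simp: A_def n_def nth_Cons split: nat.splits)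
      have "Determinant.det (swaprows 0 1 A) = - Determinant.det A"
        by (rule det_swaprows[of 0 n 1]) (auto simp: A_def n_def)
      then show ?thesis
        unfolding cinner_add_left cinner_wedge_det[OF n(1,3)] cinner_wedge_det[OF n(2,3)]
          swap[symmetric] A_def[symmetric]
        by simp
    qed (simp add: cinner_add_left cinner_wedge)
  qed
  then show ?thesis by (simp add: eq_neg_iff_add_eq_0)
qed

section \<open>The Fock space\<close>

definition wspan :: "'a::chilbert_space set \<Rightarrow> 'a list ell2 set"
  where "wspan \<pp> = cspan {wedge ps |ps. set ps \<subseteq> \<pp>}"

lemma wedge_in_wspan: "set ps \<subseteq> \<pp> \<Longrightarrow> wedge ps \<in> wspan \<pp>"
  unfolding wspan_def by (rule complex_vector.span_base) blast

lemma csubspace_wspan: "csubspace (wspan \<pp>)"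
  unfolding wspan_def by (rule complex_vector.subspace_span)

lemma fock_eq: "fock \<pp> = closure (wspan \<pp>)"
proof (rule antisym)
  have "exterior_power \<pp> n \<subseteq> closure (wspan \<pp>)" for n
    unfolding exterior_power_def wspan_def by (intro closure_mono complex_vector.span_mono) auto
  then have "cspan (\<Union>n. exterior_power \<pp> n) \<subseteq> closure (wspan \<pp>)"
    by (intro complex_vector.span_minimal closure_csubspace csubspace_wspan) blast
  then show "fock \<pp> \<subseteq> closure (wspan \<pp>)" unfolding fock_def by (intro closure_minimal) auto
  have "wedge ps \<in> exterior_power \<pp> (length ps)" if "set ps \<subseteq> \<pp>" for ps
    unfolding exterior_power_def using that
    by (intro subsetD[OF closure_subset] complex_vector.span_base) auto
  then have "{wedge ps |ps. set ps \<subseteq> \<pp>} \<subseteq> (\<Union>n. exterior_power \<pp> n)" by blast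
  then show "closure (wspan \<pp>) \<subseteq> fock \<pp>"
    unfolding fock_def wspan_def by (intro closure_mono complex_vector.span_mono)
qed

lemma closed_fock: "closed (fock \<pp>)" and csubspace_fock: "csubspace (fock \<pp>)"
  unfolding fock_eq by (simp_all add: closure_csubspace csubspace_wspan)

lemma wspan_fock: "wspan \<pp> \<subseteq> fock \<pp>"
  unfolding fock_eq by (rule closure_subset)

lemma wedge_in_fock: "set ps \<subseteq> \<pp> \<Longrightarrow> wedge ps \<in> fock \<pp>"
  using wspan_fock wedge_in_wspan by blast

lemma fock_minimal:
  assumes "closed V" "csubspace V" "\<And>ps. set ps \<subseteq> \<pp> \<Longrightarrow> wedge ps \<in> V"
  shows "fock \<pp> \<subseteq> V"
  unfolding fock_eq wspan_def using assms
    by (intro closure_minimal complex_vector.span_minimal) auto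

lemma contract_in_wspan: "set ps \<subseteq> \<pp> \<Longrightarrow> contract v ps \<in> wspan \<pp>"
  unfolding contract_def using set_omit
  by (intro csubspace_sum csubspace_scale csubspace_wspan wedge_in_wspan) fastforce

text \<open>Works with relations, as neither span is known to be single-valued when the lemma is
  applied: adjointness on generators extends first in one argument, then in the other.\<close>

lemma cspan_formal_adjoint:
  assumes "\<And>x y x' y'. (x, y) \<in> X \<Longrightarrow> (x', y') \<in> Y \<Longrightarrow> cinner y x' = cinner x y'"
    and "(x, y) \<in> cspan X" "(x', y') \<in> cspan Y"
  shows "cinner y x' = cinner x y'"
proof -
  have 1: "cspan X \<subseteq> {p. cinner (snd p) x' = cinner (fst p) y'}" if "(x', y') \<in> Y" for x' y'
    by (rule complex_vector.span_minimal)
      (use assms(1) that in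
        \<open>auto simp: complex_vector.subspace_def scaleC_prod_def cinner_add_left cinner_scaleC_left\<close>)
  have 2: "cinner y a = cinner x b" if "(a, b) \<in> Y" for a b using 1[OF that] assms(2) by auto
  have "cspan Y \<subseteq> {p. cinner y (fst p) = cinner x (snd p)}"
    by (rule complex_vector.span_minimal)
      (use 2 in
        \<open>auto simp: complex_vector.subspace_def scaleC_prod_def cinner_add_right cinner_scaleC_right\<close>)
  then show ?thesis using assms(3) by auto
qed

lemma wspan_Domain:
  "wspan \<pp> \<subseteq> Domain (cspan {(wedge ps, f ps) |ps. set ps \<subseteq> \<pp>})" for f :: "_ \<Rightarrow> 'b::chilbert_space"
proof -
  let ?G = "cspan {(wedge ps, f ps) |ps. set ps \<subseteq> \<pp>}"
  have "(wedge ps, f ps) \<in> ?G" if "set ps \<subseteq> \<pp>" for ps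
    by (rule complex_vector.span_base) (use that in blast)
  moreover have "csubspace (Domain ?G)"
    by (intro csubspace_Domain complex_vector.subspace_span)
  ultimately show ?thesis unfolding wspan_def by (intro complex_vector.span_minimal) auto
qed

text \<open>The norm bound on the whole span contains well-definedness: a linear relation among
  wedge products gives a pair (0, y), and then y = 0.\<close>

lemma bounded_operator_on_wedges:
  assumes f: "\<And>ps. set ps \<subseteq> \<pp> \<Longrightarrow> f ps \<in> fock \<pp>"
    and K: "\<And>x y. (x, y) \<in> cspan {(wedge ps, f ps) |ps. set ps \<subseteq> \<pp>} \<Longrightarrow> norm y \<le> K * norm x"
  shows "bounded_operator_on (fock \<pp>) (closure (cspan {(wedge ps, f ps) |ps. set ps \<subseteq> \<pp>}))"
proof (rule bounded_operator_on_closure[OF closed_fock complex_vector.subspace_span _ _ K])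
  show "cspan {(wedge ps, f ps) |ps. set ps \<subseteq> \<pp>} \<subseteq> fock \<pp> \<times> fock \<pp>"
    by (intro complex_vector.span_minimal csubspace_Times csubspace_fock) (auto simp: f
      wedge_in_fock)
  show "fock \<pp> \<subseteq> closure (Domain (cspan {(wedge ps, f ps) |ps. set ps \<subseteq> \<pp>}))"
    unfolding fock_eq by (intro closure_mono wspan_Domain)
qed

section \<open>Creation and annihilation on the algebraic Fock space\<close>

context
  fixes \<pp> :: "'a::chilbert_space set" and v :: 'a
  assumes v: "v \<in> \<pp>"
begin

definition "C0 = cspan {(wedge ps, wedge (v # ps)) |ps. set ps \<subseteq> \<pp>}"
definition "A0 = cspan {(wedge ps, contract v ps) |ps. set ps \<subseteq> \<pp>}"
text \<open>Keeps the created and the annihilated vector for the same linear combination of wedge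
  products, so that the anticommutator can be evaluated before either operator is known to be a
  function.\<close>

definition "G3 = cspan {(wedge ps, wedge (v # ps), contract v ps) |ps. set ps \<subseteq> \<pp>}"

lemma csubspace_C0: "csubspace C0" and csubspace_A0: "csubspace A0" and csubspace_G3: "csubspace G3"
  unfolding C0_def A0_def G3_def by (rule complex_vector.subspace_span)+

lemma C0I: "set ps \<subseteq> \<pp> \<Longrightarrow> (wedge ps, wedge (v # ps)) \<in> C0"
  and A0I: "set ps \<subseteq> \<pp> \<Longrightarrow> (wedge ps, contract v ps) \<in> A0"
  and G3I: "set ps \<subseteq> \<pp> \<Longrightarrow> (wedge ps, wedge (v # ps), contract v ps) \<in> G3"
  unfolding C0_def A0_def G3_def by (rule complex_vector.span_base, blast)+

lemma C0_A0_adjoint: "(x, y) \<in> C0 \<Longrightarrow> (x', y') \<in> A0 \<Longrightarrow> cinner y x' = cinner x y'"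
  unfolding C0_def A0_def by (erule cspan_formal_adjoint[rotated]) (auto simp: cinner_wedge_Cons)

text \<open>The second component is the sum subtracted in \<open>contract_Cons\<close>, so it
  cancels in the anticommutator.\<close>

lemma C0_contract:
  assumes "set ps \<subseteq> \<pp>"
  shows "(contract v ps, \<Sum>r<length ps. ((-1) ^ r * cinner v (ps ! r)) *\<^sub>C wedge (v # omit r ps)) \<in>
    C0"
proof -
  have "(\<Sum>r<length ps. ((-1) ^ r * cinner v (ps ! r)) *\<^sub>C (wedge (omit r ps), wedge (v # omit r
    ps))) \<in> C0"
    using set_omit assms by (intro csubspace_sum csubspace_scale csubspace_C0 C0I) fastforce
  moreover have "(\<Sum>r<length ps. ((-1) ^ r * cinner v (ps ! r)) *\<^sub>C (wedge (omit r ps), wedge (v #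
    omit r ps)))
      = (contract v ps, \<Sum>r<length ps. ((-1) ^ r * cinner v (ps ! r)) *\<^sub>C wedge (v # omit r ps))"
    by (rule prod_eqI) (simp_all add: contract_def fst_sum snd_sum scaleC_prod_def)
  ultimately show ?thesis by simp
qed

text \<open>
  On the algebraic Fock space creation and annihilation are formally adjoint and satisfy
  \<open>c c\<^sup>* + c\<^sup>* c = \<parallel>v\<parallel>\<^sup>2\<close>; hence they are well defined and bounded.
\<close>

lemma G3_D:
  assumes "(x, y, z) \<in> G3"
  shows "(x, y) \<in> C0" "(x, z) \<in> A0" "\<exists>u w. (y, u) \<in> A0 \<and> (z, w) \<in> C0 \<and> u + w = cinner v v *\<^sub>C x"
proof -
  define V where "V = {t. (fst t, fst (snd t)) \<in> C0 \<and> (fst t, snd (snd t)) \<in> A0 \<and>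
    (\<exists>u w. (fst (snd t), u) \<in> A0 \<and> (snd (snd t), w) \<in> C0 \<and> u + w = cinner v v *\<^sub>C fst t)}"
  have zero: "(0, 0) \<in> C0" "(0, 0) \<in> A0"
    using csubspace_0[OF csubspace_C0] csubspace_0[OF csubspace_A0] by (simp_all add: zero_prod_def)
  have add: "(a + a', b + b') \<in> C0" if "(a, b) \<in> C0" "(a', b') \<in> C0" for a b a' b'
    using csubspace_add[OF csubspace_C0 that] by simp
  have add': "(a + a', b + b') \<in> A0" if "(a, b) \<in> A0" "(a', b') \<in> A0" for a b a' b'
    using csubspace_add[OF csubspace_A0 that] by simp
  have scale: "(c *\<^sub>C a, c *\<^sub>C b) \<in> C0" if "(a, b) \<in> C0" for a b c
    using csubspace_scale[OF csubspace_C0 that, of c] by (simp add: scaleC_prod_def)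
  have scale': "(c *\<^sub>C a, c *\<^sub>C b) \<in> A0" if "(a, b) \<in> A0" for a b c
    using csubspace_scale[OF csubspace_A0 that, of c] by (simp add: scaleC_prod_def)
  have "G3 \<subseteq> V"
    unfolding G3_def
  proof (rule complex_vector.span_minimal)
    show "csubspace V"
      unfolding complex_vector.subspace_def
    proof (intro conjI ballI allI)
      show "0 \<in> V" unfolding V_def using zero by (auto intro!: exI[of _ 0])
      show "s + t \<in> V" if st: "s \<in> V" "t \<in> V" for s t
      proof -
        obtain u w where uw: "(fst (snd s), u) \<in> A0" "(snd (snd s), w) \<in> C0"
          "u + w = cinner v v *\<^sub>C fst s"
          using st(1) unfolding V_def by blast
        obtain u' w' where uw': "(fst (snd t), u') \<in> A0" "(snd (snd t), w') \<in> C0"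
          "u' + w' = cinner v v *\<^sub>C fst t"
          using st(2) unfolding V_def by blast
        have "(u + u') + (w + w') = (u + w) + (u' + w')" by simp
        also have "\<dots> = cinner v v *\<^sub>C (fst s + fst t)" by (simp only: uw uw' scaleC_add_right)
        finally have eq: "(u + u') + (w + w') = cinner v v *\<^sub>C (fst s + fst t)" .
        have st': "(fst s, fst (snd s)) \<in> C0" "(fst s, snd (snd s)) \<in> A0"
          "(fst t, fst (snd t)) \<in> C0" "(fst t, snd (snd t)) \<in> A0"
          using st unfolding V_def by blast+
        show ?thesis
          unfolding V_def mem_Collect_eq fst_add snd_add
          using eq add[OF st'(1,3)] add'[OF st'(2,4)] add'[OF uw(1) uw'(1)] add[OF uw(2) uw'(2)]
            by blast
      qed
      show "c *\<^sub>C t \<in> V" if t: "t \<in> V" for c t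
      proof -
        obtain u w where uw: "(fst (snd t), u) \<in> A0" "(snd (snd t), w) \<in> C0"
          "u + w = cinner v v *\<^sub>C fst t"
          using t unfolding V_def by blast
        have eq: "c *\<^sub>C u + c *\<^sub>C w = cinner v v *\<^sub>C (c *\<^sub>C fst t)"
          unfolding scaleC_add_right[symmetric] uw by (simp add: scaleC_scaleC mult.commute)
        have t': "(fst t, fst (snd t)) \<in> C0" "(fst t, snd (snd t)) \<in> A0"
          using t unfolding V_def by blast+
        show ?thesis
          unfolding V_def mem_Collect_eq fst_scaleC snd_scaleC
          using eq scale[OF t'(1)] scale'[OF t'(2)] scale'[OF uw(1)] scale[OF uw(2)] by blast
      qed
    qed
    show "{(wedge ps, wedge (v # ps), contract v ps) |ps. set ps \<subseteq> \<pp>} \<subseteq> V"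
    proof clarify
      fix ps :: "'a list" assume ps: "set ps \<subseteq> \<pp>"
      have "(wedge (v # ps), contract v (v # ps)) \<in> A0" using ps v by (intro A0I) auto
      then show "(wedge ps, wedge (v # ps), contract v ps) \<in> V"
        unfolding V_def mem_Collect_eq fst_conv snd_conv
        by (intro conjI C0I[OF ps] A0I[OF ps] exI[of _ "contract v (v # ps)"] exI, assumption)
          (rule C0_contract[OF ps], simp add: contract_Cons)
    qed
  qed
  then have "(x, y, z) \<in> V" using assms by blast
  then show "(x, y) \<in> C0" "(x, z) \<in> A0" "\<exists>u w. (y, u) \<in> A0 \<and> (z, w) \<in> C0 \<and> u + w = cinner v v *\<^sub>C x"
    unfolding V_def by auto
qed

lemma G3_norm:
  assumes G: "(x, y, z) \<in> G3"
  shows "norm y \<le> norm v * norm x" "norm z \<le> norm v * norm x"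
proof -
  obtain u w where uw: "(y, u) \<in> A0" "(z, w) \<in> C0" "u + w = cinner v v *\<^sub>C x" using G3_D(3)[OF G]
    by blast
  have "cinner y y = cinner x u" by (rule C0_A0_adjoint[OF G3_D(1)[OF G] uw(1)])
  moreover have "cinner w x = cinner z z" by (rule C0_A0_adjoint[OF uw(2) G3_D(2)[OF G]])
  then have "cinner z z = cinner x w" using cinner_commute[of x w] by (simp add: cinner_self)
  ultimately have "cinner y y + cinner z z = cinner x (u + w)" by (simp add: cinner_add_right)
  also have "\<dots> = complex_of_real ((norm v)\<^sup>2 * (norm x)\<^sup>2)"
    unfolding uw(3) by (simp add: cinner_scaleC_right cinner_self)
  finally have "complex_of_real ((norm y)\<^sup>2 + (norm z)\<^sup>2) = complex_of_real ((norm v)\<^sup>2 * (norm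
    x)\<^sup>2)"
    by (simp add: cinner_self)
  then have eq: "(norm y)\<^sup>2 + (norm z)\<^sup>2 = (norm v * norm x)\<^sup>2"
    unfolding of_real_eq_iff by (simp add: power_mult_distrib)
  then have "(norm y)\<^sup>2 \<le> (norm v * norm x)\<^sup>2" "(norm z)\<^sup>2 \<le> (norm v * norm x)\<^sup>2"
    by (metis le_add_same_cancel1 zero_le_power2) (metis eq le_add_same_cancel2 zero_le_power2)
  then show "norm y \<le> norm v * norm x" "norm z \<le> norm v * norm x"
    by (auto intro: power2_le_imp_le)
qed

lemma G3_subspace:
  "(0, 0, 0) \<in> G3" "(x, y, z) \<in> G3 \<Longrightarrow> (x', y', z') \<in> G3 \<Longrightarrow> (x + x', y + y', z + z') \<in> G3"
  "(x, y, z) \<in> G3 \<Longrightarrow> (c *\<^sub>C x, c *\<^sub>C y, c *\<^sub>C z) \<in> G3"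
  using csubspace_0[OF csubspace_G3] csubspace_add[OF csubspace_G3, of "(x, y, z)" "(x', y', z')"]
    csubspace_scale[OF csubspace_G3, of "(x, y, z)" c]
  by (simp_all add: zero_prod_def scaleC_prod_def)

lemma C0_G3: assumes "(x, y) \<in> C0" shows "\<exists>z. (x, y, z) \<in> G3"
proof -
  have "C0 \<subseteq> {p. \<exists>z. (fst p, snd p, z) \<in> G3}"
    unfolding C0_def
  proof (rule complex_vector.span_minimal)
    show "csubspace {p. \<exists>z. (fst p, snd p, z) \<in> G3}"
      unfolding complex_vector.subspace_def mem_Collect_eq fst_add snd_add fst_scaleC snd_scaleC
        fst_zero snd_zero
      using G3_subspace by blast
  qed (clarsimp, blast intro: G3I)
  then have "(x, y) \<in> {p. \<exists>z. (fst p, snd p, z) \<in> G3}" using assms by blast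
  then show ?thesis by simp
qed

lemma A0_G3: assumes "(x, z) \<in> A0" shows "\<exists>y. (x, y, z) \<in> G3"
proof -
  have "A0 \<subseteq> {p. \<exists>y. (fst p, y, snd p) \<in> G3}"
    unfolding A0_def
  proof (rule complex_vector.span_minimal)
    show "csubspace {p. \<exists>y. (fst p, y, snd p) \<in> G3}"
      unfolding complex_vector.subspace_def mem_Collect_eq fst_add snd_add fst_scaleC snd_scaleC
        fst_zero snd_zero
      using G3_subspace by blast
  qed (clarsimp, blast intro: G3I)
  then have "(x, z) \<in> {p. \<exists>y. (fst p, y, snd p) \<in> G3}" using assms by blast
  then show ?thesis by simp
qed

lemma bounded_creation: "bounded_operator_on (fock \<pp>) (creation \<pp> v)"
  unfolding creation_def
proof (rule bounded_operator_on_wedges, fold C0_def)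
  show "norm y \<le> norm v * norm x" if "(x, y) \<in> C0" for x y
    using C0_G3[OF that] G3_norm by blast
qed (use v in \<open>auto intro!: wedge_in_fock\<close>)

lemma annihilation_eq: "annihilation \<pp> v = closure A0"
  unfolding annihilation_def A0_def contract_def omit_def ..

lemma bounded_annihilation: "bounded_operator_on (fock \<pp>) (annihilation \<pp> v)"
  unfolding annihilation_eq A0_def
proof (rule bounded_operator_on_wedges, fold A0_def)
  show "norm y \<le> norm v * norm x" if "(x, y) \<in> A0" for x y
    using A0_G3[OF that] G3_norm by blast
qed (rule subsetD[OF wspan_fock contract_in_wspan])

lemma norm_wedge_Cons_le: "set ps \<subseteq> \<pp> \<Longrightarrow> norm (wedge (v # ps)) \<le> norm v * norm (wedge ps)"
  using G3_norm(1)[OF G3I] .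

end

section \<open>The bounded operators on Fock space, their anticommutators and the parity\<close>

definition creat :: "'a::chilbert_space set \<Rightarrow> 'a \<Rightarrow> 'a list ell2 \<Rightarrow> 'a list ell2"
  where "creat \<pp> v = (SOME f. endo (fock \<pp>) f \<and> creation \<pp> v = graph (fock \<pp>) f)"

definition annih :: "'a::chilbert_space set \<Rightarrow> 'a \<Rightarrow> 'a list ell2 \<Rightarrow> 'a list ell2"
  where "annih \<pp> v = (SOME f. endo (fock \<pp>) f \<and> annihilation \<pp> v = graph (fock \<pp>) f)"

lemma creat: assumes "v \<in> \<pp>"
  shows "endo (fock \<pp>) (creat \<pp> v)" "creation \<pp> v = graph (fock \<pp>) (creat \<pp> v)"
proof -
  obtain f where "endo (fock \<pp>) f" "creation \<pp> v = graph (fock \<pp>) f"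
    using bounded_operator_on_imp_graph[OF closed_fock csubspace_fock bounded_creation[OF assms]]
      by blast
  then have "endo (fock \<pp>) (creat \<pp> v) \<and> creation \<pp> v = graph (fock \<pp>) (creat \<pp> v)"
    unfolding creat_def by (intro someI_ex[of
      "\<lambda>f. endo (fock \<pp>) f \<and> creation \<pp> v = graph (fock \<pp>) f"]) blast
  then show "endo (fock \<pp>) (creat \<pp> v)" "creation \<pp> v = graph (fock \<pp>) (creat \<pp> v)" by blast+
qed

lemma annih: assumes "v \<in> \<pp>"
  shows "endo (fock \<pp>) (annih \<pp> v)" "annihilation \<pp> v = graph (fock \<pp>) (annih \<pp> v)"
proof -
  obtain f where "endo (fock \<pp>) f" "annihilation \<pp> v = graph (fock \<pp>) f"
    using bounded_operator_on_imp_graph[OF closed_fock csubspace_fock bounded_annihilation[OF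
      assms]] by blast
  then have "endo (fock \<pp>) (annih \<pp> v) \<and> annihilation \<pp> v = graph (fock \<pp>) (annih \<pp> v)"
    unfolding annih_def by (intro someI_ex[of
      "\<lambda>f. endo (fock \<pp>) f \<and> annihilation \<pp> v = graph (fock \<pp>) f"]) blast
  then show "endo (fock \<pp>) (annih \<pp> v)" "annihilation \<pp> v = graph (fock \<pp>) (annih \<pp> v)" by blast+
qed

lemma creat_wedge: assumes "v \<in> \<pp>" "set ps \<subseteq> \<pp>" shows "creat \<pp> v (wedge ps) = wedge (v # ps)"
proof -
  have "(wedge ps, wedge (v # ps)) \<in> creation \<pp> v"
    unfolding creation_def using assms
    by (intro subsetD[OF closure_subset] complex_vector.span_base) blast
  then show ?thesis using creat(2)[OF assms(1)] by (simp add: graph_iff)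
qed

lemma annih_wedge: assumes "v \<in> \<pp>" "set ps \<subseteq> \<pp>" shows "annih \<pp> v (wedge ps) = contract v ps"
proof -
  have "(wedge ps, contract v ps) \<in> annihilation \<pp> v"
    unfolding annihilation_eq[OF assms(1)] by (rule subsetD[OF closure_subset A0I[OF assms]])
  then show ?thesis using annih(2)[OF assms(1)] by (simp add: graph_iff)
qed

lemma endo_sum:
  assumes "endo H f" shows "f (\<Sum>r\<in>A. c r *\<^sub>C x r) = (\<Sum>r\<in>A. c r *\<^sub>C f (x r))"
  by (induction A rule: infinite_finite_induct)
    (simp_all add: endo_zero[OF assms] endo_add[OF assms] endo_scaleC[OF assms])

text \<open>Two bounded maps are compared on wedge products; the multiple of the identity is there
  for anticommutators, and c = 0 covers plain anticommutation.\<close>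

lemma fock_eqI:
  assumes f: "endo (fock \<pp>) f" and g: "endo (fock \<pp>) g"
    and eq: "\<And>ps. set ps \<subseteq> \<pp> \<Longrightarrow> f (wedge ps) = c *\<^sub>C wedge ps + g (wedge ps)" and x: "x \<in> fock \<pp>"
  shows "f x = c *\<^sub>C x + g x"
proof -
  have "closed {x. f x = c *\<^sub>C x + g x}"
    by (rule closed_Collect_eq[OF linear_continuous_on linear_continuous_on])
      (intro bounded_linear_add bounded_linear_scaleC endo_bounded_linear[OF f]
        endo_bounded_linear[OF g])+
  moreover have "csubspace {x. f x = c *\<^sub>C x + g x}"
    by (auto simp: complex_vector.subspace_def endo_zero[OF f] endo_zero[OF g] endo_add[OF f]
      endo_add[OF g]
        endo_scaleC[OF f] endo_scaleC[OF g] scaleC_add_right scaleC_scaleC mult.commute)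
  ultimately have "fock \<pp> \<subseteq> {x. f x = c *\<^sub>C x + g x}" using eq by (intro fock_minimal) auto
  then show ?thesis using x by blast
qed

lemma fock_adjointI:
  assumes f: "endo (fock \<pp>) f" and g: "endo (fock \<pp>) g"
    and eq: "\<And>ps qs. set ps \<subseteq> \<pp> \<Longrightarrow> set qs \<subseteq> \<pp> \<Longrightarrow> cinner (f (wedge ps)) (wedge qs) = cinner (wedge
      ps) (g (wedge qs))"
  shows "adjoint_pair (fock \<pp>) f g"
proof -
  have 1: "fock \<pp> \<subseteq> {x. cinner (f x) (wedge qs) = cinner x (g (wedge qs))}" if qs: "set qs \<subseteq> \<pp>"
    for qs
  proof (rule fock_minimal)
    show "closed {x. cinner (f x) (wedge qs) = cinner x (g (wedge qs))}"
      by (intro closed_Collect_eq cinner.continuous_on linear_continuous_on[OF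
        endo_bounded_linear[OF f]] continuous_intros)
  qed (auto simp: complex_vector.subspace_def endo_zero[OF f] endo_add[OF f] endo_scaleC[OF f]
      cinner_add_left cinner_scaleC_left eq qs)
  have "fock \<pp> \<subseteq> {y. cinner (f x) y = cinner x (g y)}" if x: "x \<in> fock \<pp>" for x
  proof (rule fock_minimal)
    show "closed {y. cinner (f x) y = cinner x (g y)}"
      by (intro closed_Collect_eq cinner.continuous_on linear_continuous_on[OF
        endo_bounded_linear[OF g]] continuous_intros)
  qed (use 1 x in
    \<open>auto simp: complex_vector.subspace_def endo_zero[OF g] endo_add[OF g] endo_scaleC[OF g]
      cinner_add_right cinner_scaleC_right\<close>)
  then show ?thesis unfolding adjoint_pair_def by blast
qed

lemma creat_annih_adjoint: "v \<in> \<pp> \<Longrightarrow> adjoint_pair (fock \<pp>) (creat \<pp> v) (annih \<pp> v)"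
  by (rule fock_adjointI) (simp_all add: creat annih creat_wedge annih_wedge cinner_wedge_Cons)

lemma creat_creat:
  assumes v: "v \<in> \<pp>" and w: "w \<in> \<pp>" and x: "x \<in> fock \<pp>"
  shows "creat \<pp> v (creat \<pp> w x) = - creat \<pp> w (creat \<pp> v x)"
proof -
  have "creat \<pp> v (creat \<pp> w x) = 0 *\<^sub>C x + (-1) *\<^sub>C creat \<pp> w (creat \<pp> v x)"
    by (rule fock_eqI[OF endo_compose[OF creat(1)[OF v] creat(1)[OF w]]
          endo_scale[OF csubspace_fock endo_compose[OF creat(1)[OF w] creat(1)[OF v]]] _ x])
      (use v w in \<open>simp add: creat_wedge wedge_swap[of v w]\<close>)
  then show ?thesis by simp
qed

lemma annih_creat:
  assumes v: "v \<in> \<pp>" and w: "w \<in> \<pp>" and x: "x \<in> fock \<pp>"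
  shows "annih \<pp> v (creat \<pp> w x) = cinner v w *\<^sub>C x - creat \<pp> w (annih \<pp> v x)"
proof -
  have "annih \<pp> v (creat \<pp> w x) = cinner v w *\<^sub>C x + (-1) *\<^sub>C creat \<pp> w (annih \<pp> v x)"
  proof (rule fock_eqI[OF endo_compose[OF annih(1)[OF v] creat(1)[OF w]]
          endo_scale[OF csubspace_fock endo_compose[OF creat(1)[OF w] annih(1)[OF v]]] _ x])
    fix ps assume ps: "set ps \<subseteq> \<pp>"
    have "creat \<pp> w (contract v ps) = (\<Sum>r<length ps. ((-1) ^ r * cinner v (ps ! r)) *\<^sub>C wedge (w #
      omit r ps))"
      unfolding contract_def endo_sum[OF creat(1)[OF w]]
      using set_omit ps w by (intro sum.cong refl arg_cong2[where f = scaleC] creat_wedge)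
        fastforce+
    then show "annih \<pp> v (creat \<pp> w (wedge ps)) = cinner v w *\<^sub>C wedge ps + (-1) *\<^sub>C creat \<pp> w
      (annih \<pp> v (wedge ps))"
      using v w ps by (simp add: creat_wedge annih_wedge contract_Cons)
  qed
  then show ?thesis by simp
qed

text \<open>The adjoint of \<open>creat_creat\<close>, which avoids a double sum over omitted
  positions.\<close>

lemma annih_annih:
  assumes v: "v \<in> \<pp>" and w: "w \<in> \<pp>" and x: "x \<in> fock \<pp>"
  shows "annih \<pp> v (annih \<pp> w x) = - annih \<pp> w (annih \<pp> v x)"
proof (rule cinner_eqI_on[OF csubspace_fock endo_in[OF annih(1)[OF v]]])
  show "- annih \<pp> w (annih \<pp> v x) \<in> fock \<pp>"
    using csubspace_neg[OF csubspace_fock endo_in[OF annih(1)[OF w]]] .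
  fix y assume y: "y \<in> fock \<pp>"
  note A = adjoint_pairD[OF creat_annih_adjoint[OF v]] adjoint_pairD[OF creat_annih_adjoint[OF w]]
  note I = endo_in[OF annih(1)[OF v]] endo_in[OF annih(1)[OF w]] endo_in[OF creat(1)[OF v]]
    endo_in[OF creat(1)[OF w]]
  have "cinner y (annih \<pp> v (annih \<pp> w x)) = cinner (creat \<pp> w (creat \<pp> v y)) x"
    by (simp add: A I x y)
  also have "\<dots> = - cinner (creat \<pp> v (creat \<pp> w y)) x"
    by (simp add: creat_creat[OF w v y] cinner.minus_left)
  also have "cinner (creat \<pp> v (creat \<pp> w y)) x = cinner y (annih \<pp> w (annih \<pp> v x))"
    by (simp add: A I x y)
  finally show "cinner y (annih \<pp> v (annih \<pp> w x)) = cinner y (- annih \<pp> w (annih \<pp> v x))"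
    by (simp add: cinner.minus_right)
qed

text \<open>The parity operator turns the anticommutation of \<open>a(q)\<close> and \<open>a(q')\<close> into commutation.\<close>

definition parity :: "'a::chilbert_space set \<Rightarrow> 'a list ell2 \<Rightarrow> 'a list ell2"
  where "parity \<pp> = (SOME f. endo (fock \<pp>) f \<and> (\<forall>ps. set ps \<subseteq> \<pp> \<longrightarrow> f (wedge ps) = (-1) ^ length ps
    *\<^sub>C wedge ps))"

text \<open>The spanned relation is symmetric and, since signs square to 1, contained in its
  converse. Applying symmetry to (x, y) and (y, x) gives equal norms, hence a bounded
  operator.\<close>

lemma parity: "endo (fock \<pp>) (parity \<pp>)"
  "set ps \<subseteq> \<pp> \<Longrightarrow> parity \<pp> (wedge ps) = (-1) ^ length ps *\<^sub>C wedge ps"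
proof -
  define K where "K = cspan {(wedge ps, (-1) ^ length ps *\<^sub>C wedge ps) |ps. set ps \<subseteq> \<pp>}"
  have cs: "csubspace K" unfolding K_def by (rule complex_vector.subspace_span)
  have K_subspace: "(0, 0) \<in> K" "\<And>x y x' y'. (x, y) \<in> K \<Longrightarrow> (x', y') \<in> K \<Longrightarrow> (x + x', y + y') \<in> K"
    "\<And>c x y. (x, y) \<in> K \<Longrightarrow> (c *\<^sub>C x, c *\<^sub>C y) \<in> K"
    using csubspace_0[OF cs] csubspace_add[OF cs, of "(_, _)" "(_, _)"]
      csubspace_scale[OF cs, of "(_, _)"]
    by (simp_all add: zero_prod_def scaleC_prod_def)
  have KI: "(wedge ps, (-1) ^ length ps *\<^sub>C wedge ps) \<in> K" if "set ps \<subseteq> \<pp>" for ps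
    unfolding K_def by (rule complex_vector.span_base) (use that in blast)
  have swap: "K \<subseteq> {p. (snd p, fst p) \<in> K}"
    unfolding K_def
  proof (rule complex_vector.span_minimal, fold K_def)
    show "csubspace {p. (snd p, fst p) \<in> K}"
      unfolding complex_vector.subspace_def mem_Collect_eq fst_add snd_add fst_scaleC snd_scaleC
        fst_zero snd_zero
      using K_subspace by blast
    show "{(wedge ps, (-1) ^ length ps *\<^sub>C wedge ps) |ps. set ps \<subseteq> \<pp>} \<subseteq> {p. (snd p, fst p) \<in> K}"
    proof clarsimp
      fix ps assume "set ps \<subseteq> \<pp>"
      from csubspace_scale[OF cs KI[OF this], of "(-1) ^ length ps"]
      show "((-1) ^ length ps *\<^sub>C wedge ps, wedge ps) \<in> K"
        by (simp add: scaleC_prod_def scaleC_scaleC power_mult_distrib[symmetric])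
    qed
  qed
  have adj: "cinner y x' = cinner x y'" if "(x, y) \<in> K" "(x', y') \<in> K" for x y x' y'
    using that unfolding K_def
    by (rule cspan_formal_adjoint[rotated]) (auto simp: cinner_scaleC_left cinner_scaleC_right
      cinner_wedge)
  have norm: "norm y \<le> 1 * norm x" if "(x, y) \<in> K" for x y
  proof -
    have "(y, x) \<in> K" using swap that by auto
    from adj[OF that this] show ?thesis by (simp add: cinner_self del: of_real_power)
  qed
  have "bounded_operator_on (fock \<pp>) (closure K)"
    unfolding K_def
    by (rule bounded_operator_on_wedges, fold K_def)
      (auto intro: norm csubspace_scale[OF csubspace_fock] wedge_in_fock)
  then obtain f where f: "endo (fock \<pp>) f" "closure K = graph (fock \<pp>) f"
    using bounded_operator_on_imp_graph[OF closed_fock csubspace_fock] by blast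
  have "f (wedge ps) = (-1) ^ length ps *\<^sub>C wedge ps" if "set ps \<subseteq> \<pp>" for ps
    using subsetD[OF closure_subset KI[OF that]] f(2) by (simp add: graph_iff)
  then have "endo (fock \<pp>) (parity \<pp>) \<and> (\<forall>ps. set ps \<subseteq> \<pp> \<longrightarrow> parity \<pp> (wedge ps) = (-1) ^ length ps
    *\<^sub>C wedge ps)"
    unfolding parity_def using f(1)
    by (intro someI_ex[of
      "\<lambda>f. endo (fock \<pp>) f \<and> (\<forall>ps. set ps \<subseteq> \<pp> \<longrightarrow> f (wedge ps) = (-1) ^ length ps *\<^sub>C wedge ps)"])
        blast
  then show "endo (fock \<pp>) (parity \<pp>)"
    "set ps \<subseteq> \<pp> \<Longrightarrow> parity \<pp> (wedge ps) = (-1) ^ length ps *\<^sub>C wedge ps" by blast+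
qed

lemma parity_adjoint: "adjoint_pair (fock \<pp>) (parity \<pp>) (parity \<pp>)"
  by (rule fock_adjointI[OF parity(1) parity(1)])
    (auto simp: parity(2) cinner_scaleC_left cinner_scaleC_right cinner_wedge)

lemma parity_creat:
  assumes v: "v \<in> \<pp>" and x: "x \<in> fock \<pp>" shows "parity \<pp> (creat \<pp> v x) = - creat \<pp> v (parity \<pp> x)"
proof -
  have "parity \<pp> (creat \<pp> v x) = 0 *\<^sub>C x + (-1) *\<^sub>C creat \<pp> v (parity \<pp> x)"
    by (rule fock_eqI[OF endo_compose[OF parity(1) creat(1)[OF v]]
          endo_scale[OF csubspace_fock endo_compose[OF creat(1)[OF v] parity(1)]] _ x])
      (use v in \<open>simp add: creat_wedge parity(2) endo_scaleC[OF creat(1)[OF v]] scaleC_scaleC\<close>)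
  then show ?thesis by simp
qed

lemma parity_annih:
  assumes v: "v \<in> \<pp>" and x: "x \<in> fock \<pp>" shows "parity \<pp> (annih \<pp> v x) = - annih \<pp> v (parity \<pp> x)"
proof -
  have "parity \<pp> (annih \<pp> v x) = 0 *\<^sub>C x + (-1) *\<^sub>C annih \<pp> v (parity \<pp> x)"
  proof (rule fock_eqI[OF endo_compose[OF parity(1) annih(1)[OF v]]
          endo_scale[OF csubspace_fock endo_compose[OF annih(1)[OF v] parity(1)]] _ x])
    fix ps assume ps: "set ps \<subseteq> \<pp>"
    have "parity \<pp> (contract v ps) = (\<Sum>r<length ps. ((-1) ^ r * cinner v (ps ! r)) *\<^sub>C (- ((-1) ^
      length ps)) *\<^sub>C wedge (omit r ps))"
      unfolding contract_def endo_sum[OF parity(1)]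
    proof (intro sum.cong refl arg_cong2[where f = scaleC])
      fix r assume "r \<in> {..<length ps}"
      \<comment> \<open>Omitting one factor flips the parity, which is the sign in the
        claim.\<close>
      then have r: "length ps = Suc (length (omit r ps))" using length_omit[of r ps] by auto
      have "set (omit r ps) \<subseteq> \<pp>" using set_omit ps by fastforce
      then show "parity \<pp> (wedge (omit r ps)) = (- ((-1) ^ length ps)) *\<^sub>C wedge (omit r ps)"
        unfolding r by (simp add: parity(2))
    qed
    also have "\<dots> = (- ((-1) ^ length ps)) *\<^sub>C contract v ps"
      unfolding contract_def complex_vector.scale_sum_right by (simp add: scaleC_scaleC mult_ac)
    finally show "parity \<pp> (annih \<pp> v (wedge ps)) = 0 *\<^sub>C wedge ps + (-1) *\<^sub>C annih \<pp> v (parity \<pp>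
      (wedge ps))"
      using v ps by (simp add: annih_wedge parity(2) endo_scaleC[OF annih(1)[OF v]] scaleC_scaleC)
  qed
  then show ?thesis by simp
qed

lemma bounded_linear_wedge_Cons: "bounded_linear (\<lambda>u. wedge (u # ps))"
  using norm_wedge_Cons_le[of _ UNIV ps]
  by (intro bounded_linear_intro[of _ "norm (wedge ps)"]) (auto simp: wedge_add scaleR_scaleC
    wedge_scaleC)

section \<open>Closed adjoints and orthogonal complements\<close>

lemma closed_antilinear_adjoint_on:
  assumes "closed H" shows "closed (antilinear_adjoint_on H T)"
proof -
  have "p \<in> antilinear_adjoint_on H T \<longleftrightarrow>
      p \<in> (H \<times> H) \<inter> (\<Inter>t\<in>T. {p. cinner (snd p) (fst t) = cinner (snd t) (fst p)})" for p
    by (cases p) (simp add: antilinear_adjoint_on_def case_prod_beta)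
  then have "antilinear_adjoint_on H T = (H \<times> H) \<inter> (\<Inter>t\<in>T. {p. cinner (snd p) (fst t) = cinner (snd
    t) (fst p)})"
    by blast
  then show ?thesis
    by (simp, intro closed_Int closed_Times closed_INT ballI closed_Collect_eq cinner.continuous_on
        continuous_intros assms)
qed

lemma orth_complement_csubspace: "csubspace (orth_complement \<qq>)"
  by (auto simp: complex_vector.subspace_def orth_complement_def cinner_add_right
    cinner_scaleC_right)

lemma closed_orth_complement: "closed (orth_complement \<qq>)"
proof -
  have "orth_complement \<qq> = (\<Inter>h\<in>\<qq>. {f. cinner h f = 0})" by (auto simp: orth_complement_def)
  then show ?thesis
    by (simp, intro closed_INT ballI closed_Collect_eq cinner.continuous_on continuous_intros)
qed

lemma orth_complement_orth_complement:
  assumes "closed \<qq>" "csubspace \<qq>" shows "orth_complement (orth_complement \<qq>) = \<qq>"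
proof (intro equalityI subsetI)
  fix x assume "x \<in> \<qq>"
  then show "x \<in> orth_complement (orth_complement \<qq>)"
    using cinner_commute[of _ x] by (auto simp: orth_complement_def)
next
  fix x assume x: "x \<in> orth_complement (orth_complement \<qq>)"
  have pq: "proj \<qq> x \<in> \<qq>" by (rule proj_in[OF assms(1) csubspace_imp_subspace[OF assms(2)]])
  have d: "x - proj \<qq> x \<in> orth_complement \<qq>" using proj_corth(2)[OF assms]
    by (simp add: orth_complement_def)
  then have "cinner (x - proj \<qq> x) x = 0" using x by (simp add: orth_complement_def)
  moreover have "cinner (x - proj \<qq> x) (proj \<qq> x) = 0" by (rule proj_corth(1)[OF assms pq])
  ultimately have "cinner (x - proj \<qq> x) (x - proj \<qq> x) = 0"
    by (simp add: cinner.diff_right[of "x - proj \<qq> x" x "proj \<qq> x"])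
  then show "x \<in> \<qq>" using pq by (simp add: cinner_self)
qed

section \<open>The self-dual CAR algebra in the Fock representation\<close>

locale fock_representation =
  fixes \<Gamma> P :: "'a::chilbert_space \<Rightarrow> 'a"
  assumes \<Gamma>: "antiunitary_involution \<Gamma>" and P: "basis_projection \<Gamma> P"
begin

abbreviation "\<pp> \<equiv> range P"

lemma \<Gamma>_add: "\<Gamma> (f + h) = \<Gamma> f + \<Gamma> h" and \<Gamma>_scale: "\<Gamma> (c *\<^sub>C f) = cnj c *\<^sub>C \<Gamma> f"
  and \<Gamma>_\<Gamma>: "\<Gamma> (\<Gamma> f) = f" and \<Gamma>_cinner: "cinner (\<Gamma> f) (\<Gamma> h) = cinner h f"
  using \<Gamma> by (auto simp: antiunitary_involution_def)

lemma P_proj: "orthogonal_projection P" and P_\<Gamma>_P: "P f + \<Gamma> (P (\<Gamma> f)) = f"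
  using P by (auto simp: basis_projection_def)

lemma P_P: "P (P f) = P f" and P_sym: "cinner (P f) h = cinner f (P h)"
  using P_proj by (auto simp: orthogonal_projection_def)

lemma P_add: "P (f + h) = P f + P h" and P_scale: "P (c *\<^sub>C f) = c *\<^sub>C P f"
  by (rule cinner_eq_iff; simp add: P_sym cinner_add_left cinner_scaleC_left)+

lemma \<Gamma>_minus: "\<Gamma> (- f) = - \<Gamma> f" and P_minus: "P (- f) = - P f"
  using \<Gamma>_scale[of "-1" f] P_scale[of "-1" f] by simp_all

lemma \<Gamma>_diff: "\<Gamma> (f - h) = \<Gamma> f - \<Gamma> h" and P_diff: "P (f - h) = P f - P h"
  using \<Gamma>_add[of f "- h"] P_add[of f "- h"] by (simp_all add: \<Gamma>_minus P_minus)

lemma P_0: "P 0 = 0" and \<Gamma>_0: "\<Gamma> 0 = 0"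
  using P_scale[of 0 0] \<Gamma>_scale[of 0 0] by simp_all

lemma P_\<Gamma>: "P (\<Gamma> f) = \<Gamma> f - \<Gamma> (P f)"
  using arg_cong[OF P_\<Gamma>_P[of f], of \<Gamma>] by (simp add: \<Gamma>_add \<Gamma>_\<Gamma> algebra_simps)

lemma in_\<pp>: "x \<in> \<pp> \<longleftrightarrow> P x = x"
  using P_P by (metis rangeE rangeI)

lemma csubspace_\<pp>: "csubspace \<pp>"
  by (auto simp: complex_vector.subspace_def in_\<pp> P_add P_scale P_0)

lemma closed_\<pp>: "closed \<pp>"
proof -
  have "(norm (P x))\<^sup>2 \<le> norm x * norm (P x)" for x
  proof -
    have "complex_of_real ((norm (P x))\<^sup>2) = cinner x (P x)"
      by (simp only: cinner_self[symmetric] P_sym P_P)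
    then have "(norm (P x))\<^sup>2 = cmod (cinner x (P x))" by (metis norm_of_real abs_power2)
    then show ?thesis using norm_cinner_le[of x "P x"] by simp
  qed
  then have "norm (P x) \<le> norm x * 1" for x
    by (cases "norm (P x) = 0") (simp_all add: power2_eq_square mult_le_cancel_right)
  then have "bounded_linear P"
    by (intro bounded_linear_intro[of P 1]) (auto simp: P_add P_scale scaleR_scaleC)
  then have "closed {x. P x = x}"
    by (intro closed_Collect_eq linear_continuous_on continuous_on_id)
  also have "{x. P x = x} = \<pp>" using in_\<pp> by blast
  finally show ?thesis .
qed

abbreviation "\<FF> \<equiv> fock \<pp>"

definition field_map :: "'a \<Rightarrow> 'a list ell2 \<Rightarrow> 'a list ell2"
  where "field_map f x = creat \<pp> (P (\<Gamma> f)) x + annih \<pp> (P f) x"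

lemma endo_field_map: "endo \<FF> (field_map f)"
  unfolding field_map_def by (intro endo_plus csubspace_fock creat annih) auto

lemma field_operator_eq: "field_operator \<Gamma> P f = graph \<FF> (field_map f)"
  unfolding field_operator_def field_map_def graph_def
  using creat(2)[of "P (\<Gamma> f)" \<pp>] annih(2)[of "P f" \<pp>] by (auto simp: graph_def)

lemma field_map_wedge:
  "set ps \<subseteq> \<pp> \<Longrightarrow> field_map f (wedge ps) = wedge (P (\<Gamma> f) # ps) + contract (P f) ps"
  by (simp add: field_map_def creat_wedge annih_wedge)

lemma field_map_vacuum: "field_map f vacuum = wedge [P (\<Gamma> f)]"
  using field_map_wedge[of "[]" f] by (simp add: vacuum_def contract_Nil)

lemma vacuum_in: "vacuum \<in> \<FF>"
  unfolding vacuum_def by (rule wedge_in_fock) simp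

lemma field_map_adjoint: "adjoint_pair \<FF> (field_map f) (field_map (\<Gamma> f))"
  unfolding adjoint_pair_def
proof (intro ballI)
  fix x y assume xy: "x \<in> \<FF>" "y \<in> \<FF>"
  have 1: "cinner (creat \<pp> (P (\<Gamma> f)) x) y = cinner x (annih \<pp> (P (\<Gamma> f)) y)"
    by (rule adjoint_pairD[OF creat_annih_adjoint xy]) simp
  have 2: "cinner (annih \<pp> (P f) x) y = cinner x (creat \<pp> (P f) y)"
    by (rule adjoint_pairD[OF adjoint_pair_sym[OF creat_annih_adjoint] xy]) simp
  show "cinner (field_map f x) y = cinner x (field_map (\<Gamma> f) y)"
    by (simp add: field_map_def cinner_add_left cinner_add_right \<Gamma>_\<Gamma> 1 2)
qed

lemma field_map_CAR:
  assumes x: "x \<in> \<FF>"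
  shows "field_map f (field_map h x) + field_map h (field_map f x) = cinner f (\<Gamma> h) *\<^sub>C x"
proof -
  have in_p: "P (\<Gamma> f) \<in> \<pp>" "P f \<in> \<pp>" "P (\<Gamma> h) \<in> \<pp>" "P h \<in> \<pp>" by auto
  note add = endo_add[OF creat(1)] endo_add[OF annih(1)]
  \<comment> \<open>The two scalars from annihilation against creation are the parts of <f, \<Gamma>
    h> belonging to P and to its complement \<Gamma> P \<Gamma>.\<close>
  have "cinner (P f) (P (\<Gamma> h)) = cinner f (\<Gamma> h) - cinner f (\<Gamma> (P h))"
    by (simp add: P_sym P_P P_\<Gamma> cinner.diff_right)
  moreover have "cinner (P h) (P (\<Gamma> f)) = cinner f (\<Gamma> (P h))"
    using \<Gamma>_cinner[of "\<Gamma> f" "P h"] by (simp add: \<Gamma>_\<Gamma> P_sym[symmetric] P_P)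
  ultimately have c: "cinner f (\<Gamma> h) = cinner (P f) (P (\<Gamma> h)) + cinner (P h) (P (\<Gamma> f))" by simp
  show ?thesis
    unfolding c scaleC_add_left
    by (simp add: field_map_def add in_p creat_creat[OF in_p(1,3) x] annih_annih[OF in_p(2,4) x]
      annih_creat[OF in_p(2,3) x] annih_creat[OF in_p(4,1) x])
qed

lemma parity_field_map: "x \<in> \<FF> \<Longrightarrow> parity \<pp> (field_map f x) = - field_map f (parity \<pp> x)"
  by (simp add: field_map_def endo_add[OF parity(1)] parity_creat parity_annih)

text \<open>
  Cyclicity of the vacuum: up to shorter wedge products, \<open>a(f)\<close> prepends the factor \<open>P \<Gamma> f\<close>.
\<close>

lemma field_map_cyclic:
  assumes V: "closed V" "csubspace V" and vac: "vacuum \<in> V"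
    and inv: "\<And>f ps. f \<in> \<qq> \<Longrightarrow> set ps \<subseteq> \<pp> \<Longrightarrow> wedge ps \<in> V \<Longrightarrow> field_map f (wedge ps) \<in> V"
    and dense: "\<pp> \<subseteq> closure ((\<lambda>f. P (\<Gamma> f)) ` \<qq>)"
  shows "\<FF> \<subseteq> V"
proof (rule fock_minimal[OF V])
  fix ps :: "'a list" assume "set ps \<subseteq> \<pp>"
  then show "wedge ps \<in> V"
  proof (induction "length ps" arbitrary: ps rule: less_induct)
    case less
    show ?case
    proof (cases ps)
      case Nil
      then show ?thesis using vac by (simp add: vacuum_def)
    next
      case (Cons v rs)
      have rs: "set rs \<subseteq> \<pp>" "v \<in> \<pp>" using less.prems Cons by auto
      have "wedge rs \<in> V" using less.hyps[of rs] rs Cons by simp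
      have "wedge (omit r rs) \<in> V" if "r < length rs" for r
        using less.hyps[of "omit r rs"] that rs set_omit[of r rs] Cons by (auto simp: length_omit)
      then have "contract w rs \<in> V" for w
        unfolding contract_def by (intro csubspace_sum csubspace_scale V) auto
      then have "wedge (P (\<Gamma> f) # rs) \<in> V" if "f \<in> \<qq>" for f
        using csubspace_diff[OF V(2) inv[OF that rs(1) \<open>wedge rs \<in> V\<close>], of "contract (P f) rs"]
        by (simp add: field_map_wedge[OF rs(1)])
      \<comment> \<open>The first factor enters continuously, so density extends membership in V
        from the vectors P \<Gamma> f to the given v.\<close>
      then have "(\<lambda>f. P (\<Gamma> f)) ` \<qq> \<subseteq> (\<lambda>u. wedge (u # rs)) -` V" by auto
      moreover have "closed ((\<lambda>u. wedge (u # rs)) -` V)"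
        by (intro closed_vimage V linear_continuous_on bounded_linear_wedge_Cons)
      ultimately have "closure ((\<lambda>f. P (\<Gamma> f)) ` \<qq>) \<subseteq> (\<lambda>u. wedge (u # rs)) -` V"
        by (rule closure_minimal)
      then show ?thesis using dense rs(2) Cons by blast
    qed
  qed
qed

end

section \<open>The one-particle operators \<alpha> and \<beta>\<close>

locale standard_subspace = fock_representation \<Gamma> P for \<Gamma> P :: "'a::chilbert_space \<Rightarrow> 'a" +
  fixes \<qq> :: "'a set"
  assumes closed_\<qq>: "closed \<qq>" and csubspace_\<qq>: "csubspace \<qq>" and \<Gamma>_\<qq>: "f \<in> \<qq> \<Longrightarrow> \<Gamma> f \<in> \<qq>"
    and generic: "generic_position \<pp> \<qq>"
begin

abbreviation "\<rr> \<equiv> orth_complement \<qq>"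

definition "\<beta> = {(P f, P (\<Gamma> f)) |f. f \<in> \<qq>}"
definition "\<alpha> = {(P f, - P (\<Gamma> f)) |f. f \<in> \<rr>}"

lemma \<Gamma>_\<rr>: "f \<in> \<rr> \<Longrightarrow> \<Gamma> f \<in> \<rr>"
  unfolding orth_complement_def
proof (intro CollectI ballI)
  fix h assume f: "f \<in> {f. \<forall>h\<in>\<qq>. cinner h f = 0}" and h: "h \<in> \<qq>"
  have "cinner h (\<Gamma> f) = cinner f (\<Gamma> h)" using \<Gamma>_cinner[of "\<Gamma> h" f] by (simp add: \<Gamma>_\<Gamma>)
  also have "\<dots> = 0" using f \<Gamma>_\<qq>[OF h] cinner_commute[of f "\<Gamma> h"] by simp
  finally show "cinner h (\<Gamma> f) = 0" .
qed

lemma orth_\<rr>: "orth_complement \<rr> = \<qq>"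
  by (rule orth_complement_orth_complement[OF closed_\<qq> csubspace_\<qq>])

lemma P_zero_orth: "P f = 0 \<Longrightarrow> f \<in> orth_complement \<pp>"
  by (auto simp: orth_complement_def P_sym)

text \<open>The assumptions are symmetric in \<qq> and its complement, so each result for \<beta>
  and the density of its domain also hold on the complementary side.\<close>

lemma standard_subspace_\<rr>: "standard_subspace \<Gamma> P \<rr>"
proof
  show "closed \<rr>" "csubspace \<rr>" by (rule closed_orth_complement orth_complement_csubspace)+
  show "generic_position \<pp> \<rr>" using generic unfolding generic_position_def orth_\<rr> by auto
qed (rule \<Gamma>_\<rr>)

text \<open>A vector of \<pp> orthogonal to P \<qq> is orthogonal to \<qq> itself, and generic
  position makes it 0.\<close>

lemma dense_P: "\<pp> \<subseteq> closure (P ` \<qq>)"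
proof (rule cdense_if_orth_trivial[OF csubspace_\<pp> closed_\<pp>])
  show "csubspace (P ` \<qq>)" by (rule csubspace_image[OF csubspace_\<qq> P_add P_scale])
  fix z assume z: "z \<in> \<pp>" "\<And>y. y \<in> P ` \<qq> \<Longrightarrow> cinner z y = 0"
  have "cinner h z = 0" if "h \<in> \<qq>" for h
  proof -
    have "cinner z h = cinner (P z) h" using z by (simp add: in_\<pp>)
    also have "\<dots> = 0" using z(2) that by (simp add: P_sym)
    finally show ?thesis using cinner_commute[of h z] by simp
  qed
  then have "z \<in> \<pp> \<inter> \<rr>" using z by (simp add: orth_complement_def)
  then show "z = 0" using generic unfolding generic_position_def by blast
qed auto

lemma dense_P_\<Gamma>: "\<pp> \<subseteq> closure ((\<lambda>f. P (\<Gamma> f)) ` \<qq>)"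
proof -
  have "P ` \<qq> \<subseteq> (\<lambda>f. P (\<Gamma> f)) ` \<qq>"
  proof
    fix x assume "x \<in> P ` \<qq>"
    then obtain f where "f \<in> \<qq>" "x = P f" by blast
    then show "x \<in> (\<lambda>f. P (\<Gamma> f)) ` \<qq>" by (intro image_eqI[of _ _ "\<Gamma> f"]) (simp_all add: \<Gamma>_\<Gamma> \<Gamma>_\<qq>)
  qed
  then show ?thesis using dense_P closure_mono by blast
qed

lemma \<beta>_adjoint: "antilinear_adjoint_on \<pp> \<beta> = \<alpha>"
proof (intro equalityI subsetI)
  fix p assume "p \<in> antilinear_adjoint_on \<pp> \<beta>"
  then obtain x z where p: "p = (x, z)" "x \<in> \<pp>" "z \<in> \<pp>"
    and adj: "\<And>f. f \<in> \<qq> \<Longrightarrow> cinner z (P f) = cinner (P (\<Gamma> f)) x"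
    unfolding \<beta>_def by (cases p) (auto simp: antilinear_adjoint_on_iff)
  \<comment> \<open>P \<Gamma> vanishes on \<pp>, so g is sent to the pair (x, z) by construction;
    only its orthogonality to \<qq> has to be derived from the adjoint relation.\<close>
  define g where "g = x - \<Gamma> z"
  have xz: "P x = x" "P z = z" using p by (simp_all add: in_\<pp>)
  have "\<Gamma> x - z \<in> \<rr>"
    unfolding orth_complement_def
  proof (intro CollectI ballI)
    fix h assume h: "h \<in> \<qq>"
    have "cinner z h = cinner z (P h)" using P_sym[of z h] xz by simp
    also have "\<dots> = cinner (\<Gamma> h) x" using adj[OF h] P_sym[of "\<Gamma> h" x] xz by simp
    also have "\<dots> = cinner (\<Gamma> x) h" using \<Gamma>_cinner[of "\<Gamma> h" x] \<Gamma>_cinner[of x "\<Gamma> h"]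
      by (simp add: \<Gamma>_\<Gamma>)
    finally have "cinner (\<Gamma> x - z) h = 0" by (simp add: cinner.diff_left)
    then show "cinner h (\<Gamma> x - z) = 0" using cinner_commute[of h "\<Gamma> x - z"] by simp
  qed
  then have "g \<in> \<rr>" using \<Gamma>_\<rr>[of "\<Gamma> x - z"] by (simp add: g_def \<Gamma>_diff \<Gamma>_\<Gamma>)
  moreover have "P g = x" by (simp add: g_def P_diff P_\<Gamma> xz)
  moreover have "- P (\<Gamma> g) = z" by (simp add: g_def \<Gamma>_diff \<Gamma>_\<Gamma> P_diff P_\<Gamma> xz)
  ultimately show "p \<in> \<alpha>" using p unfolding \<alpha>_def by blast
next
  fix p assume "p \<in> \<alpha>"
  then obtain g where g: "p = (P g, - P (\<Gamma> g))" "g \<in> \<rr>" unfolding \<alpha>_def by blast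
  have "cinner (- P (\<Gamma> g)) (P f) = cinner (P (\<Gamma> f)) (P g)" if f: "f \<in> \<qq>" for f
  proof -
    have "cinner (P (\<Gamma> f)) (P g) = cinner (\<Gamma> f - \<Gamma> (P f)) g"
      by (simp add: P_sym[symmetric] P_P) (simp add: P_\<Gamma>)
    also have "\<dots> = cinner (\<Gamma> f) g - cinner (\<Gamma> g) (P f)"
      using \<Gamma>_cinner[of "P f" "\<Gamma> g"] by (simp add: cinner.diff_left \<Gamma>_\<Gamma>)
    also have "cinner (\<Gamma> f) g = 0" using g \<Gamma>_\<qq>[OF f] by (simp add: orth_complement_def)
    also have "cinner (\<Gamma> g) (P f) = cinner (P (\<Gamma> g)) (P f)" by (simp add: P_sym P_P)
    finally show ?thesis by (simp add: cinner.minus_left)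
  qed
  then show "p \<in> antilinear_adjoint_on \<pp> \<beta>"
    unfolding g(1) \<beta>_def antilinear_adjoint_on_iff using P_minus[of "\<Gamma> g"]
      by (auto simp: in_\<pp> P_P P_minus)
qed

end

context standard_subspace
begin

interpretation R: standard_subspace \<Gamma> P \<rr>
  by (rule standard_subspace_\<rr>)

text \<open>Up to sign \<alpha> is the operator \<beta> of the complement, whose adjoint is the
  operator \<alpha> of the double complement \<qq>; the two signs cancel.\<close>

lemma \<alpha>_adjoint: "antilinear_adjoint_on \<pp> \<alpha> = \<beta>"
proof -
  have "\<alpha> = {(y, - w) |y w. (y, w) \<in> R.\<beta>}" unfolding \<alpha>_def R.\<beta>_def by auto
  then have "(x, z) \<in> antilinear_adjoint_on \<pp> \<alpha> \<longleftrightarrow> (x, - z) \<in> antilinear_adjoint_on \<pp> R.\<beta>" for x z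
  proof -
    have "- z \<in> \<pp> \<longleftrightarrow> z \<in> \<pp>"
      using csubspace_neg[OF csubspace_\<pp>, of z] csubspace_neg[OF csubspace_\<pp>, of "- z"]
      by auto
    moreover have "cinner z y = cinner (- w) x \<longleftrightarrow> cinner (- z) y = cinner w x" for y w
      by (auto simp: cinner.minus_left minus_equation_iff)
    moreover have "(\<forall>y w. (y, w) \<in> \<alpha> \<longrightarrow> cinner z y = cinner w x) \<longleftrightarrow>
        (\<forall>y w. (y, w) \<in> R.\<beta> \<longrightarrow> cinner z y = cinner (- w) x)"
      unfolding \<open>\<alpha> = _\<close> by blast
    ultimately show ?thesis unfolding antilinear_adjoint_on_iff by simp
  qed
  then have "(x, z) \<in> antilinear_adjoint_on \<pp> \<alpha> \<longleftrightarrow> (x, z) \<in> \<beta>" for x z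
    unfolding R.\<beta>_adjoint R.\<alpha>_def \<beta>_def orth_\<rr> by auto
  then show ?thesis by auto
qed

lemma antilinear_involution_\<beta>: "antilinear_involution \<pp> \<beta>"
proof
  show "closed \<pp>" "csubspace \<pp>" by (rule closed_\<pp> csubspace_\<pp>)+
  show "closed \<beta>" unfolding \<alpha>_adjoint[symmetric] by (rule closed_antilinear_adjoint_on[OF closed_\<pp>])
  have "Domain \<beta> = P ` \<qq>" unfolding \<beta>_def by auto
  then show "densely_defined_on \<pp> \<beta>" unfolding densely_defined_on_def using dense_P by simp
  show "(y, x) \<in> \<beta>" if xy: "(x, y) \<in> \<beta>" for x y
  proof -
    obtain f where "f \<in> \<qq>" "x = P f" "y = P (\<Gamma> f)" using xy unfolding \<beta>_def by blast
    then show ?thesis unfolding \<beta>_def by (intro CollectI exI[of _ "\<Gamma> f"]) (simp add: \<Gamma>_\<Gamma> \<Gamma>_\<qq>)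
  qed
  show "antilinear_operator_on \<pp> \<beta>"
    unfolding antilinear_operator_on_def
  proof (intro conjI)
    show "\<beta> \<subseteq> \<pp> \<times> \<pp>" unfolding \<beta>_def by auto
    show "single_valued \<beta>"
    proof (rule single_valuedI)
      fix x y z assume "(x, y) \<in> \<beta>" "(x, z) \<in> \<beta>"
      then obtain f g where fg: "f \<in> \<qq>" "g \<in> \<qq>" "x = P f" "P f = P g" "y = P (\<Gamma> f)" "z = P (\<Gamma> g)"
        unfolding \<beta>_def by blast
      \<comment> \<open>Single-valuedness is injectivity of P on \<qq>, one of the four trivial
        intersections.\<close>
      then have "f - g \<in> orth_complement \<pp> \<inter> \<qq>"
        using P_zero_orth[of "f - g"] csubspace_diff[OF csubspace_\<qq>] by (simp add: P_diff)
      then have "f - g = 0" using generic unfolding generic_position_def by blast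
      then show "y = z" using fg by simp
    qed
    show "(0, 0) \<in> \<beta>" unfolding \<beta>_def using csubspace_0[OF csubspace_\<qq>]
      by (intro CollectI exI[of _ 0]) (simp add: P_0 \<Gamma>_0)
    show "\<forall>(x, y)\<in>\<beta>. \<forall>(x', y')\<in>\<beta>. (x + x', y + y') \<in> \<beta>"
    proof clarify
      fix x y x' y' assume "(x, y) \<in> \<beta>" "(x', y') \<in> \<beta>"
      then obtain f g where fg: "f \<in> \<qq>" "g \<in> \<qq>" "x = P f" "y = P (\<Gamma> f)" "x' = P g" "y' = P (\<Gamma> g)"
        unfolding \<beta>_def by blast
      then show "(x + x', y + y') \<in> \<beta>" unfolding \<beta>_def
        by (intro CollectI exI[of _ "f + g"]) (simp add: P_add \<Gamma>_add csubspace_add[OF csubspace_\<qq>])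
    qed
    show "\<forall>c. \<forall>(x, y)\<in>\<beta>. (c *\<^sub>C x, cnj c *\<^sub>C y) \<in> \<beta>"
    proof clarify
      fix c x y assume "(x, y) \<in> \<beta>"
      then obtain f where fg: "f \<in> \<qq>" "x = P f" "y = P (\<Gamma> f)" unfolding \<beta>_def by blast
      then show "(c *\<^sub>C x, cnj c *\<^sub>C y) \<in> \<beta>" unfolding \<beta>_def
        by (intro CollectI exI[of _ "c *\<^sub>C f"]) (simp add: P_scale \<Gamma>_scale csubspace_scale[OF
          csubspace_\<qq>])
    qed
  qed
qed

interpretation O: antilinear_involution \<pp> \<beta>
  by (rule antilinear_involution_\<beta>)

lemma graph_\<Delta>:
  assumes Q: "orthogonal_projection Q" "range Q = \<qq>"
  shows "\<beta> O \<alpha> = {(P (Q p), P (p - Q p)) |p. p \<in> \<pp>}"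
proof -
  have T: "O.T = \<beta> O \<alpha>" by (simp add: O.T_def \<beta>_adjoint)
  have in_T: "(P (Q p), P (p - Q p)) \<in> O.T" if p: "p \<in> \<pp>" for p
  proof -
    have Qp: "Q p \<in> \<qq>" using Q(2) by blast
    have "cinner h (p - Q p) = 0" if h: "h \<in> \<qq>" for h
    proof -
      obtain k where "h = Q k" using h Q(2) by blast
      then show ?thesis using Q(1) by (simp add: orthogonal_projection_def cinner.diff_right)
    qed
    then have "p - Q p \<in> \<rr>" by (simp add: orth_complement_def)
    \<comment> \<open>This vector starts the \<alpha>-pair at P \<Gamma> Q p: the contribution of p
      itself drops out because P \<Gamma> p = 0.\<close>
    then have g: "- \<Gamma> (p - Q p) \<in> \<rr>" using \<Gamma>_\<rr> csubspace_neg[OF orth_complement_csubspace] by blast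
    have "P (\<Gamma> p) = 0" using p by (simp add: P_\<Gamma> in_\<pp>)
    then have "P (- \<Gamma> (p - Q p)) = P (\<Gamma> (Q p))" by (simp add: P_minus P_diff \<Gamma>_diff)
    moreover have "- P (\<Gamma> (- \<Gamma> (p - Q p))) = P (p - Q p)" by (simp add: P_minus \<Gamma>_minus \<Gamma>_\<Gamma> P_diff)
    ultimately have "(P (\<Gamma> (Q p)), P (p - Q p)) \<in> \<alpha>" unfolding \<alpha>_def using g
      by (metis (mono_tags, lifting) mem_Collect_eq)
    moreover have "(P (Q p), P (\<Gamma> (Q p))) \<in> \<beta>" unfolding \<beta>_def using Qp by blast
    ultimately show ?thesis unfolding T by blast
  qed
  show ?thesis
    unfolding T[symmetric]
  proof (intro equalityI subsetI)
    fix t assume "t \<in> O.T"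
    then obtain a b where t: "t = (a, b)" "(a, b) \<in> O.T" by (cases t) simp
    \<comment> \<open>A pair in the graph is determined by its sum w through the resolvent, so it
      coincides with the explicit pair for p = w.\<close>
    define w where "w = a + b"
    have "w \<in> \<pp>" unfolding w_def using t(2) O.T.T_sub csubspace_add[OF csubspace_\<pp>] by blast
    then have "P w = w" by (simp add: in_\<pp>)
    have "O.B (P (Q w) + P (w - Q w)) = P (Q w)" by (rule O.T.B_eq[OF in_T[OF \<open>w \<in> \<pp>\<close>]])
    moreover have "P (Q w) + P (w - Q w) = w" using \<open>P w = w\<close> by (simp add: P_diff)
    moreover have "O.B w = a" unfolding w_def by (rule O.T.B_eq[OF t(2)])
    ultimately have "a = P (Q w)" by simp
    moreover from this have "b = P (w - Q w)" using \<open>P (Q w) + P (w - Q w) = w\<close> unfolding w_def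
      by (metis add_left_cancel)
    ultimately show "t \<in> {(P (Q p), P (p - Q p)) |p. p \<in> \<pp>}" using t \<open>w \<in> \<pp>\<close> by blast
  qed (use in_T in blast)
qed

lemma \<Delta>_selfadjoint: "selfadjoint_on \<pp> (\<beta> O \<alpha>)" and \<Delta>_positive: "positive_operator (\<beta> O \<alpha>)"
  using O.T_selfadjoint O.T_positive by (simp_all add: O.T_def \<beta>_adjoint)

lemma \<Delta>_converse: "(\<beta> O \<alpha>)\<inverse> = \<alpha> O \<beta>" and \<Delta>_converse_sv: "single_valued (\<alpha> O \<beta>)"
proof -
  have "\<beta>\<inverse> = \<beta>" unfolding set_eq_iff split_paired_All converse_iff using O.S_swap by blast
  moreover have "\<alpha>\<inverse> = \<alpha>"
    unfolding set_eq_iff split_paired_All converse_iff using O.adj_swap unfolding \<beta>_adjoint by blast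
  ultimately show "(\<beta> O \<alpha>)\<inverse> = \<alpha> O \<beta>" by (simp add: converse_relcomp)
  show "single_valued (\<alpha> O \<beta>)"
    by (rule single_valuedI) (use O.S_sv O.adj_sv in \<open>unfold \<beta>_adjoint, blast\<close>)
qed

section \<open>The vacuum is cyclic and separating\<close>

lemma field_map_orth_commute:
  assumes f: "f \<in> \<qq>" and g: "g \<in> \<rr>" and x: "x \<in> \<FF>"
  shows "field_map f (parity \<pp> (field_map g x)) = parity \<pp> (field_map g (field_map f x))"
proof -
  have "cinner f (\<Gamma> g) = 0" using f \<Gamma>_\<rr>[OF g] by (simp add: orth_complement_def)
  then have "field_map f (field_map g x) = - field_map g (field_map f x)"
    using field_map_CAR[OF x, of f g] by (simp add: add_eq_0_iff2)
  moreover have "field_map f (parity \<pp> (field_map g x)) = - parity \<pp> (field_map f (field_map g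
    x))" using parity_field_map[OF endo_in[OF endo_field_map], of f g x] by simp
  ultimately show ?thesis by (simp add: endo_minus[OF parity(1)])
qed

lemma commutant_field_map: assumes g: "g \<in> \<rr>"
  shows "(\<lambda>x. parity \<pp> (field_map g x)) \<in> commutant \<FF> (field_map ` \<qq>)"
  unfolding commutant_def
    using endo_compose[OF parity(1) endo_field_map] field_map_orth_commute[OF _ g] by auto

lemma orbit_invariant:
  assumes X: "\<And>f. f \<in> X \<Longrightarrow> endo \<FF> f" and g: "g \<in> commutant \<FF> X"
    and x: "x \<in> closure ((\<lambda>g. g vacuum) ` commutant \<FF> X)"
  shows "g x \<in> closure ((\<lambda>g. g vacuum) ` commutant \<FF> X)"
proof -
  let ?V = "(\<lambda>g. g vacuum) ` commutant \<FF> X"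
  have "?V \<subseteq> g -` closure ?V"
  proof
    fix y assume "y \<in> ?V"
    then obtain h where h: "y = h vacuum" "h \<in> commutant \<FF> X" by blast
    have "g y \<in> ?V" unfolding h(1) by (rule image_eqI[OF refl commutant_compose[OF g h(2)]])
    then have "g y \<in> closure ?V" by (rule subsetD[OF closure_subset])
    then show "y \<in> g -` closure ?V" by simp
  qed
  moreover have "closed (g -` closure ?V)"
    by (intro closed_vimage closed_closure linear_continuous_on endo_bounded_linear[OF
      commutant_endo[OF g]])
  ultimately have "closure ?V \<subseteq> g -` closure ?V" by (rule closure_minimal)
  then show ?thesis using x by blast
qed

lemma vacuum_in_orbit:
  assumes X: "\<And>f. f \<in> X \<Longrightarrow> endo \<FF> f"
  shows "vacuum \<in> closure ((\<lambda>g. g vacuum) ` commutant \<FF> X)"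
proof -
  have id: "proj \<FF> x = x" if "x \<in> \<FF>" for x
    by (rule proj_id[OF closed_fock csubspace_imp_subspace[OF csubspace_fock] that])
  \<comment> \<open>The projection represents the identity of \<FF>, since maps in
    \<open>endo\<close> take all values in \<FF>.\<close>
  have "proj \<FF> \<in> commutant \<FF> X"
    unfolding commutant_def using endo_proj[OF closed_fock csubspace_fock] endo_in[OF X]
      by (auto simp: id)
  then have "vacuum \<in> (\<lambda>g. g vacuum) ` commutant \<FF> X"
    by (rule image_eqI[rotated]) (simp add: id vacuum_in)
  then show ?thesis by (rule subsetD[OF closure_subset])
qed

lemma cyclic_separating: "cyclic_separating \<FF> (field_map ` \<qq>) vacuum"
proof
  show "closed \<FF>" "csubspace \<FF>" "vacuum \<in> \<FF>" by (rule closed_fock csubspace_fock vacuum_in)+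
  show "\<exists>f'\<in>field_map ` \<qq>. endo \<FF> f' \<and> endo \<FF> f \<and> adjoint_pair \<FF> f f'" if f: "f \<in> field_map ` \<qq>"
    for f
    using f endo_field_map field_map_adjoint \<Gamma>_\<qq> by blast
  have X: "endo \<FF> f" if "f \<in> field_map ` \<qq>" for f using that endo_field_map by blast
  have X': "endo \<FF> f" if "f \<in> commutant \<FF> (field_map ` \<qq>)" for f using that by (rule commutant_endo)
  show "\<FF> \<subseteq> closure ((\<lambda>g. g vacuum) ` commutant \<FF> (commutant \<FF> (field_map ` \<qq>)))"
  proof (rule field_map_cyclic[OF closed_closure closure_csubspace[OF commutant_orbit_csubspace[OF
    csubspace_fock X']] vacuum_in_orbit[OF X'] _ dense_P_\<Gamma>])
    fix f ps assume f: "f \<in> \<qq>"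
      and ps: "wedge ps \<in> closure ((\<lambda>g. g vacuum) ` commutant \<FF> (commutant \<FF> (field_map ` \<qq>)))"
    have *: "field_map f \<in> commutant \<FF> (commutant \<FF> (field_map ` \<qq>))" using f endo_field_map
      unfolding commutant_def by auto
    show "field_map f (wedge ps) \<in> closure ((\<lambda>g. g vacuum) ` commutant \<FF> (commutant \<FF> (field_map `
      \<qq>)))"
      by (rule orbit_invariant[OF X' * ps])
  qed
  let ?V = "closure ((\<lambda>g. g vacuum) ` commutant \<FF> (field_map ` \<qq>))"
  have cs: "csubspace ?V"
    by (rule closure_csubspace[OF commutant_orbit_csubspace[OF csubspace_fock X]])
  show "\<FF> \<subseteq> ?V"
  proof (rule field_map_cyclic[OF closed_closure cs vacuum_in_orbit[OF X] _ R.dense_P_\<Gamma>])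
    fix g ps assume g: "g \<in> \<rr>" and ps: "set ps \<subseteq> \<pp>" "wedge ps \<in> ?V"
    have "parity \<pp> (field_map g (wedge ps)) \<in> ?V"
      by (rule orbit_invariant[OF X commutant_field_map[OF g] ps(2)])
    \<comment> \<open>On a wedge product the parity amounts to a sign, so invariance under the
      commuting operator gives invariance under the field operator itself.\<close>
    also have "parity \<pp> (field_map g (wedge ps)) = - ((-1) ^ length ps *\<^sub>C field_map g (wedge ps))"
      using parity_field_map[OF wedge_in_fock[OF ps(1)], of g]
        by (simp add: parity(2)[OF ps(1)] endo_scaleC[OF endo_field_map])
    finally have "(- ((-1) ^ length ps)) *\<^sub>C (- ((-1) ^ length ps *\<^sub>C field_map g (wedge ps))) \<in> ?V"
      by (rule csubspace_scale[OF cs])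
    then show "field_map g (wedge ps) \<in> ?V"
      by (simp add: scaleC_scaleC power_mult_distrib[symmetric])
  qed
qed

section \<open>The modular conjugation on the one-particle space\<close>

interpretation F: cyclic_separating \<FF> "field_map ` \<qq>" vacuum
  by (rule cyclic_separating)

lemma field_algebra_eq: "field_algebra \<Gamma> P \<qq> = graph \<FF> ` F.M"
proof -
  have "field_operator \<Gamma> P ` \<qq> = graph \<FF> ` field_map ` \<qq>"
    by (simp add: field_operator_eq image_image)
  moreover have "commutant_on \<FF> (graph \<FF> ` field_map ` \<qq>) = graph \<FF> ` F.N"
    unfolding F.N_def by (rule commutant_on_graph[OF closed_fock csubspace_fock]) (use
      endo_field_map in blast)
  moreover have "commutant_on \<FF> (graph \<FF> ` F.N) = graph \<FF> ` F.M"
    unfolding F.M_def by (rule commutant_on_graph[OF closed_fock csubspace_fock F.N_endo])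
  ultimately show ?thesis unfolding field_algebra_def by simp
qed

lemma modular_conjugation_one_particle:
  assumes xy: "(x, y) \<in> O.J"
  shows "(wedge [x], wedge [y]) \<in> modular_conjugation \<FF> (field_algebra \<Gamma> P \<qq>) vacuum"
proof -
  interpret S: antilinear_involution \<FF> "closure F.S0" by (rule F.antilinear_involution_tomita)
  have M: "modular_conjugation \<FF> (field_algebra \<Gamma> P \<qq>) vacuum = S.J"
    unfolding field_algebra_eq by (rule S.modular_conjugation_eq[OF F.tomita_eq])
  show ?thesis
    unfolding M
  proof (rule modular_transfer[OF antilinear_involution_\<beta> F.antilinear_involution_tomita
    bounded_linear_wedge_Cons _ _ _ xy])
    show "wedge [x] \<in> \<FF>" if "x \<in> \<pp>" for x using that by (intro wedge_in_fock) simp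
  next
    fix x y assume "(x, y) \<in> \<beta>"
    then obtain f where f: "f \<in> \<qq>" "x = P f" "y = P (\<Gamma> f)" unfolding \<beta>_def by blast
    \<comment> \<open>The field operator of f creates P \<Gamma> f from the vacuum, so the operator
      for x = P f is that of \<Gamma> f, and its adjoint creates y.\<close>
    have "(field_map (\<Gamma> f) vacuum, field_map f vacuum) \<in> closure F.S0"
    proof (rule F.in_S0)
      show "field_map (\<Gamma> f) \<in> F.M" "field_map f \<in> F.M" using f \<Gamma>_\<qq> by (auto intro: F.in_M)
      show "adjoint_pair \<FF> (field_map (\<Gamma> f)) (field_map f)" using field_map_adjoint[of "\<Gamma> f"]
        by (simp add: \<Gamma>_\<Gamma>)
    qed
    then show "(wedge [x], wedge [y]) \<in> closure F.S0" by (simp add: field_map_vacuum \<Gamma>_\<Gamma> f)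
  next
    fix x y assume "(x, y) \<in> antilinear_adjoint_on \<pp> \<beta>"
    then obtain g where g: "g \<in> \<rr>" "x = P g" "y = - P (\<Gamma> g)" unfolding \<beta>_adjoint \<alpha>_def by blast
    \<comment> \<open>Applied to the vacuum, the field operator of h creates -P g and parity
      restores the sign, giving x. In the adjoint parity acts first, trivially on the vacuum, and
      the field operator of \<Gamma> h creates P h = y.\<close>
    define h where "h = - \<Gamma> g"
    have h: "h \<in> \<rr>" using \<Gamma>_\<rr>[OF g(1)] csubspace_neg[OF orth_complement_csubspace]
      by (simp add: h_def)
    let ?G = "\<lambda>x. parity \<pp> (field_map h x)" and ?G' = "\<lambda>x. field_map (\<Gamma> h) (parity \<pp> x)"
    have G: "?G \<in> F.N" unfolding F.N_def by (rule commutant_field_map[OF h])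
    have adj: "adjoint_pair \<FF> ?G ?G'"
      unfolding adjoint_pair_def
      by (simp add: adjoint_pairD[OF parity_adjoint] adjoint_pairD[OF field_map_adjoint]
        endo_in[OF endo_field_map] endo_in[OF parity(1)])
    have G': "?G' \<in> F.N"
      using commutant_adjoint[OF csubspace_fock F.X_adj G[unfolded F.N_def] endo_compose[OF
        endo_field_map parity(1)] adj] unfolding F.N_def .
    have minus: "wedge [- v] = - wedge [v]" for v :: 'a using wedge_scaleC[of "-1" v "[]"] by simp
    have "?G vacuum = wedge [x]"
      by (simp add: field_map_vacuum parity(2) h_def \<Gamma>_minus \<Gamma>_\<Gamma> P_minus minus g endo_minus[OF
        parity(1)])
    moreover have "?G' vacuum = wedge [y]"
      using parity(2)[of "[]" \<pp>]
        by (simp add: field_map_vacuum \<Gamma>_\<Gamma> h_def P_minus g flip: vacuum_def)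
    ultimately show "(wedge [x], wedge [y]) \<in> antilinear_adjoint_on \<FF> (closure F.S0)"
      using F.adjoint_tomita[OF G G' adj] by simp
  qed
qed

lemma modular_conjugation_formula:
  assumes f: "f \<in> \<qq>"
  shows "\<exists>y. (P (\<Gamma> f), y) \<in> sqrt_on \<pp> (\<beta> O \<alpha>) \<and>
    (wedge [P f], wedge [y]) \<in> modular_conjugation \<FF> (field_algebra \<Gamma> P \<qq>) vacuum"
proof -
  have T: "O.T = \<beta> O \<alpha>" by (simp add: O.T_def \<beta>_adjoint)
  have "(P f, P (\<Gamma> f)) \<in> \<beta>" unfolding \<beta>_def using f by blast
  then have "(P (\<Gamma> f), P f) \<in> O.T.R O O.J" using O.S_swap equalityD1[OF O.polar] by blast
  then obtain y where y: "(P (\<Gamma> f), y) \<in> O.T.R" "(y, P f) \<in> O.J" by blast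
  have "(P (\<Gamma> f), y) \<in> sqrt_on \<pp> (\<beta> O \<alpha>)" using y(1) unfolding T[symmetric] O.T.sqrt_on_eq .
  then show ?thesis using modular_conjugation_one_particle[OF O.J_swap[OF y(2)]] by blast
qed

end

theorem theorem4p9:
  fixes \<Gamma> P Q :: "'a::chilbert_space \<Rightarrow> 'a"
    and \<pp> \<qq> :: "'a set"
    and \<alpha> \<beta> \<Delta> :: "('a \<times> 'a) set"
  assumes "antiunitary_involution \<Gamma>"
    and "basis_projection \<Gamma> P" and "\<pp> = range P"
    and "closed \<qq>" and "csubspace \<qq>" and "\<Gamma> ` \<qq> \<subseteq> \<qq>"
    and "orthogonal_projection Q" and "range Q = \<qq>"
    and "generic_position \<pp> \<qq>"
    and "\<beta> = {(P q, P (\<Gamma> q)) |q. q \<in> \<qq>}"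
    and "\<alpha> = {(P q', - P (\<Gamma> q')) |q'. q' \<in> orth_complement \<qq>}"
    and "\<Delta> = \<beta> O antilinear_adjoint_on \<pp> \<beta>"
  shows "(linear_operator_on \<pp> \<Delta> \<and> densely_defined_on \<pp> \<Delta> \<and>
      positive_operator \<Delta> \<and> selfadjoint_on \<pp> \<Delta>) \<and>
    \<Delta> = {(P (Q p), P (p - Q p)) |p. p \<in> \<pp>} \<and>
    single_valued (\<Delta>\<inverse>) \<and>
    \<Delta>\<inverse> = antilinear_adjoint_on \<pp> \<beta> O \<beta> \<and>
    \<Delta>\<inverse> = \<alpha> O antilinear_adjoint_on \<pp> \<alpha> \<and>
    (\<forall>q\<in>\<qq>. \<exists>y. (P (\<Gamma> q), y) \<in> sqrt_on \<pp> \<Delta> \<and>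
      (wedge [P q], wedge [y]) \<in> modular_conjugation (fock \<pp>) (field_algebra \<Gamma> P \<qq>) vacuum)"
proof -
  interpret S: standard_subspace \<Gamma> P \<qq>
    by standard (use assms in auto)
  have \<beta>: "\<beta> = S.\<beta>" and \<alpha>: "\<alpha> = S.\<alpha>"
    using assms(10,11) by (simp_all add: S.\<beta>_def S.\<alpha>_def)
  have \<Delta>: "\<Delta> = S.\<beta> O S.\<alpha>"
    unfolding assms(12) \<beta> assms(3) S.\<beta>_adjoint ..
  note eqs = assms(3) \<beta> \<alpha> \<Delta>
  have sa: "selfadjoint_on (range P) (S.\<beta> O S.\<alpha>)" by (rule S.\<Delta>_selfadjoint)
  then have "linear_operator_on (range P) (S.\<beta> O S.\<alpha>)" "densely_defined_on (range P) (S.\<beta> O S.\<alpha>)"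
    by (simp_all add: selfadjoint_on_def)
  then show ?thesis
    unfolding eqs S.\<beta>_adjoint S.\<alpha>_adjoint S.\<Delta>_converse
    using sa S.\<Delta>_positive S.graph_\<Delta>[OF assms(7,8)] S.\<Delta>_converse_sv S.modular_conjugation_formula
    by blast
qed

end
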